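(* Let $\mathcal{A}$ be a small 2-category and let $\mathcal{E}:\mathcal{A}^{op}\to\mathcal{T}op$ be a 2-functor, $A\mapsto\mathcal{E}_A$, with inverse image functors $u^*:\mathcal{E}_A\to\mathcal{E}_B$ for $u:A\to B$ in $\mathcal{A}$. Then there exists a 2-functor $\mathcal{C}:\mathcal{A}^{op}\to\mathcal{S}it$, $A\mapsto\mathcal{C}_A$, such that: (i) for every $A\in\mathcal{A}$, $\mathcal{C}_A$ is a small full generating subcategory of $\mathcal{E}_A$ closed under finite limits, considered as a site with the canonical topology; (ii) the arrows and the 2-cells in the diagram $\mathcal{C}$ are the restrictions of those in the diagram $\mathcal{E}$: for every 2-cell $\gamma:u\Rightarrow v:A\to B$ in $\mathcal{A}$, denoting by $i_A:\mathcal{C}_A\hookrightarrow\mathcal{E}_A$ the inclusions and by the same symbols $u^*,v^*,\gamma$ the functors and natural transformations given by $\mathcal{E}$ and by $\mathcal{C}$, one has (strictly) $u^*i_A=i_Bu^*$, $v^*i_A=i_Bv^*$ and $\gamma\, i_A=i_B\,\gamma$.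
   Context: A 2-category is a $\mathcal{C}at$-enriched category ($\mathcal{C}at$ the category of small categories), and 2-functors are $\mathcal{C}at$-enriched functors (strict). $\mathcal{A}^{op}$ is obtained from $\mathcal{A}$ by reversing both arrows and 2-cells. A site is a category with finite limits, with a Grothendieck topology and a small set of objects such that every object can be covered by objects from this set (topological generators). $\mathcal{S}it^*$ is the 2-category of sites, with arrows $\mathcal{C}\to\mathcal{D}$ the continuous (cover-preserving) exact (finite-limit-preserving) functors, and 2-cells the natural transformations. $\mathcal{S}it$ is obtained by reversing arrows and 2-cells: $\mathcal{S}it(\mathcal{D},\mathcal{C})=\mathcal{S}it^*(\mathcal{C},\mathcal{D})^{op}$. A (Grothendieck) topos is a category equivalent to the category of sheaves on a site; topoi are regarded as sites with the canonical topology. $\mathcal{T}op$ is the 2-category of topoi and geometric morphisms $f=(f^*\dashv f_* )$ ($f^*$ exact), with 2-cells $f\Rightarrow g$ the natural transformations $g^*\Rightarrow f^*$ (equivalently the corresponding transformations of direct images). Thus, for a 2-functor $\mathcal{E}:\mathcal{A}^{op}\to\mathcal{T}op$, a 2-cell $\gamma:u\Rightarrow v:A\to B$ in $\mathcal{A}$ gives a natural transformation $\gamma:u^*\Rightarrow v^*:\mathcal{E}_A\to\mathcal{E}_B$, and inverse images satisfy $(vu)^*=v^*u^*$. Likewise a 2-functor $\mathcal{A}^{op}\to\mathcal{S}it$ is the same as a 2-functor $\mathcal{A}\to\mathcal{S}it^*$. For a full generating subcategory $\mathcal{C}_A\subset\mathcal{E}_A$, "the canonical topology" means the one induced by the canonical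 topology of $\mathcal{E}_A$: coverings are the families that are jointly epimorphic in $\mathcal{E}_A$. *)

theory Defs
  imports "HOL-Library.FuncSet"
begin

unbundle cardinal_syntax

section \<open>Smallness\<close>

text \<open>
  Sizes are measured against a fixed set \<open>U\<close> whose cardinality is uncountable and strongly
  inaccessible, like that of a Grothendieck universe. A set, of any type, is small if it has fewer
  elements than \<open>U\<close>; up to bijection, the small sets are the subsets of \<open>U\<close> with fewer elements
  than \<open>U\<close>.
\<close>

definition universe :: "'u set \<Rightarrow> bool" where
  "universe U \<longleftrightarrow> natLeq <o |U| \<and> regularCard |U| \<and>
     (\<forall>X :: 'u set. |X| <o |U| \<longrightarrow> |Pow X| <o |U| )"

definition small :: "'u set \<Rightarrow> 'b set \<Rightarrow> bool" where
  "small U X \<longleftrightarrow> |X| <o |U|"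


section \<open>Categories, functors, natural transformations\<close>

text \<open>\<open>Comp C g f\<close> is \<open>g\<close> after \<open>f\<close>.\<close>

record ('o, 'a) cat =
  Obj :: "'o set"
  Arr :: "'a set"
  Dom :: "'a \<Rightarrow> 'o"
  Cod :: "'a \<Rightarrow> 'o"
  Ident :: "'o \<Rightarrow> 'a"
  Comp :: "'a \<Rightarrow> 'a \<Rightarrow> 'a"

definition Hom :: "('o, 'a) cat \<Rightarrow> 'o \<Rightarrow> 'o \<Rightarrow> 'a set" where
  "Hom C X Y = {f \<in> Arr C. Dom C f = X \<and> Cod C f = Y}"

locale category =
  fixes C :: "('o, 'a) cat"
  assumes Dom_in: "f \<in> Arr C \<Longrightarrow> Dom C f \<in> Obj C"
    and Cod_in: "f \<in> Arr C \<Longrightarrow> Cod C f \<in> Obj C"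
    and Ident_in: "X \<in> Obj C \<Longrightarrow> Ident C X \<in> Hom C X X"
    and Comp_in: "\<lbrakk>f \<in> Hom C X Y; g \<in> Hom C Y Z\<rbrakk> \<Longrightarrow> Comp C g f \<in> Hom C X Z"
    and Comp_Ident: "f \<in> Hom C X Y \<Longrightarrow> Comp C f (Ident C X) = f"
    and Ident_Comp: "f \<in> Hom C X Y \<Longrightarrow> Comp C (Ident C Y) f = f"
    and Comp_assoc: "\<lbrakk>f \<in> Hom C W X; g \<in> Hom C X Y; h \<in> Hom C Y Z\<rbrakk>
      \<Longrightarrow> Comp C h (Comp C g f) = Comp C (Comp C h g) f"

definition op_cat :: "('o, 'a) cat \<Rightarrow> ('o, 'a) cat" where
  "op_cat C = \<lparr>Obj = Obj C, Arr = Arr C, Dom = Cod C, Cod = Dom C, Ident = Ident C,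
     Comp = (\<lambda>g f. Comp C f g)\<rparr>"

definition prod_cat :: "('o, 'a) cat \<Rightarrow> ('p, 'b) cat \<Rightarrow> ('o \<times> 'p, 'a \<times> 'b) cat" where
  "prod_cat C D = \<lparr>Obj = Obj C \<times> Obj D, Arr = Arr C \<times> Arr D,
     Dom = map_prod (Dom C) (Dom D), Cod = map_prod (Cod C) (Cod D),
     Ident = map_prod (Ident C) (Ident D),
     Comp = (\<lambda>(g, k) (f, h). (Comp C g f, Comp D k h))\<rparr>"

definition full_subcat :: "('o, 'a) cat \<Rightarrow> 'o set \<Rightarrow> ('o, 'a) cat" where
  "full_subcat C S = C\<lparr>Obj := Obj C \<inter> S, Arr := {f \<in> Arr C. Dom C f \<in> S \<and> Cod C f \<in> S}\<rparr>"

text \<open>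
  Object and arrow maps of functors, and component families of natural transformations, take the
  value \<open>undefined\<close> outside their domain. Hence two functors or transformations are equal in HOL
  if and only if they are equal as functors or transformations.
\<close>

record ('o, 'a, 'p, 'b) ftor =
  fob :: "'o \<Rightarrow> 'p"
  far :: "'a \<Rightarrow> 'b"

locale cat_functor = source: category C + target: category D
  for C :: "('o, 'a) cat" and D :: "('p, 'b) cat" +
  fixes F :: "('o, 'a, 'p, 'b) ftor"
  assumes fob_ext: "fob F \<in> extensional (Obj C)"
    and far_ext: "far F \<in> extensional (Arr C)"
    and fob_in: "X \<in> Obj C \<Longrightarrow> fob F X \<in> Obj D"
    and far_in: "f \<in> Hom C X Y \<Longrightarrow> far F f \<in> Hom D (fob F X) (fob F Y)"
    and far_Ident: "X \<in> Obj C \<Longrightarrow> far F (Ident C X) = Ident D (fob F X)"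
    and far_Comp: "\<lbrakk>f \<in> Hom C X Y; g \<in> Hom C Y Z\<rbrakk>
      \<Longrightarrow> far F (Comp C g f) = Comp D (far F g) (far F f)"

definition id_ftor :: "('o, 'a) cat \<Rightarrow> ('o, 'a, 'o, 'a) ftor" where
  "id_ftor C = \<lparr>fob = (\<lambda>X\<in>Obj C. X), far = (\<lambda>f\<in>Arr C. f)\<rparr>"

text \<open>The inclusion into a category of its subcategory \<open>C\<close> has the same maps as \<open>id_ftor C\<close>.\<close>

abbreviation inclusion :: "('o, 'a) cat \<Rightarrow> ('o, 'a, 'o, 'a) ftor" where
  "inclusion C \<equiv> id_ftor C"

text \<open>\<open>G\<close> after \<open>F\<close>, for \<open>F\<close> with domain \<open>C\<close>.\<close>

definition ftor_comp :: "('o, 'a) cat \<Rightarrow> ('p, 'b, 'q, 'c) ftor \<Rightarrow> ('o, 'a, 'p, 'b) ftor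
    \<Rightarrow> ('o, 'a, 'q, 'c) ftor" where
  "ftor_comp C G F = \<lparr>fob = (\<lambda>X\<in>Obj C. fob G (fob F X)), far = (\<lambda>f\<in>Arr C. far G (far F f))\<rparr>"

record ('o, 'a, 'p, 'b) ntrans =
  nsrc :: "('o, 'a, 'p, 'b) ftor"
  ntgt :: "('o, 'a, 'p, 'b) ftor"
  ncmp :: "'o \<Rightarrow> 'b"

locale nat_trans = nsrc: cat_functor C D "nsrc \<alpha>" + ntgt: cat_functor C D "ntgt \<alpha>"
  for C :: "('o, 'a) cat" and D :: "('p, 'b) cat" and \<alpha> :: "('o, 'a, 'p, 'b) ntrans" +
  assumes ncmp_ext: "ncmp \<alpha> \<in> extensional (Obj C)"
    and ncmp_in: "X \<in> Obj C \<Longrightarrow> ncmp \<alpha> X \<in> Hom D (fob (nsrc \<alpha>) X) (fob (ntgt \<alpha>) X)"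
    and naturality: "f \<in> Hom C X Y
      \<Longrightarrow> Comp D (ncmp \<alpha> Y) (far (nsrc \<alpha>) f) = Comp D (far (ntgt \<alpha>) f) (ncmp \<alpha> X)"

definition id_ntrans :: "('o, 'a) cat \<Rightarrow> ('p, 'b) cat \<Rightarrow> ('o, 'a, 'p, 'b) ftor
    \<Rightarrow> ('o, 'a, 'p, 'b) ntrans" where
  "id_ntrans C D F = \<lparr>nsrc = F, ntgt = F, ncmp = (\<lambda>X\<in>Obj C. Ident D (fob F X))\<rparr>"

definition vcomp :: "('o, 'a) cat \<Rightarrow> ('p, 'b) cat \<Rightarrow> ('o, 'a, 'p, 'b) ntrans
    \<Rightarrow> ('o, 'a, 'p, 'b) ntrans \<Rightarrow> ('o, 'a, 'p, 'b) ntrans" where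
  "vcomp C D \<beta> \<alpha> = \<lparr>nsrc = nsrc \<alpha>, ntgt = ntgt \<beta>,
     ncmp = (\<lambda>X\<in>Obj C. Comp D (ncmp \<beta> X) (ncmp \<alpha> X))\<rparr>"

text \<open>
  Horizontal composite of \<open>\<alpha> : F \<Rightarrow> F' : C \<rightarrow> D\<close> and \<open>\<beta> : G \<Rightarrow> G' : D \<rightarrow> E\<close>, with component
  \<open>\<beta> (F' X) \<circ> G (\<alpha> X)\<close> at \<open>X\<close>.
\<close>

definition hcomp :: "('o, 'a) cat \<Rightarrow> ('q, 'c) cat \<Rightarrow> ('p, 'b, 'q, 'c) ntrans
    \<Rightarrow> ('o, 'a, 'p, 'b) ntrans \<Rightarrow> ('o, 'a, 'q, 'c) ntrans" where
  "hcomp C E \<beta> \<alpha> = \<lparr>nsrc = ftor_comp C (nsrc \<beta>) (nsrc \<alpha>), ntgt = ftor_comp C (ntgt \<beta>) (ntgt \<alpha>),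
     ncmp = (\<lambda>X\<in>Obj C. Comp E (ncmp \<beta> (fob (ntgt \<alpha>) X)) (far (nsrc \<beta>) (ncmp \<alpha> X)))\<rparr>"

text \<open>The whiskerings \<open>\<alpha> F\<close> and \<open>G \<alpha>\<close>; \<open>C\<close> is the domain of the composite functors.\<close>

definition whisker_right :: "('o, 'a) cat \<Rightarrow> ('p, 'b, 'q, 'c) ntrans \<Rightarrow> ('o, 'a, 'p, 'b) ftor
    \<Rightarrow> ('o, 'a, 'q, 'c) ntrans" where
  "whisker_right C \<alpha> F = \<lparr>nsrc = ftor_comp C (nsrc \<alpha>) F, ntgt = ftor_comp C (ntgt \<alpha>) F,
     ncmp = (\<lambda>X\<in>Obj C. ncmp \<alpha> (fob F X))\<rparr>"

definition whisker_left :: "('o, 'a) cat \<Rightarrow> ('p, 'b, 'q, 'c) ftor \<Rightarrow> ('o, 'a, 'p, 'b) ntrans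
    \<Rightarrow> ('o, 'a, 'q, 'c) ntrans" where
  "whisker_left C G \<alpha> = \<lparr>nsrc = ftor_comp C G (nsrc \<alpha>), ntgt = ftor_comp C G (ntgt \<alpha>),
     ncmp = (\<lambda>X\<in>Obj C. far G (ncmp \<alpha> X))\<rparr>"

definition functor_cat :: "('o, 'a) cat \<Rightarrow> ('p, 'b) cat
    \<Rightarrow> (('o, 'a, 'p, 'b) ftor, ('o, 'a, 'p, 'b) ntrans) cat" where
  "functor_cat C D = \<lparr>Obj = {F. cat_functor C D F}, Arr = {\<alpha>. nat_trans C D \<alpha>},
     Dom = nsrc, Cod = ntgt, Ident = id_ntrans C D, Comp = vcomp C D\<rparr>"

definition iso_arrow :: "('o, 'a) cat \<Rightarrow> 'a \<Rightarrow> bool" where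
  "iso_arrow C f \<longleftrightarrow> f \<in> Arr C \<and> (\<exists>g \<in> Hom C (Cod C f) (Dom C f).
     Comp C g f = Ident C (Dom C f) \<and> Comp C f g = Ident C (Cod C f))"

definition equivalent_cats :: "('o, 'a) cat \<Rightarrow> ('p, 'b) cat \<Rightarrow> bool" where
  "equivalent_cats C D \<longleftrightarrow> (\<exists>F G \<eta> \<epsilon>. cat_functor C D F \<and> cat_functor D C G \<and>
     \<eta> \<in> Hom (functor_cat C C) (id_ftor C) (ftor_comp C G F) \<and> iso_arrow (functor_cat C C) \<eta> \<and>
     \<epsilon> \<in> Hom (functor_cat D D) (ftor_comp D F G) (id_ftor D) \<and> iso_arrow (functor_cat D D) \<epsilon>)"

text \<open>\<open>L : C \<rightarrow> D\<close> is left adjoint to \<open>R : D \<rightarrow> C\<close>: a unit and a counit satisfying the triangle identities.\<close>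

definition left_adjoint :: "('o, 'a) cat \<Rightarrow> ('p, 'b) cat \<Rightarrow> ('o, 'a, 'p, 'b) ftor
    \<Rightarrow> ('p, 'b, 'o, 'a) ftor \<Rightarrow> bool" where
  "left_adjoint C D L R \<longleftrightarrow> cat_functor C D L \<and> cat_functor D C R \<and>
     (\<exists>\<eta> \<epsilon>. \<eta> \<in> Hom (functor_cat C C) (id_ftor C) (ftor_comp C R L) \<and>
        \<epsilon> \<in> Hom (functor_cat D D) (ftor_comp D L R) (id_ftor D) \<and>
        (\<forall>X \<in> Obj C. Comp D (ncmp \<epsilon> (fob L X)) (far L (ncmp \<eta> X)) = Ident D (fob L X)) \<and>
        (\<forall>Y \<in> Obj D. Comp C (far R (ncmp \<epsilon> Y)) (ncmp \<eta> (fob R Y)) = Ident C (fob R Y)))"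


section \<open>Finite limits\<close>

definition is_cone :: "('i, 'j) cat \<Rightarrow> ('o, 'a) cat \<Rightarrow> ('i, 'j, 'o, 'a) ftor
    \<Rightarrow> 'o \<Rightarrow> ('i \<Rightarrow> 'a) \<Rightarrow> bool" where
  "is_cone J C D L p \<longleftrightarrow> L \<in> Obj C \<and> (\<forall>i \<in> Obj J. p i \<in> Hom C L (fob D i)) \<and>
     (\<forall>h \<in> Arr J. Comp C (far D h) (p (Dom J h)) = p (Cod J h))"

definition is_limit :: "('i, 'j) cat \<Rightarrow> ('o, 'a) cat \<Rightarrow> ('i, 'j, 'o, 'a) ftor
    \<Rightarrow> 'o \<Rightarrow> ('i \<Rightarrow> 'a) \<Rightarrow> bool" where
  "is_limit J C D L p \<longleftrightarrow> is_cone J C D L p \<and>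
     (\<forall>M q. is_cone J C D M q
        \<longrightarrow> (\<exists>!m. m \<in> Hom C M L \<and> (\<forall>i \<in> Obj J. Comp C (p i) m = q i)))"

text \<open>Every finite category is isomorphic to one whose objects and arrows are natural numbers.\<close>

definition finite_diagram :: "(nat, nat) cat \<Rightarrow> ('o, 'a) cat \<Rightarrow> (nat, nat, 'o, 'a) ftor \<Rightarrow> bool" where
  "finite_diagram J C D \<longleftrightarrow> finite (Obj J) \<and> finite (Arr J) \<and> cat_functor J C D"

definition has_finite_limits :: "('o, 'a) cat \<Rightarrow> bool" where
  "has_finite_limits C \<longleftrightarrow> (\<forall>J D. finite_diagram J C D \<longrightarrow> (\<exists>L p. is_limit J C D L p))"

definition exact_ftor :: "('o, 'a) cat \<Rightarrow> ('p, 'b) cat \<Rightarrow> ('o, 'a, 'p, 'b) ftor \<Rightarrow> bool" where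
  "exact_ftor C C' F \<longleftrightarrow> (\<forall>J D L p. finite_diagram J C D \<and> is_limit J C D L p
     \<longrightarrow> is_limit J C' (ftor_comp J F D) (fob F L) (\<lambda>i. far F (p i)))"

text \<open>
  The objects in \<open>S\<close> need not be closed under isomorphism: a limit in \<open>C\<close> of each finite diagram in
  \<open>S\<close> must lie in \<open>S\<close>, but not every limit. A small set containing all of them need not exist.
\<close>

definition closed_under_finite_limits :: "('o, 'a) cat \<Rightarrow> 'o set \<Rightarrow> bool" where
  "closed_under_finite_limits C S \<longleftrightarrow>
     (\<forall>J D. finite_diagram J C D \<and> fob D ` Obj J \<subseteq> S \<longrightarrow> (\<exists>L \<in> S. \<exists>p. is_limit J C D L p))"


section \<open>Sites\<close>

text \<open>
  A Grothendieck topology is given by its covering sieves. A family of arrows with codomain \<open>X\<close>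
  is covering if the sieve it generates is.
\<close>

definition sieve :: "('o, 'a) cat \<Rightarrow> 'o \<Rightarrow> 'a set \<Rightarrow> bool" where
  "sieve C X R \<longleftrightarrow> X \<in> Obj C \<and> R \<subseteq> {f \<in> Arr C. Cod C f = X} \<and>
     (\<forall>f \<in> R. \<forall>g \<in> Arr C. Cod C g = Dom C f \<longrightarrow> Comp C f g \<in> R)"

definition generated_sieve :: "('o, 'a) cat \<Rightarrow> 'a set \<Rightarrow> 'a set" where
  "generated_sieve C \<Phi> = {Comp C f g | f g. f \<in> \<Phi> \<and> g \<in> Arr C \<and> Cod C g = Dom C f}"

definition pullback_sieve :: "('o, 'a) cat \<Rightarrow> 'a \<Rightarrow> 'a set \<Rightarrow> 'a set" where
  "pullback_sieve C f R = {g \<in> Arr C. Cod C g = Dom C f \<and> Comp C f g \<in> R}"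

record ('o, 'a) site =
  ucat :: "('o, 'a) cat"
  cov :: "'o \<Rightarrow> 'a set set"

locale grothendieck_topology = category "ucat T" for T :: "('o, 'a) site" +
  assumes cov_sieve: "\<lbrakk>X \<in> Obj (ucat T); R \<in> cov T X\<rbrakk> \<Longrightarrow> sieve (ucat T) X R"
    and cov_maximal: "X \<in> Obj (ucat T) \<Longrightarrow> {f \<in> Arr (ucat T). Cod (ucat T) f = X} \<in> cov T X"
    and cov_stable: "\<lbrakk>f \<in> Hom (ucat T) Y X; R \<in> cov T X\<rbrakk> \<Longrightarrow> pullback_sieve (ucat T) f R \<in> cov T Y"
    and cov_transitive: "\<lbrakk>X \<in> Obj (ucat T); R \<in> cov T X; sieve (ucat T) X R';
        \<And>f. f \<in> R \<Longrightarrow> pullback_sieve (ucat T) f R' \<in> cov T (Dom (ucat T) f)\<rbrakk> \<Longrightarrow> R' \<in> cov T X"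

definition covering_family :: "('o, 'a) site \<Rightarrow> 'o \<Rightarrow> 'a set \<Rightarrow> bool" where
  "covering_family T X \<Phi> \<longleftrightarrow> X \<in> Obj (ucat T) \<and> \<Phi> \<subseteq> {f \<in> Arr (ucat T). Cod (ucat T) f = X} \<and>
     generated_sieve (ucat T) \<Phi> \<in> cov T X"

definition topological_generators :: "('o, 'a) site \<Rightarrow> 'o set \<Rightarrow> bool" where
  "topological_generators T G \<longleftrightarrow> G \<subseteq> Obj (ucat T) \<and>
     (\<forall>X \<in> Obj (ucat T). \<exists>\<Phi>. covering_family T X \<Phi> \<and> (\<forall>f \<in> \<Phi>. Dom (ucat T) f \<in> G))"

text \<open>As usual, the categories underlying sites are locally small.\<close>

locale site = grothendieck_topology T for U :: "'u set" and T :: "('o, 'a) site" +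
  assumes locally_small: "\<lbrakk>X \<in> Obj (ucat T); Y \<in> Obj (ucat T)\<rbrakk> \<Longrightarrow> small U (Hom (ucat T) X Y)"
    and finite_limits: "has_finite_limits (ucat T)"
    and small_generators: "\<exists>G. small U G \<and> topological_generators T G"

definition continuous_ftor :: "('o, 'a) site \<Rightarrow> ('p, 'b) site \<Rightarrow> ('o, 'a, 'p, 'b) ftor \<Rightarrow> bool" where
  "continuous_ftor T T' F \<longleftrightarrow>
     (\<forall>X \<Phi>. covering_family T X \<Phi> \<longrightarrow> covering_family T' (fob F X) (far F ` \<Phi>))"


section \<open>Sheaves and topoi\<close>

text \<open>
  Small sets are represented by the small subsets of \<open>U\<close>; a triple \<open>(X, Y, f)\<close> is the map \<open>f : X \<rightarrow> Y\<close>.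
\<close>

definition Set_cat :: "'u set \<Rightarrow> ('u set, 'u set \<times> 'u set \<times> ('u \<Rightarrow> 'u)) cat" where
  "Set_cat U = \<lparr>Obj = {X. X \<subseteq> U \<and> small U X},
     Arr = {(X, Y, f). X \<subseteq> U \<and> small U X \<and> Y \<subseteq> U \<and> small U Y \<and> f \<in> X \<rightarrow>\<^sub>E Y},
     Dom = (\<lambda>(X, Y, f). X), Cod = (\<lambda>(X, Y, f). Y), Ident = (\<lambda>X. (X, X, \<lambda>x\<in>X. x)),
     Comp = (\<lambda>(Y', Z, g) (X, Y, f). (X, Z, compose X g f))\<rparr>"

type_synonym ('o, 'a, 'u) presheaf = "('o, 'a, 'u set, 'u set \<times> 'u set \<times> ('u \<Rightarrow> 'u)) ftor"

definition presheaf_cat :: "'u set \<Rightarrow> ('o, 'a) cat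
    \<Rightarrow> (('o, 'a, 'u) presheaf, ('o, 'a, 'u set, 'u set \<times> 'u set \<times> ('u \<Rightarrow> 'u)) ntrans) cat" where
  "presheaf_cat U C = functor_cat (op_cat C) (Set_cat U)"

definition restr :: "('o, 'a, 'u) presheaf \<Rightarrow> 'a \<Rightarrow> 'u \<Rightarrow> 'u" where
  "restr P f = snd (snd (far P f))"

definition matching_family :: "('o, 'a) cat \<Rightarrow> ('o, 'a, 'u) presheaf \<Rightarrow> 'a set \<Rightarrow> ('a \<Rightarrow> 'u) \<Rightarrow> bool" where
  "matching_family C P R x \<longleftrightarrow> (\<forall>f \<in> R. x f \<in> fob P (Dom C f)) \<and>
     (\<forall>f \<in> R. \<forall>g \<in> Arr C. Cod C g = Dom C f \<longrightarrow> x (Comp C f g) = restr P g (x f))"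

definition is_sheaf :: "'u set \<Rightarrow> ('o, 'a) site \<Rightarrow> ('o, 'a, 'u) presheaf \<Rightarrow> bool" where
  "is_sheaf U T P \<longleftrightarrow> P \<in> Obj (presheaf_cat U (ucat T)) \<and>
     (\<forall>X \<in> Obj (ucat T). \<forall>R \<in> cov T X. \<forall>x. matching_family (ucat T) P R x
        \<longrightarrow> (\<exists>!s. s \<in> fob P X \<and> (\<forall>f \<in> R. restr P f s = x f)))"

definition Sh :: "'u set \<Rightarrow> ('o, 'a) site
    \<Rightarrow> (('o, 'a, 'u) presheaf, ('o, 'a, 'u set, 'u set \<times> 'u set \<times> ('u \<Rightarrow> 'u)) ntrans) cat" where
  "Sh U T = full_subcat (presheaf_cat U (ucat T)) {P. is_sheaf U T P}"

text \<open>
  The defining site has its objects and arrows in the type of \<open>U\<close>, so they may form a proper class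
  relative to \<open>U\<close>. By the comparison lemma every topos is equivalent to sheaves on a small site, so
  nothing is lost by fixing this type.
\<close>

definition topos :: "'u set \<Rightarrow> ('o, 'a) cat \<Rightarrow> bool" where
  "topos U E \<longleftrightarrow> (\<exists>T :: ('u, 'u) site. site U T \<and> equivalent_cats E (Sh U T))"

definition jointly_epi :: "('o, 'a) cat \<Rightarrow> 'o \<Rightarrow> 'a set \<Rightarrow> bool" where
  "jointly_epi E X \<Phi> \<longleftrightarrow> (\<forall>Y \<in> Obj E. \<forall>g \<in> Hom E X Y. \<forall>h \<in> Hom E X Y.
     (\<forall>f \<in> \<Phi>. Comp E g f = Comp E h f) \<longrightarrow> g = h)"

text \<open>
  The full subcategory of \<open>E\<close> on \<open>S\<close> with the topology induced by the canonical topology of \<open>E\<close>. A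
  family is jointly epimorphic if and only if the sieve it generates is. For \<open>S = Obj E\<close> this is \<open>E\<close>
  with its canonical topology.
\<close>

definition canonical_site_on :: "('o, 'a) cat \<Rightarrow> 'o set \<Rightarrow> ('o, 'a) site" where
  "canonical_site_on E S = \<lparr>ucat = full_subcat E S,
     cov = (\<lambda>X. {R. sieve (full_subcat E S) X R \<and> jointly_epi E X R})\<rparr>"

definition generating :: "('o, 'a) cat \<Rightarrow> 'o set \<Rightarrow> bool" where
  "generating E S \<longleftrightarrow> topological_generators (canonical_site_on E (Obj E)) S"


section \<open>2-categories\<close>

text \<open>
  A 2-category is a category enriched in categories: \<open>HComp A X Y Z\<close> is the composition functor
  \<open>A(Y, Z) \<times> A(X, Y) \<rightarrow> A(X, Z)\<close>. Distinct hom-categories may share objects and arrows.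
\<close>

record ('x, 'y, 'z) two_cat =
  Ob :: "'x set"
  HomC :: "'x \<Rightarrow> 'x \<Rightarrow> ('y, 'z) cat"
  Id1 :: "'x \<Rightarrow> 'y"
  HComp :: "'x \<Rightarrow> 'x \<Rightarrow> 'x \<Rightarrow> ('y \<times> 'y, 'z \<times> 'z, 'y, 'z) ftor"

abbreviation Id2 :: "('x, 'y, 'z) two_cat \<Rightarrow> 'x \<Rightarrow> 'z" where
  "Id2 A X \<equiv> Ident (HomC A X X) (Id1 A X)"

locale two_category =
  fixes A :: "('x, 'y, 'z) two_cat"
  assumes HComp_functor: "\<lbrakk>X \<in> Ob A; Y \<in> Ob A; Z \<in> Ob A\<rbrakk>
      \<Longrightarrow> cat_functor (prod_cat (HomC A Y Z) (HomC A X Y)) (HomC A X Z) (HComp A X Y Z)"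
    and HomC_category: "\<lbrakk>X \<in> Ob A; Y \<in> Ob A\<rbrakk> \<Longrightarrow> category (HomC A X Y)"
    and Id1_in: "X \<in> Ob A \<Longrightarrow> Id1 A X \<in> Obj (HomC A X X)"
    and fob_assoc: "\<lbrakk>W \<in> Ob A; X \<in> Ob A; Y \<in> Ob A; Z \<in> Ob A;
        f \<in> Obj (HomC A W X); g \<in> Obj (HomC A X Y); h \<in> Obj (HomC A Y Z)\<rbrakk>
      \<Longrightarrow> fob (HComp A W Y Z) (h, fob (HComp A W X Y) (g, f))
        = fob (HComp A W X Z) (fob (HComp A X Y Z) (h, g), f)"
    and far_assoc: "\<lbrakk>W \<in> Ob A; X \<in> Ob A; Y \<in> Ob A; Z \<in> Ob A;
        \<alpha> \<in> Arr (HomC A W X); \<beta> \<in> Arr (HomC A X Y); \<gamma> \<in> Arr (HomC A Y Z)\<rbrakk>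
      \<Longrightarrow> far (HComp A W Y Z) (\<gamma>, far (HComp A W X Y) (\<beta>, \<alpha>))
        = far (HComp A W X Z) (far (HComp A X Y Z) (\<gamma>, \<beta>), \<alpha>)"
    and fob_unit: "\<lbrakk>X \<in> Ob A; Y \<in> Ob A; f \<in> Obj (HomC A X Y)\<rbrakk>
      \<Longrightarrow> fob (HComp A X X Y) (f, Id1 A X) = f \<and> fob (HComp A X Y Y) (Id1 A Y, f) = f"
    and far_unit: "\<lbrakk>X \<in> Ob A; Y \<in> Ob A; \<alpha> \<in> Arr (HomC A X Y)\<rbrakk>
      \<Longrightarrow> far (HComp A X X Y) (\<alpha>, Id2 A X) = \<alpha> \<and> far (HComp A X Y Y) (Id2 A Y, \<alpha>) = \<alpha>"

definition small_two_cat :: "'u set \<Rightarrow> ('x, 'y, 'z) two_cat \<Rightarrow> bool" where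
  "small_two_cat U A \<longleftrightarrow> small U (Ob A) \<and>
     (\<forall>X \<in> Ob A. \<forall>Y \<in> Ob A. small U (Obj (HomC A X Y)) \<and> small U (Arr (HomC A X Y)))"

text \<open>Reversal of both arrows and 2-cells.\<close>

definition two_op :: "('x, 'y, 'z) two_cat \<Rightarrow> ('x, 'y, 'z) two_cat" where
  "two_op A = \<lparr>Ob = Ob A, HomC = (\<lambda>X Y. op_cat (HomC A Y X)), Id1 = Id1 A,
     HComp = (\<lambda>X Y Z. \<lparr>fob = fob (HComp A Z Y X) \<circ> prod.swap,
                       far = far (HComp A Z Y X) \<circ> prod.swap\<rparr>)\<rparr>"

record ('x, 'y, 'z, 'x1, 'y1, 'z1) two_ftor =
  F0 :: "'x \<Rightarrow> 'x1"
  FH :: "'x \<Rightarrow> 'x \<Rightarrow> ('y, 'z, 'y1, 'z1) ftor"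

locale two_functor = source: two_category A + target: two_category B
  for A :: "('x, 'y, 'z) two_cat" and B :: "('x1, 'y1, 'z1) two_cat" +
  fixes F :: "('x, 'y, 'z, 'x1, 'y1, 'z1) two_ftor"
  assumes F0_in: "X \<in> Ob A \<Longrightarrow> F0 F X \<in> Ob B"
    and FH_functor: "\<lbrakk>X \<in> Ob A; Y \<in> Ob A\<rbrakk>
      \<Longrightarrow> cat_functor (HomC A X Y) (HomC B (F0 F X) (F0 F Y)) (FH F X Y)"
    and FH_Id1: "X \<in> Ob A \<Longrightarrow> fob (FH F X X) (Id1 A X) = Id1 B (F0 F X)"
    and FH_fob_HComp: "\<lbrakk>X \<in> Ob A; Y \<in> Ob A; Z \<in> Ob A; f \<in> Obj (HomC A X Y); g \<in> Obj (HomC A Y Z)\<rbrakk>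
      \<Longrightarrow> fob (FH F X Z) (fob (HComp A X Y Z) (g, f))
        = fob (HComp B (F0 F X) (F0 F Y) (F0 F Z)) (fob (FH F Y Z) g, fob (FH F X Y) f)"
    and FH_far_HComp: "\<lbrakk>X \<in> Ob A; Y \<in> Ob A; Z \<in> Ob A; \<alpha> \<in> Arr (HomC A X Y); \<beta> \<in> Arr (HomC A Y Z)\<rbrakk>
      \<Longrightarrow> far (FH F X Z) (far (HComp A X Y Z) (\<beta>, \<alpha>))
        = far (HComp B (F0 F X) (F0 F Y) (F0 F Z)) (far (FH F Y Z) \<beta>, far (FH F X Y) \<alpha>)"


section \<open>The 2-categories of sites and of topoi\<close>

definition Sit_star_hom :: "('o, 'a) site \<Rightarrow> ('o, 'a) site
    \<Rightarrow> (('o, 'a, 'o, 'a) ftor, ('o, 'a, 'o, 'a) ntrans) cat" where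
  "Sit_star_hom T T' = full_subcat (functor_cat (ucat T) (ucat T'))
     {F. continuous_ftor T T' F \<and> exact_ftor (ucat T) (ucat T') F}"

definition Sit_star :: "'u set
    \<Rightarrow> (('o, 'a) site, ('o, 'a, 'o, 'a) ftor, ('o, 'a, 'o, 'a) ntrans) two_cat" where
  "Sit_star U = \<lparr>Ob = {T. site U T}, HomC = Sit_star_hom, Id1 = (\<lambda>T. id_ftor (ucat T)),
     HComp = (\<lambda>T1 T2 T3.
       \<lparr>fob = (\<lambda>(G, F) \<in> Obj (prod_cat (Sit_star_hom T2 T3) (Sit_star_hom T1 T2)).
                ftor_comp (ucat T1) G F),
        far = (\<lambda>(\<beta>, \<alpha>) \<in> Arr (prod_cat (Sit_star_hom T2 T3) (Sit_star_hom T1 T2)).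
                hcomp (ucat T1) (ucat T3) \<beta> \<alpha>)\<rparr>)\<rparr>"

definition Sit :: "'u set
    \<Rightarrow> (('o, 'a) site, ('o, 'a, 'o, 'a) ftor, ('o, 'a, 'o, 'a) ntrans) two_cat" where
  "Sit U = two_op (Sit_star U)"

text \<open>
  A geometric morphism \<open>f : E \<rightarrow> F\<close> is a pair of an inverse image functor \<open>f\<^sup>* : F \<rightarrow> E\<close> and a direct
  image functor \<open>f\<^sub>* : E \<rightarrow> F\<close> such that \<open>f\<^sup>*\<close> is exact and left adjoint to \<open>f\<^sub>*\<close>; the unit and counit
  are not part of the data. A 2-cell \<open>f \<Rightarrow> g\<close> is a natural transformation \<open>g\<^sup>* \<Rightarrow> f\<^sup>*\<close>, stored
  together with \<open>f\<close> and \<open>g\<close>, as it does not determine their direct images.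
\<close>

record ('o, 'a) geom =
  inv_im :: "('o, 'a, 'o, 'a) ftor"
  dir_im :: "('o, 'a, 'o, 'a) ftor"

record ('o, 'a) geom_cell =
  gsrc :: "('o, 'a) geom"
  gtgt :: "('o, 'a) geom"
  gtrans :: "('o, 'a, 'o, 'a) ntrans"

definition geometric_morphism :: "('o, 'a) cat \<Rightarrow> ('o, 'a) cat \<Rightarrow> ('o, 'a) geom \<Rightarrow> bool" where
  "geometric_morphism E F f \<longleftrightarrow>
     left_adjoint F E (inv_im f) (dir_im f) \<and> exact_ftor F E (inv_im f)"

definition Top_hom :: "('o, 'a) cat \<Rightarrow> ('o, 'a) cat \<Rightarrow> (('o, 'a) geom, ('o, 'a) geom_cell) cat" where
  "Top_hom E F = \<lparr>Obj = {f. geometric_morphism E F f},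
     Arr = {\<sigma>. geometric_morphism E F (gsrc \<sigma>) \<and> geometric_morphism E F (gtgt \<sigma>) \<and>
               gtrans \<sigma> \<in> Hom (functor_cat F E) (inv_im (gtgt \<sigma>)) (inv_im (gsrc \<sigma>))},
     Dom = gsrc, Cod = gtgt,
     Ident = (\<lambda>f. \<lparr>gsrc = f, gtgt = f, gtrans = id_ntrans F E (inv_im f)\<rparr>),
     Comp = (\<lambda>\<tau> \<sigma>. \<lparr>gsrc = gsrc \<sigma>, gtgt = gtgt \<tau>, gtrans = vcomp F E (gtrans \<sigma>) (gtrans \<tau>)\<rparr>)\<rparr>"

text \<open>The composite of \<open>f : E1 \<rightarrow> E2\<close> and \<open>g : E2 \<rightarrow> E3\<close>.\<close>

definition geom_comp :: "('o, 'a) cat \<Rightarrow> ('o, 'a) cat \<Rightarrow> ('o, 'a) geom \<Rightarrow> ('o, 'a) geom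
    \<Rightarrow> ('o, 'a) geom" where
  "geom_comp E1 E3 g f = \<lparr>inv_im = ftor_comp E3 (inv_im f) (inv_im g),
     dir_im = ftor_comp E1 (dir_im g) (dir_im f)\<rparr>"

definition Top :: "'u set
    \<Rightarrow> (('o, 'a) cat, ('o, 'a) geom, ('o, 'a) geom_cell) two_cat" where
  "Top U = \<lparr>Ob = {E. topos U E}, HomC = Top_hom,
     Id1 = (\<lambda>E. \<lparr>inv_im = id_ftor E, dir_im = id_ftor E\<rparr>),
     HComp = (\<lambda>E1 E2 E3.
       \<lparr>fob = (\<lambda>(g, f) \<in> Obj (prod_cat (Top_hom E2 E3) (Top_hom E1 E2)). geom_comp E1 E3 g f),
        far = (\<lambda>(\<tau>, \<sigma>) \<in> Arr (prod_cat (Top_hom E2 E3) (Top_hom E1 E2)).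
                \<lparr>gsrc = geom_comp E1 E3 (gsrc \<tau>) (gsrc \<sigma>),
                 gtgt = geom_comp E1 E3 (gtgt \<tau>) (gtgt \<sigma>),
                 gtrans = hcomp E3 E1 (gtrans \<sigma>) (gtrans \<tau>)\<rparr>)\<rparr>)\<rparr>"

end

theory Submission
  imports Defs
begin

text \<open>
  Let \<open>S\<^sub>0 A\<close> be a small generating set of objects of the topos \<open>E\<^sub>A\<close> and choose a limit of every finite
  diagram. Closing the family \<open>S\<^sub>0\<close> countably often under the chosen limits and under all inverse
  images gives small full subcategories between which the functors \<open>u\<^sup>*\<close> restrict strictly; they
  preserve covers because they are left adjoints. A limit in such a subcategory is a limit in the
  topos, since it can be compared with the limit that the closure provides. The induced topology is
  stable because each arrow into the pullback of a covering family is itself covered by arrows from \<open>S A\<close>.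

  This uses four properties of a topos: local smallness, finite limits, a small generating set, and
  stability of jointly epimorphic families. They are invariant under equivalence, hence need a proof
  for sheaves on a site only, where each reduces to sections over a small set of topological
  generators. Stability follows once jointly epimorphic families of sheaves are known to be locally
  surjective, and for this it suffices to map into the sheaf of closed sieves.
\<close>

section \<open>Small sets\<close>

text \<open>Strictness decides the construction: replacing the topoi by equivalent categories of
  sheaves would give the equations only up to isomorphism. So the subcategories consist of objects
  of \<open>E\<^sub>A\<close> itself and are closed under the actual values of the functors
  \<open>u\<^sup>*\<close>; fullness takes care of arrows and components. All subcategories must
  grow together, because the functors connect them. Only one limit per diagram is added: an object
  may have more isomorphic copies than a small set holds. Uncountability, regularity and the strong
  limit property of \<open>|U|\<close> keep every round of the closure and the union of all rounds
  small. On the side of sheaves the defining site may be large. Hence smallness always comes from a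
  small set of generators: a morphism, a closed sieve or the relations of a section are coded by
  their trace on it. Quotients of sheafified representables, the usual generators, are recovered
  from inside: each section of a sheaf generates a subsheaf, and the relation it induces between
  arrows from generators is the only datum that matters.\<close>

lemma small_mono: "small U X" if "small U Y" "X \<subseteq> Y"
  using that unfolding small_def by (meson card_of_mono1 ordLeq_ordLess_trans)

lemma small_image: "small U (f ` X)" if "small U X"
  using that unfolding small_def by (meson card_of_image ordLeq_ordLess_trans)

lemma small_inj_on: "small U X" if "inj_on f X" "small U (f ` X)"
  using that unfolding small_def
  by (meson card_of_ordLeq ordLeq_ordLess_trans subset_refl)

lemma small_inj_into: "small U X" if "inj_on f X" "f ` X \<subseteq> Y" "small U Y"
  using small_inj_on small_mono that by metis

text \<open>\<open>small\<close> makes sense in any type, but the power set clause of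
  \<open>universe\<close> speaks of sets in the type of \<open>U\<close>, and the objects of
  \<open>Set_cat U\<close> are subsets of \<open>U\<close>. This embedding leads from the one to the
  other.\<close>

lemma small_embed:
  assumes "small U X"
  shows "\<exists>f. inj_on f X \<and> f ` X \<subseteq> U"
proof -
  have "|X| \<le>o |U|" using assms by (simp add: small_def ordLess_imp_ordLeq)
  then show ?thesis by (simp add: card_of_ordLeq)
qed

locale universe_set =
  fixes U :: "'u set"
  assumes universe: "universe U"
begin

lemma natLeq_less: "natLeq <o |U|"
  using universe by (simp add: universe_def)

lemma Cinfinite_U: "Cinfinite |U|"
  using natLeq_less infinite_iff_natLeq_ordLeq[of U]
  by (auto simp: cinfinite_def Field_card_of ordLess_imp_ordLeq card_of_card_order_on)

lemma small_nat: "small U (X :: nat set)"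
proof -
  have "|X| \<le>o |UNIV :: nat set|" by (rule card_of_mono1) simp
  then have "|X| \<le>o natLeq" using card_of_nat ordLeq_ordIso_trans by blast
  then show ?thesis using natLeq_less ordLeq_ordLess_trans unfolding small_def by blast
qed

lemma small_finite: "finite X \<Longrightarrow> small U X"
  unfolding small_def using natLeq_less finite_iff_ordLess_natLeq ordLess_transitive by blast

text \<open>Regularity of \<open>|U|\<close> enters here; products and binary unions are then
  instances.\<close>

lemma small_UN: "small U (\<Union>i\<in>I. X i)" if "small U I" "\<And>i. i \<in> I \<Longrightarrow> small U (X i)"
  using that universe Cinfinite_U unfolding small_def universe_def
  by (intro card_of_UNION_ordLess_infinite_Field_regularCard) auto

lemma small_Times: "small U (X \<times> Y)" if "small U X" "small U Y"
proof -
  have "X \<times> Y = (\<Union>x\<in>X. Pair x ` Y)" by auto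
  then show ?thesis using that by (auto intro!: small_UN small_image)
qed

lemma small_Un: "small U (X \<union> Y)" if "small U X" "small U Y"
proof -
  have "small U (\<Union>Z\<in>{X, Y}. Z)"
    using that by (intro small_UN) (auto intro: small_finite)
  then show ?thesis by simp
qed

text \<open>The strong limit clause enters here. It is applied to a copy of \<open>X\<close> in the
  type of \<open>U\<close>, since \<open>X\<close> may live elsewhere.\<close>

lemma small_Pow: "small U (Pow X)" if X: "small U X"
proof -
  obtain f where f: "inj_on f X" "f ` X \<subseteq> U" using small_embed X by metis
  have "small U (f ` X)" by (rule small_image[OF X])
  then have "small U (Pow (f ` X))" using universe unfolding small_def universe_def by blast
  moreover have "inj_on ((`) f) (Pow X)" by (rule inj_on_image_Pow[OF f(1)])
  ultimately show ?thesis by (rule small_inj_into[rotated 2]) auto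
qed

text \<open>A function that is extensional on \<open>X\<close> is determined by its graph over
  \<open>X\<close>, an element of \<open>Pow (X \<times> Y)\<close>.\<close>

lemma small_functions:
  assumes "small U X" "small U Y" "\<And>f. f \<in> F \<Longrightarrow> f \<in> X \<rightarrow>\<^sub>E Y"
  shows "small U F"
proof (rule small_inj_into)
  show "inj_on (\<lambda>f. (\<lambda>x. (x, f x)) ` X) F"
  proof (rule inj_onI)
    fix f g assume "f \<in> F" "g \<in> F" and eq: "(\<lambda>x. (x, f x)) ` X = (\<lambda>x. (x, g x)) ` X"
    then have "f \<in> X \<rightarrow>\<^sub>E Y" "g \<in> X \<rightarrow>\<^sub>E Y" using assms by auto
    moreover have "f x = g x" if "x \<in> X" for x
      using eq that by (auto simp: set_eq_iff image_iff)
    ultimately show "f = g" by (rule PiE_ext)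
  qed
  show "(\<lambda>f. (\<lambda>x. (x, f x)) ` X) ` F \<subseteq> Pow (X \<times> Y)" using assms(3) by fastforce
  show "small U (Pow (X \<times> Y))" by (intro small_Pow small_Times assms)
qed

text \<open>Even one finite category has uncountably many representations, because the fields
  \<open>Dom\<close>, \<open>Cod\<close>, \<open>Ident\<close> and \<open>Comp\<close> are arbitrary
  outside the category. Still there are no more than subsets of a countable set, and that many is
  small by uncountability and the strong limit clause.\<close>

lemma small_nat_cats: "small U (X :: (nat, nat) cat set)"
proof (rule small_inj_into)
  define code :: "(nat, nat) cat \<Rightarrow> _" where "code = (\<lambda>J. (Obj J, Arr J, range (\<lambda>n. (n, Dom J n)),
    range (\<lambda>n. (n, Cod J n)), range (\<lambda>n. (n, Ident J n)), range (\<lambda>(m, n). ((m, n), Comp J m n))))"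
  show "inj_on code X"
    unfolding code_def
    apply (rule inj_onI)
    subgoal for J K
      apply (cases J; cases K)
      apply (simp add: set_eq_iff image_iff fun_eq_iff)
      apply metis
      done
    done
  show "code ` X \<subseteq> UNIV \<times> UNIV \<times> UNIV \<times> UNIV \<times> UNIV \<times> UNIV" by simp
  have N: "small U (UNIV :: nat set)" "small U (UNIV :: nat set set)"
    using small_Pow[OF small_nat[of UNIV]] by (auto simp: small_nat)
  have NN: "small U (UNIV :: (nat \<times> nat) set)" "small U (UNIV :: (nat \<times> nat) set set)"
    using small_Times[OF N(1) N(1)] small_Pow[of "UNIV :: (nat \<times> nat) set"] by auto
  have NNN: "small U (UNIV :: ((nat \<times> nat) \<times> nat) set set)"
    using small_Times[OF NN(1) N(1)] small_Pow[of "UNIV :: ((nat \<times> nat) \<times> nat) set"] by auto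
  show "small U (UNIV \<times> UNIV \<times> UNIV \<times> UNIV \<times> UNIV \<times> UNIV ::
    (nat set \<times> nat set \<times> (nat \<times> nat) set \<times> (nat \<times> nat) set \<times> (nat \<times> nat) set \<times> ((nat \<times> nat) \<times> nat) set) set)"
    by (intro small_Times N NN NNN)
qed

end

section \<open>Categories, functors and transformations\<close>

lemma (in category) Hom_Obj: "f \<in> Hom C X Y \<Longrightarrow> X \<in> Obj C \<and> Y \<in> Obj C"
  using Dom_in Cod_in by (auto simp: Hom_def)

text \<open>The axioms mention hom-sets, whose end points rewriting cannot guess. This and the
  following variants express them through \<open>Dom\<close> and \<open>Cod\<close>, as conditional
  equations for the simplifier.\<close>

lemma (in category) Comp_Arr: "f \<in> Arr C \<Longrightarrow> g \<in> Arr C \<Longrightarrow> Dom C g = Cod C f \<Longrightarrow>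
    Comp C g f \<in> Arr C \<and> Dom C (Comp C g f) = Dom C f \<and> Cod C (Comp C g f) = Cod C g"
  using Comp_in[of f "Dom C f" "Cod C f" g "Cod C g"] by (auto simp: Hom_def)

lemma (in category) Arr_assoc: "f \<in> Arr C \<Longrightarrow> g \<in> Arr C \<Longrightarrow> h \<in> Arr C \<Longrightarrow>
    Dom C g = Cod C f \<Longrightarrow> Dom C h = Cod C g \<Longrightarrow> Comp C h (Comp C g f) = Comp C (Comp C h g) f"
  using Comp_assoc[of f "Dom C f" "Cod C f" g "Cod C g" h "Cod C h"] by (auto simp: Hom_def)

lemma (in category) Ident_Arr: "X \<in> Obj C \<Longrightarrow>
    Ident C X \<in> Arr C \<and> Dom C (Ident C X) = X \<and> Cod C (Ident C X) = X"
  using Ident_in[of X] by (auto simp: Hom_def)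

lemma (in category) Arr_Comp_Ident: "f \<in> Arr C \<Longrightarrow> Dom C f = X \<Longrightarrow> Comp C f (Ident C X) = f"
  using Comp_Ident[of f X "Cod C f"] by (auto simp: Hom_def)

lemma (in category) Arr_Ident_Comp: "f \<in> Arr C \<Longrightarrow> Cod C f = X \<Longrightarrow> Comp C (Ident C X) f = f"
  using Ident_Comp[of f "Dom C f" X] by (auto simp: Hom_def)

lemma (in cat_functor) far_Arr: "f \<in> Arr C \<Longrightarrow>
    far F f \<in> Arr D \<and> Dom D (far F f) = fob F (Dom C f) \<and> Cod D (far F f) = fob F (Cod C f)"
  using far_in[of f "Dom C f" "Cod C f"] by (auto simp: Hom_def)

lemma (in cat_functor) far_Comp_Arr: "f \<in> Arr C \<Longrightarrow> g \<in> Arr C \<Longrightarrow> Dom C g = Cod C f \<Longrightarrow>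
    far F (Comp C g f) = Comp D (far F g) (far F f)"
  using far_Comp[of f "Dom C f" "Cod C f" g "Cod C g"] by (auto simp: Hom_def)

section \<open>Opposite categories, full subcategories and products\<close>

lemma op_cat_simps [simp]:
  "Obj (op_cat C) = Obj C" "Arr (op_cat C) = Arr C" "Dom (op_cat C) = Cod C" "Cod (op_cat C) = Dom C"
  "Ident (op_cat C) = Ident C" "Comp (op_cat C) g f = Comp C f g" "op_cat (op_cat C) = C"
  by (simp_all add: op_cat_def)

lemma Hom_op_cat [simp]: "Hom (op_cat C) X Y = Hom C Y X"
  by (auto simp: Hom_def)

lemma category_op_cat: "category (op_cat C)" if "category C"
proof -
  interpret category C by fact
  show ?thesis
    by unfold_locales
      (auto simp: Dom_in Cod_in Ident_in Comp_in Comp_Ident Ident_Comp Comp_assoc)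
qed

lemma cat_functor_op_cat: "cat_functor (op_cat C) (op_cat D) F" if "cat_functor C D F"
proof -
  interpret cat_functor C D F by fact
  interpret o1: category "op_cat C" by (rule category_op_cat[OF source.category_axioms])
  interpret o2: category "op_cat D" by (rule category_op_cat[OF target.category_axioms])
  show ?thesis
    by unfold_locales (auto simp: fob_ext far_ext fob_in far_in far_Ident far_Comp)
qed

lemma full_subcat_simps [simp]:
  "Obj (full_subcat C S) = Obj C \<inter> S" "Arr (full_subcat C S) = {f \<in> Arr C. Dom C f \<in> S \<and> Cod C f \<in> S}"
  "Dom (full_subcat C S) = Dom C" "Cod (full_subcat C S) = Cod C"
  "Ident (full_subcat C S) = Ident C" "Comp (full_subcat C S) = Comp C"
  by (simp_all add: full_subcat_def)

lemma Hom_full_subcat: "Hom (full_subcat C S) X Y = {f \<in> Hom C X Y. X \<in> S \<and> Y \<in> S}"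
  by (auto simp: Hom_def)

lemma category_full_subcat: "category (full_subcat C S)" if "category C"
proof -
  interpret category C by fact
  show ?thesis
    by unfold_locales
      (auto simp: Hom_full_subcat Dom_in Cod_in Ident_in intro: Comp_in Comp_Ident Ident_Comp Comp_assoc)
qed

lemma prod_cat_simps [simp]:
  "Obj (prod_cat C D) = Obj C \<times> Obj D" "Arr (prod_cat C D) = Arr C \<times> Arr D"
  "Dom (prod_cat C D) (f, h) = (Dom C f, Dom D h)" "Cod (prod_cat C D) (f, h) = (Cod C f, Cod D h)"
  "Ident (prod_cat C D) (X, Y) = (Ident C X, Ident D Y)"
  "Comp (prod_cat C D) (g, k) (f, h) = (Comp C g f, Comp D k h)"
  by (simp_all add: prod_cat_def)

lemma Hom_prod_cat: "(f, h) \<in> Hom (prod_cat C D) (X, X') (Y, Y') \<longleftrightarrow> f \<in> Hom C X Y \<and> h \<in> Hom D X' Y'"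
  by (auto simp: Hom_def)

lemma category_prod_cat: "category (prod_cat C D)" if "category C" "category D"
proof -
  interpret C: category C by fact
  interpret D: category D by fact
  show ?thesis
    by unfold_locales
      (auto simp: Hom_prod_cat C.Dom_in C.Cod_in D.Dom_in D.Cod_in C.Ident_in D.Ident_in
        C.Comp_Ident C.Ident_Comp D.Comp_Ident D.Ident_Comp
        intro: C.Comp_in D.Comp_in C.Comp_assoc D.Comp_assoc)
qed

section \<open>Functors and their composition\<close>

lemma ftor_eqI:
  assumes "cat_functor C D F" "cat_functor C D' F'"
    and "\<And>X. X \<in> Obj C \<Longrightarrow> fob F X = fob F' X" "\<And>f. f \<in> Arr C \<Longrightarrow> far F f = far F' f"
  shows "F = F'"
proof -
  interpret F: cat_functor C D F by fact
  interpret F': cat_functor C D' F' by fact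
  have "fob F = fob F'" using F.fob_ext F'.fob_ext assms(3) by (rule extensionalityI)
  moreover have "far F = far F'" using F.far_ext F'.far_ext assms(4) by (rule extensionalityI)
  ultimately show ?thesis by simp
qed

lemma id_ftor_simps [simp]:
  "X \<in> Obj C \<Longrightarrow> fob (id_ftor C) X = X" "f \<in> Arr C \<Longrightarrow> far (id_ftor C) f = f"
  by (simp_all add: id_ftor_def)

lemma cat_functor_id_ftor: "cat_functor C C (id_ftor C)" if "category C"
proof -
  interpret category C by fact
  show ?thesis
    apply unfold_locales
    apply (auto simp: id_ftor_def)
    apply (auto simp: Hom_def Dom_in Cod_in Ident_Arr Comp_Arr)
    done
qed

lemma ftor_comp_simps [simp]:
  "X \<in> Obj C \<Longrightarrow> fob (ftor_comp C G F) X = fob G (fob F X)"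
  "f \<in> Arr C \<Longrightarrow> far (ftor_comp C G F) f = far G (far F f)"
  by (simp_all add: ftor_comp_def)

lemma cat_functor_ftor_comp: "cat_functor C E (ftor_comp C G F)"
  if "cat_functor C D F" "cat_functor D E G"
proof -
  interpret F: cat_functor C D F by fact
  interpret G: cat_functor D E G by fact
  show ?thesis
    apply unfold_locales
         apply (auto simp: ftor_comp_def F.fob_in G.fob_in F.source.Ident_Arr F.far_Ident G.far_Ident)
     apply (auto simp: Hom_def F.far_Arr G.far_Arr F.source.Comp_Arr F.source.Dom_in F.source.Cod_in
        F.far_Comp_Arr G.far_Comp_Arr)
    done
qed

lemma ftor_comp_assoc:
  assumes "cat_functor C D F"
  shows "ftor_comp C H (ftor_comp C G F) = ftor_comp C (ftor_comp D H G) F"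
proof -
  interpret F: cat_functor C D F by fact
  show ?thesis by (auto simp: ftor_comp_def F.fob_in F.far_Arr fun_eq_iff)
qed

lemma ftor_comp_id:
  assumes "cat_functor C D F"
  shows "ftor_comp C F (id_ftor C) = F" "ftor_comp C (id_ftor D) F = F"
proof -
  interpret F: cat_functor C D F by fact
  show "ftor_comp C F (id_ftor C) = F"
    by (rule ftor_eqI[OF cat_functor_ftor_comp[OF cat_functor_id_ftor assms] assms])
      (auto simp: F.source.category_axioms)
  show "ftor_comp C (id_ftor D) F = F"
    by (rule ftor_eqI[OF cat_functor_ftor_comp[OF assms cat_functor_id_ftor] assms])
      (auto simp: F.target.category_axioms F.fob_in F.far_Arr)
qed

section \<open>Natural transformations and functor categories\<close>

lemma (in nat_trans) ncmp_Arr: "X \<in> Obj C \<Longrightarrow>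
    ncmp \<alpha> X \<in> Arr D \<and> Dom D (ncmp \<alpha> X) = fob (nsrc \<alpha>) X \<and> Cod D (ncmp \<alpha> X) = fob (ntgt \<alpha>) X"
  using ncmp_in[of X] by (auto simp: Hom_def)

lemma (in nat_trans) naturality_Arr: "f \<in> Arr C
    \<Longrightarrow> Comp D (ncmp \<alpha> (Cod C f)) (far (nsrc \<alpha>) f) = Comp D (far (ntgt \<alpha>) f) (ncmp \<alpha> (Dom C f))"
  using naturality[of f "Dom C f" "Cod C f"] by (auto simp: Hom_def)

lemma nat_transI:
  assumes "cat_functor C D (nsrc \<alpha>)" "cat_functor C D (ntgt \<alpha>)" "ncmp \<alpha> \<in> extensional (Obj C)"
    and "\<And>X. X \<in> Obj C \<Longrightarrow> ncmp \<alpha> X \<in> Hom D (fob (nsrc \<alpha>) X) (fob (ntgt \<alpha>) X)"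
    and "\<And>f. f \<in> Arr C
    \<Longrightarrow> Comp D (ncmp \<alpha> (Cod C f)) (far (nsrc \<alpha>) f) = Comp D (far (ntgt \<alpha>) f) (ncmp \<alpha> (Dom C f))"
  shows "nat_trans C D \<alpha>"
proof -
  interpret s: cat_functor C D "nsrc \<alpha>" by fact
  interpret t: cat_functor C D "ntgt \<alpha>" by fact
  show ?thesis using assms by unfold_locales (auto simp: Hom_def)
qed

text \<open>Asks for extensionality only, so that it can compare composites before they are known to
  be natural.\<close>

lemma ntrans_eqI:
  assumes "ncmp \<alpha> \<in> extensional S" "ncmp \<beta> \<in> extensional S" "nsrc \<alpha> = nsrc \<beta>" "ntgt \<alpha> = ntgt \<beta>"
    "\<And>X. X \<in> S \<Longrightarrow> ncmp \<alpha> X = ncmp \<beta> X"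
  shows "\<alpha> = (\<beta> :: ('o, 'a, 'p, 'b) ntrans)"
proof -
  have "ncmp \<alpha> = ncmp \<beta>" using assms by (metis extensionalityI)
  then show ?thesis using assms by simp
qed

lemma nat_trans_eqI:
  assumes "nat_trans C D \<alpha>" "nat_trans C D' \<beta>" "nsrc \<alpha> = nsrc \<beta>" "ntgt \<alpha> = ntgt \<beta>"
    "\<And>X. X \<in> Obj C \<Longrightarrow> ncmp \<alpha> X = ncmp \<beta> X"
  shows "\<alpha> = \<beta>"
  using ntrans_eqI[of \<alpha> "Obj C" \<beta>] nat_trans.ncmp_ext[OF assms(1)] nat_trans.ncmp_ext[OF assms(2)] assms
  by blast

lemma id_ntrans_simps [simp]:
  "nsrc (id_ntrans C D F) = F" "ntgt (id_ntrans C D F) = F"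
  "X \<in> Obj C \<Longrightarrow> ncmp (id_ntrans C D F) X = Ident D (fob F X)"
  by (simp_all add: id_ntrans_def)

lemma vcomp_simps [simp]:
  "nsrc (vcomp C D \<beta> \<alpha>) = nsrc \<alpha>" "ntgt (vcomp C D \<beta> \<alpha>) = ntgt \<beta>"
  "X \<in> Obj C \<Longrightarrow> ncmp (vcomp C D \<beta> \<alpha>) X = Comp D (ncmp \<beta> X) (ncmp \<alpha> X)"
  by (simp_all add: vcomp_def)

lemma hcomp_simps [simp]:
  "nsrc (hcomp C E \<beta> \<alpha>) = ftor_comp C (nsrc \<beta>) (nsrc \<alpha>)"
  "ntgt (hcomp C E \<beta> \<alpha>) = ftor_comp C (ntgt \<beta>) (ntgt \<alpha>)"
  "X \<in> Obj C \<Longrightarrow>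
    ncmp (hcomp C E \<beta> \<alpha>) X = Comp E (ncmp \<beta> (fob (ntgt \<alpha>) X)) (far (nsrc \<beta>) (ncmp \<alpha> X))"
  by (simp_all add: hcomp_def)

lemma nat_trans_id: "nat_trans C D (id_ntrans C D F)" if "cat_functor C D F"
proof -
  interpret cat_functor C D F by fact
  show ?thesis
    by (rule nat_transI)
      (auto simp: that id_ntrans_def fob_in target.Ident_in far_Arr source.Dom_in source.Cod_in
        target.Arr_Comp_Ident target.Arr_Ident_Comp)
qed

lemma nat_trans_vcomp: "nat_trans C D (vcomp C D \<beta> \<alpha>)"
  if "nat_trans C D \<alpha>" "nat_trans C D \<beta>" "nsrc \<beta> = ntgt \<alpha>"
proof -
  interpret a: nat_trans C D \<alpha> by fact
  interpret b: nat_trans C D \<beta> by fact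
  note [simp] = a.nsrc.source.Dom_in a.nsrc.source.Cod_in a.ncmp_Arr b.ncmp_Arr that(3) a.nsrc.far_Arr b.nsrc.far_Arr b.ntgt.far_Arr
    a.ntgt.far_Arr
  show ?thesis
  proof (rule nat_transI)
    fix f assume f: "f \<in> Arr C"
    have "Comp D (Comp D (ncmp \<beta> (Cod C f)) (ncmp \<alpha> (Cod C f))) (far (nsrc \<alpha>) f)
        = Comp D (ncmp \<beta> (Cod C f)) (Comp D (ncmp \<alpha> (Cod C f)) (far (nsrc \<alpha>) f))"
      using f by (intro a.nsrc.target.Arr_assoc[symmetric]) auto
    also have "\<dots> = Comp D (ncmp \<beta> (Cod C f)) (Comp D (far (ntgt \<alpha>) f) (ncmp \<alpha> (Dom C f)))"
      using f by (simp add: a.naturality_Arr)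
    also have "\<dots> = Comp D (Comp D (ncmp \<beta> (Cod C f)) (far (ntgt \<alpha>) f)) (ncmp \<alpha> (Dom C f))"
      using f by (intro a.nsrc.target.Arr_assoc) auto
    also have "\<dots> = Comp D (Comp D (far (ntgt \<beta>) f) (ncmp \<beta> (Dom C f))) (ncmp \<alpha> (Dom C f))"
      using f b.naturality_Arr[of f] by simp
    also have "\<dots> = Comp D (far (ntgt \<beta>) f) (Comp D (ncmp \<beta> (Dom C f)) (ncmp \<alpha> (Dom C f)))"
      using f by (intro a.nsrc.target.Arr_assoc[symmetric]) auto
    finally show "Comp D (ncmp (vcomp C D \<beta> \<alpha>) (Cod C f)) (far (nsrc (vcomp C D \<beta> \<alpha>)) f)
        = Comp D (far (ntgt (vcomp C D \<beta> \<alpha>)) f) (ncmp (vcomp C D \<beta> \<alpha>) (Dom C f))"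
      using f by simp
  qed (auto simp: a.nsrc.cat_functor_axioms b.ntgt.cat_functor_axioms vcomp_def Hom_def
      a.nsrc.target.Comp_Arr)
qed

lemma functor_cat_simps [simp]:
  "Obj (functor_cat C D) = {F. cat_functor C D F}" "Arr (functor_cat C D) = {\<alpha>. nat_trans C D \<alpha>}"
  "Dom (functor_cat C D) = nsrc" "Cod (functor_cat C D) = ntgt" "Ident (functor_cat C D) = id_ntrans C D"
  "Comp (functor_cat C D) = vcomp C D"
  by (simp_all add: functor_cat_def)

lemma Hom_functor_cat: "\<alpha> \<in> Hom (functor_cat C D) F G \<longleftrightarrow> nat_trans C D \<alpha> \<and> nsrc \<alpha> = F \<and> ntgt \<alpha> = G"
  by (auto simp: Hom_def)

lemma category_functor_cat: "category (functor_cat C D)"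
proof
  fix f assume "f \<in> Arr (functor_cat C D)"
  then interpret nat_trans C D f by simp
  show "Dom (functor_cat C D) f \<in> Obj (functor_cat C D)" "Cod (functor_cat C D) f \<in> Obj (functor_cat C D)"
    by (auto simp: nsrc.cat_functor_axioms ntgt.cat_functor_axioms)
next
  fix X assume "X \<in> Obj (functor_cat C D)"
  then show "Ident (functor_cat C D) X \<in> Hom (functor_cat C D) X X"
    by (auto simp: Hom_functor_cat nat_trans_id)
next
  fix f g X Y Z assume "f \<in> Hom (functor_cat C D) X Y" "g \<in> Hom (functor_cat C D) Y Z"
  then show "Comp (functor_cat C D) g f \<in> Hom (functor_cat C D) X Z"
    by (auto simp: Hom_functor_cat nat_trans_vcomp)
next
  fix f X Y assume f: "f \<in> Hom (functor_cat C D) X Y"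
  then interpret nat_trans C D f by (simp add: Hom_functor_cat)
  have f: "nsrc f = X" "ntgt f = Y" using f by (auto simp: Hom_functor_cat)
  show "Comp (functor_cat C D) f (Ident (functor_cat C D) X) = f"
    by (rule ntrans_eqI[where S = "Obj C"])
      (use f in \<open>auto simp: ncmp_ext ncmp_Arr nsrc.target.Arr_Comp_Ident vcomp_def\<close>)
  show "Comp (functor_cat C D) (Ident (functor_cat C D) Y) f = f"
    by (rule ntrans_eqI[where S = "Obj C"])
      (use f in \<open>auto simp: ncmp_ext ncmp_Arr nsrc.target.Arr_Ident_Comp vcomp_def\<close>)
next
  fix f g h W X Y Z assume A: "f \<in> Hom (functor_cat C D) W X" "g \<in> Hom (functor_cat C D) X Y"
    "h \<in> Hom (functor_cat C D) Y Z"
  then interpret f: nat_trans C D f by (simp add: Hom_functor_cat)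
  interpret g: nat_trans C D g using A by (simp add: Hom_functor_cat)
  interpret h: nat_trans C D h using A by (simp add: Hom_functor_cat)
  have A: "ntgt f = nsrc g" "ntgt g = nsrc h" using A by (auto simp: Hom_functor_cat)
  show "Comp (functor_cat C D) h (Comp (functor_cat C D) g f) = Comp (functor_cat C D) (Comp (functor_cat C D) h g) f"
    by (rule ntrans_eqI[where S = "Obj C"])
      (auto simp: vcomp_def A f.ncmp_Arr g.ncmp_Arr h.ncmp_Arr intro!: f.nsrc.target.Arr_assoc)
qed

text \<open>Naturality of \<beta> at the arrow \<open>ncmp \<alpha> X\<close>. The definition of
  \<open>hcomp\<close> picks one of the two orders of whiskering; this gives the other.\<close>

lemma hcomp_alt:
  assumes "nat_trans C D \<alpha>" "nat_trans D E \<beta>" "X \<in> Obj C"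
  shows "Comp E (ncmp \<beta> (fob (ntgt \<alpha>) X)) (far (nsrc \<beta>) (ncmp \<alpha> X))
    = Comp E (far (ntgt \<beta>) (ncmp \<alpha> X)) (ncmp \<beta> (fob (nsrc \<alpha>) X))"
proof -
  interpret a: nat_trans C D \<alpha> by fact
  interpret b: nat_trans D E \<beta> by fact
  show ?thesis using b.naturality_Arr[of "ncmp \<alpha> X"] a.ncmp_Arr assms(3) by simp
qed

lemma nat_trans_hcomp: "nat_trans C E (hcomp C E \<beta> \<alpha>)"
  if "nat_trans C D \<alpha>" "nat_trans D E \<beta>"
proof -
  interpret a: nat_trans C D \<alpha> by fact
  interpret b: nat_trans D E \<beta> by fact
  note [simp] = a.nsrc.source.Dom_in a.nsrc.source.Cod_in a.ncmp_Arr b.ncmp_Arr a.nsrc.far_Arr b.nsrc.far_Arr b.ntgt.far_Arr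
    a.ntgt.far_Arr a.nsrc.fob_in a.ntgt.fob_in
  show ?thesis
  proof (rule nat_transI)
    fix f assume f: "f \<in> Arr C"
    let ?X = "Dom C f" and ?Y = "Cod C f"
    have "Comp E (Comp E (ncmp \<beta> (fob (ntgt \<alpha>) ?Y)) (far (nsrc \<beta>) (ncmp \<alpha> ?Y))) (far (nsrc \<beta>) (far (nsrc \<alpha>) f))
        = Comp E (ncmp \<beta> (fob (ntgt \<alpha>) ?Y)) (Comp E (far (nsrc \<beta>) (ncmp \<alpha> ?Y)) (far (nsrc \<beta>) (far (nsrc \<alpha>) f)))"
      using f by (intro b.nsrc.target.Arr_assoc[symmetric]) auto
    also have "Comp E (far (nsrc \<beta>) (ncmp \<alpha> ?Y)) (far (nsrc \<beta>) (far (nsrc \<alpha>) f))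
        = far (nsrc \<beta>) (Comp D (far (ntgt \<alpha>) f) (ncmp \<alpha> ?X))"
      using f by (simp add: a.naturality_Arr[symmetric] b.nsrc.far_Comp_Arr)
    \<comment> \<open>Naturality of \<beta> at the whole composite arrow moves it past \<beta> in
      one go.\<close>
    also have "Comp E (ncmp \<beta> (fob (ntgt \<alpha>) ?Y)) \<dots> = Comp E (far (ntgt \<beta>) (Comp D (far (ntgt \<alpha>) f) (ncmp \<alpha> ?X)))
        (ncmp \<beta> (fob (nsrc \<alpha>) ?X))"
      using f b.naturality_Arr[of "Comp D (far (ntgt \<alpha>) f) (ncmp \<alpha> ?X)"]
      by (simp add: a.nsrc.target.Comp_Arr)
    also have "\<dots> = Comp E (Comp E (far (ntgt \<beta>) (far (ntgt \<alpha>) f)) (far (ntgt \<beta>) (ncmp \<alpha> ?X)))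
        (ncmp \<beta> (fob (nsrc \<alpha>) ?X))"
      using f by (simp add: b.ntgt.far_Comp_Arr)
    also have "\<dots> = Comp E (far (ntgt \<beta>) (far (ntgt \<alpha>) f)) (Comp E (far (ntgt \<beta>) (ncmp \<alpha> ?X))
        (ncmp \<beta> (fob (nsrc \<alpha>) ?X)))"
      using f by (intro b.nsrc.target.Arr_assoc[symmetric]) auto
    finally show "Comp E (ncmp (hcomp C E \<beta> \<alpha>) ?Y) (far (nsrc (hcomp C E \<beta> \<alpha>)) f)
        = Comp E (far (ntgt (hcomp C E \<beta> \<alpha>)) f) (ncmp (hcomp C E \<beta> \<alpha>) ?X)"
      using f hcomp_alt[OF that] by simp
  qed (auto simp: a.nsrc.cat_functor_axioms a.ntgt.cat_functor_axioms b.nsrc.cat_functor_axioms b.ntgt.cat_functor_axioms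
       hcomp_def Hom_def b.nsrc.target.Comp_Arr intro!: cat_functor_ftor_comp[where D = D])
qed

lemma hcomp_interchange:
  assumes "nat_trans C D \<alpha>" "nat_trans C D \<alpha>'" "nat_trans D E \<beta>" "nat_trans D E \<beta>'"
    and [simp]: "nsrc \<alpha>' = ntgt \<alpha>" "nsrc \<beta>' = ntgt \<beta>"
  shows "hcomp C E (vcomp D E \<beta>' \<beta>) (vcomp C D \<alpha>' \<alpha>) = vcomp C E (hcomp C E \<beta>' \<alpha>') (hcomp C E \<beta> \<alpha>)"
proof -
  interpret a: nat_trans C D \<alpha> by fact
  interpret a': nat_trans C D \<alpha>' by fact
  interpret b: nat_trans D E \<beta> by fact
  interpret b': nat_trans D E \<beta>' by fact
  note [simp] = a.nsrc.source.Dom_in a.nsrc.source.Cod_in a.ncmp_Arr b.ncmp_Arr a'.ncmp_Arr b'.ncmp_Arr 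
    a.nsrc.far_Arr b.nsrc.far_Arr b.ntgt.far_Arr b'.ntgt.far_Arr
    a.ntgt.far_Arr a'.ntgt.far_Arr a.nsrc.fob_in a.ntgt.fob_in a'.nsrc.fob_in a'.ntgt.fob_in
    b.nsrc.target.Comp_Arr
  show ?thesis
  proof (rule ntrans_eqI[where S = "Obj C"])
    fix X assume X: "X \<in> Obj C"
    let ?Z = "fob (ntgt \<alpha>') X" and ?Y = "fob (ntgt \<alpha>) X"
    have "Comp E (Comp E (ncmp \<beta>' ?Z) (ncmp \<beta> ?Z)) (Comp E (far (nsrc \<beta>) (ncmp \<alpha>' X)) (far (nsrc \<beta>) (ncmp \<alpha> X)))
      = Comp E (ncmp \<beta>' ?Z) (Comp E (ncmp \<beta> ?Z) (Comp E (far (nsrc \<beta>) (ncmp \<alpha>' X)) (far (nsrc \<beta>) (ncmp \<alpha> X))))"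
      using X by (intro b.nsrc.target.Arr_assoc[symmetric]) auto
    also have "Comp E (ncmp \<beta> ?Z) (Comp E (far (nsrc \<beta>) (ncmp \<alpha>' X)) (far (nsrc \<beta>) (ncmp \<alpha> X)))
      = Comp E (Comp E (ncmp \<beta> ?Z) (far (nsrc \<beta>) (ncmp \<alpha>' X))) (far (nsrc \<beta>) (ncmp \<alpha> X))"
      using X by (intro b.nsrc.target.Arr_assoc) auto
    \<comment> \<open>The exchange proper: \<open>hcomp_alt\<close> for \<alpha>' and \<beta> swaps
      the two inner factors. Everything else is bracketing.\<close>
    also have "Comp E (ncmp \<beta> ?Z) (far (nsrc \<beta>) (ncmp \<alpha>' X)) = Comp E (far (ntgt \<beta>) (ncmp \<alpha>' X)) (ncmp \<beta> ?Y)"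
      using hcomp_alt[OF assms(2,3) X] by simp
    also have "Comp E (Comp E (far (ntgt \<beta>) (ncmp \<alpha>' X)) (ncmp \<beta> ?Y)) (far (nsrc \<beta>) (ncmp \<alpha> X))
      = Comp E (far (ntgt \<beta>) (ncmp \<alpha>' X)) (Comp E (ncmp \<beta> ?Y) (far (nsrc \<beta>) (ncmp \<alpha> X)))"
      using X by (intro b.nsrc.target.Arr_assoc[symmetric]) auto
    also have "Comp E (ncmp \<beta>' ?Z) \<dots> = Comp E (Comp E (ncmp \<beta>' ?Z) (far (ntgt \<beta>) (ncmp \<alpha>' X)))
        (Comp E (ncmp \<beta> ?Y) (far (nsrc \<beta>) (ncmp \<alpha> X)))"
      using X by (intro b.nsrc.target.Arr_assoc) auto
    finally show "ncmp (hcomp C E (vcomp D E \<beta>' \<beta>) (vcomp C D \<alpha>' \<alpha>)) X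
        = ncmp (vcomp C E (hcomp C E \<beta>' \<alpha>') (hcomp C E \<beta> \<alpha>)) X"
      using X by (simp add: b.nsrc.far_Comp_Arr)
  qed (auto simp: hcomp_def vcomp_def)
qed

lemma hcomp_assoc:
  assumes "nat_trans B C \<alpha>" "nat_trans C D \<beta>" "nat_trans D E \<gamma>"
  shows "hcomp B E \<gamma> (hcomp B D \<beta> \<alpha>) = hcomp B E (hcomp C E \<gamma> \<beta>) \<alpha>"
proof -
  interpret a: nat_trans B C \<alpha> by fact
  interpret b: nat_trans C D \<beta> by fact
  interpret c: nat_trans D E \<gamma> by fact
  note [simp] = a.ncmp_Arr b.ncmp_Arr c.ncmp_Arr
    a.nsrc.far_Arr b.nsrc.far_Arr b.ntgt.far_Arr c.nsrc.far_Arr c.ntgt.far_Arr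
    a.ntgt.far_Arr a.nsrc.fob_in a.ntgt.fob_in b.nsrc.fob_in b.ntgt.fob_in
  show ?thesis
  proof (rule ntrans_eqI[where S = "Obj B"])
    fix X assume X: "X \<in> Obj B"
    show "ncmp (hcomp B E \<gamma> (hcomp B D \<beta> \<alpha>)) X = ncmp (hcomp B E (hcomp C E \<gamma> \<beta>) \<alpha>) X"
      using X by (simp add: c.nsrc.far_Comp_Arr c.nsrc.target.Arr_assoc)
  qed (auto simp: hcomp_def ftor_comp_assoc[OF a.nsrc.cat_functor_axioms] ftor_comp_assoc[OF a.ntgt.cat_functor_axioms])
qed

lemma hcomp_id:
  assumes "nat_trans C D \<alpha>"
  shows "hcomp C D \<alpha> (id_ntrans C C (id_ftor C)) = \<alpha>" "hcomp C D (id_ntrans D D (id_ftor D)) \<alpha> = \<alpha>"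
proof -
  interpret a: nat_trans C D \<alpha> by fact
  note [simp] = a.ncmp_Arr a.nsrc.fob_in a.ntgt.fob_in a.ncmp_ext ftor_comp_id[OF a.nsrc.cat_functor_axioms]
     ftor_comp_id[OF a.ntgt.cat_functor_axioms]
  show "hcomp C D \<alpha> (id_ntrans C C (id_ftor C)) = \<alpha>"
    by (rule ntrans_eqI[where S = "Obj C"])
     (auto simp: a.nsrc.far_Ident a.nsrc.target.Arr_Comp_Ident hcomp_def[of C D \<alpha>])
  show "hcomp C D (id_ntrans D D (id_ftor D)) \<alpha> = \<alpha>"
    by (rule ntrans_eqI[where S = "Obj C"])
     (auto simp: a.nsrc.target.Arr_Ident_Comp hcomp_def[of C D _ \<alpha>])
qed

lemma hcomp_id_id:
  assumes "cat_functor C D F" "cat_functor D E G"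
  shows "hcomp C E (id_ntrans D E G) (id_ntrans C D F) = id_ntrans C E (ftor_comp C G F)"
proof -
  interpret F: cat_functor C D F by fact
  interpret G: cat_functor D E G by fact
  show ?thesis
    by (rule ntrans_eqI[where S = "Obj C"])
      (auto simp: F.fob_in G.fob_in G.far_Ident G.target.Ident_Arr G.target.Arr_Ident_Comp,
       auto simp: hcomp_def id_ntrans_def)
qed

section \<open>The 2-category of sites\<close>

lemma two_op_simps [simp]:
  "Ob (two_op A) = Ob A" "HomC (two_op A) X Y = op_cat (HomC A Y X)" "Id1 (two_op A) = Id1 A"
  "fob (HComp (two_op A) X Y Z) (g, f) = fob (HComp A Z Y X) (f, g)"
  "far (HComp (two_op A) X Y Z) (\<beta>, \<alpha>) = far (HComp A Z Y X) (\<alpha>, \<beta>)"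
  by (simp_all add: two_op_def)

lemma HComp_two_op: "HComp (two_op A) X Y Z =
    \<lparr>fob = fob (HComp A Z Y X) \<circ> prod.swap, far = far (HComp A Z Y X) \<circ> prod.swap\<rparr>"
  by (simp add: two_op_def)

text \<open>Reversing 1-cells exchanges the factors of the product on which composition is defined,
  and reversing 2-cells replaces each hom-category by its opposite. This is the functoriality that
  \<open>HComp (two_op A)\<close> requires.\<close>

lemma cat_functor_swap:
  assumes "cat_functor (prod_cat C D) E F" "category C" "category D"
  shows "cat_functor (prod_cat (op_cat D) (op_cat C)) (op_cat E)
    \<lparr>fob = fob F \<circ> prod.swap, far = far F \<circ> prod.swap\<rparr>"
proof -
  interpret F: cat_functor "prod_cat C D" E F by fact
  interpret s: category "prod_cat (op_cat D) (op_cat C)"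
    by (intro category_prod_cat category_op_cat assms)
  interpret t: category "op_cat E"
    by (intro category_op_cat F.target.category_axioms)
  show ?thesis
  proof
    show "fob \<lparr>fob = fob F \<circ> prod.swap, far = far F \<circ> prod.swap\<rparr> \<in> extensional (Obj (prod_cat (op_cat D) (op_cat C)))"
      using F.fob_ext by (auto simp: extensional_def)
    show "far \<lparr>fob = fob F \<circ> prod.swap, far = far F \<circ> prod.swap\<rparr> \<in> extensional (Arr (prod_cat (op_cat D) (op_cat C)))"
      using F.far_ext by (auto simp: extensional_def)
  next
    fix X assume "X \<in> Obj (prod_cat (op_cat D) (op_cat C))"
    then show "fob \<lparr>fob = fob F \<circ> prod.swap, far = far F \<circ> prod.swap\<rparr> X \<in> Obj (op_cat E)"
      "far \<lparr>fob = fob F \<circ> prod.swap, far = far F \<circ> prod.swap\<rparr> (Ident (prod_cat (op_cat D) (op_cat C)) X)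
        = Ident (op_cat E) (fob \<lparr>fob = fob F \<circ> prod.swap, far = far F \<circ> prod.swap\<rparr> X)"
      using F.fob_in[of "prod.swap X"] F.far_Ident[of "prod.swap X"] by auto
  next
    fix f X Y assume "f \<in> Hom (prod_cat (op_cat D) (op_cat C)) X Y"
    then show "far \<lparr>fob = fob F \<circ> prod.swap, far = far F \<circ> prod.swap\<rparr> f
       \<in> Hom (op_cat E) (fob \<lparr>fob = fob F \<circ> prod.swap, far = far F \<circ> prod.swap\<rparr> X)
                        (fob \<lparr>fob = fob F \<circ> prod.swap, far = far F \<circ> prod.swap\<rparr> Y)"
      using F.far_in[of "prod.swap f" "prod.swap Y" "prod.swap X"]
      by (cases f; cases X; cases Y) (auto simp: Hom_prod_cat)
  next
    fix f g X Y Z assume "f \<in> Hom (prod_cat (op_cat D) (op_cat C)) X Y" "g \<in> Hom (prod_cat (op_cat D) (op_cat C)) Y Z"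
    then show "far \<lparr>fob = fob F \<circ> prod.swap, far = far F \<circ> prod.swap\<rparr> (Comp (prod_cat (op_cat D) (op_cat C)) g f) =
       Comp (op_cat E) (far \<lparr>fob = fob F \<circ> prod.swap, far = far F \<circ> prod.swap\<rparr> g)
        (far \<lparr>fob = fob F \<circ> prod.swap, far = far F \<circ> prod.swap\<rparr> f)"
      using F.far_Comp[of "prod.swap g" "prod.swap Z" "prod.swap Y" "prod.swap f" "prod.swap X"]
      by (cases f; cases g; cases X; cases Y; cases Z) (auto simp: Hom_prod_cat)
  qed
qed

lemma two_category_two_op: "two_category (two_op A)" if "two_category A"
proof -
  interpret two_category A by fact
  show ?thesis
  proof (rule two_category.intro)
    fix X Y Z assume "X \<in> Ob (two_op A)" "Y \<in> Ob (two_op A)" "Z \<in> Ob (two_op A)"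
    then show "cat_functor (prod_cat (HomC (two_op A) Y Z) (HomC (two_op A) X Y)) (HomC (two_op A) X Z)
        (HComp (two_op A) X Y Z)"
      unfolding HComp_two_op two_op_simps by (intro cat_functor_swap HComp_functor HomC_category) auto
  qed (auto simp: HomC_category category_op_cat Id1_in fob_assoc far_assoc fob_unit far_unit)
qed

text \<open>The legs of a cone are not extensional, so applying \<open>id_ftor\<close> to them
  changes values outside \<open>Obj J\<close>. Being a limit depends on the values on
  \<open>Obj J\<close> only, because \<open>Dom J h\<close> and \<open>Cod J h\<close> lie there;
  the same argument returns for composites and restrictions.\<close>

lemma exact_ftor_id: "exact_ftor C C (id_ftor C)"
  unfolding exact_ftor_def finite_diagram_def
proof (intro allI impI)
  fix J D L p
  assume A: "(finite (Obj J) \<and> finite (Arr J) \<and> cat_functor J C D) \<and> is_limit J C D L p"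
  then have "\<forall>i\<in>Obj J. far (id_ftor C) (p i) = p i" "fob (id_ftor C) L = L" "ftor_comp J (id_ftor C) D = D"
    by (auto simp: is_limit_def is_cone_def Hom_def ftor_comp_id)
  moreover have "\<forall>h\<in>Arr J. Dom J h \<in> Obj J \<and> Cod J h \<in> Obj J"
    using A by (auto simp: category.Dom_in category.Cod_in cat_functor_def)
  ultimately show "is_limit J C (ftor_comp J (id_ftor C) D) (fob (id_ftor C) L) (\<lambda>i. far (id_ftor C) (p i))"
    using A unfolding is_limit_def is_cone_def by simp
qed

lemma finite_diagram_ftor_comp:
  assumes "finite_diagram J C D" "cat_functor C C' F"
  shows "finite_diagram J C' (ftor_comp J F D)"
  using assms cat_functor_ftor_comp unfolding finite_diagram_def by blast

lemma exact_ftor_comp: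
  assumes "exact_ftor C D F" "exact_ftor D E G" "cat_functor C D F"
  shows "exact_ftor C E (ftor_comp C G F)"
  unfolding exact_ftor_def
proof (intro allI impI)
  fix J K L p assume A: "finite_diagram J C K \<and> is_limit J C K L p"
  then have K: "cat_functor J C K" by (simp add: finite_diagram_def)
  have J: "\<forall>h\<in>Arr J. Dom J h \<in> Obj J \<and> Cod J h \<in> Obj J"
    using K by (auto simp: category.Dom_in category.Cod_in cat_functor_def)
  have "is_limit J E (ftor_comp J G (ftor_comp J F K)) (fob G (fob F L)) (\<lambda>i. far G (far F (p i)))"
    using assms A finite_diagram_ftor_comp unfolding exact_ftor_def by blast
  moreover have "L \<in> Obj C" "\<forall>i\<in>Obj J. p i \<in> Arr C" using A by (auto simp: is_limit_def is_cone_def Hom_def)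
  ultimately show "is_limit J E (ftor_comp J (ftor_comp C G F) K) (fob (ftor_comp C G F) L)
      (\<lambda>i. far (ftor_comp C G F) (p i))"
    using J unfolding ftor_comp_assoc[OF K] is_limit_def is_cone_def by simp
qed

lemma covering_family_Arr: "covering_family T X \<Phi> \<Longrightarrow> X \<in> Obj (ucat T) \<and> \<Phi> \<subseteq> Arr (ucat T)"
  by (auto simp: covering_family_def)

lemma continuous_ftor_id: "continuous_ftor T T (id_ftor (ucat T))"
  unfolding continuous_ftor_def
proof (intro allI impI)
  fix X \<Phi> assume A: "covering_family T X \<Phi>"
  then have "far (id_ftor (ucat T)) ` \<Phi> = \<Phi>"
    using covering_family_Arr[OF A] by (force simp: subset_iff)
  then show "covering_family T (fob (id_ftor (ucat T)) X) (far (id_ftor (ucat T)) ` \<Phi>)"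
    using A covering_family_Arr[OF A] by simp
qed

lemma continuous_ftor_comp: "continuous_ftor T T'' (ftor_comp (ucat T) G F)"
  if F: "continuous_ftor T T' F" and G: "continuous_ftor T' T'' G"
  unfolding continuous_ftor_def
proof (intro allI impI)
  fix X \<Phi> assume A: "covering_family T X \<Phi>"
  then have "covering_family T'' (fob G (fob F X)) (far G ` far F ` \<Phi>)"
    using F G unfolding continuous_ftor_def by blast
  moreover have "far (ftor_comp (ucat T) G F) ` \<Phi> = far G ` far F ` \<Phi>"
    using covering_family_Arr[OF A] by (auto simp: image_iff subset_iff)
  ultimately show "covering_family T'' (fob (ftor_comp (ucat T) G F) X) (far (ftor_comp (ucat T) G F) ` \<Phi>)"
    using covering_family_Arr[OF A] by simp
qed

text \<open>Membership in \<open>Obj (Sit_star_hom T T')\<close>, as a predicate with its own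
  composition law, so that the full subcategory of the functor category need not be unfolded each
  time.\<close>

definition site_ftor :: "('o, 'a) site \<Rightarrow> ('p, 'b) site \<Rightarrow> ('o, 'a, 'p, 'b) ftor \<Rightarrow> bool" where
  "site_ftor T T' F \<longleftrightarrow> cat_functor (ucat T) (ucat T') F \<and> continuous_ftor T T' F
    \<and> exact_ftor (ucat T) (ucat T') F"

lemma site_ftor_id: "category (ucat T) \<Longrightarrow> site_ftor T T (id_ftor (ucat T))"
  by (auto simp: site_ftor_def cat_functor_id_ftor continuous_ftor_id exact_ftor_id)

lemma site_ftor_comp: "site_ftor T T' F \<Longrightarrow> site_ftor T' T'' G \<Longrightarrow> site_ftor T T'' (ftor_comp (ucat T) G F)"
  unfolding site_ftor_def
  by (auto intro: cat_functor_ftor_comp continuous_ftor_comp exact_ftor_comp)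

section \<open>The hom-categories and the composition of \<open>Sit_star\<close>\<close>

lemma category_Sit_star_hom: "category (Sit_star_hom T T')"
  unfolding Sit_star_hom_def by (intro category_full_subcat category_functor_cat)

lemma nat_trans_functors: "nat_trans C D \<alpha> \<Longrightarrow> cat_functor C D (nsrc \<alpha>) \<and> cat_functor C D (ntgt \<alpha>)"
  by (simp add: nat_trans_def)

lemma Sit_star_hom_simps [simp]:
  "F \<in> Obj (Sit_star_hom T T') \<longleftrightarrow> site_ftor T T' F"
  "\<alpha> \<in> Arr (Sit_star_hom T T') \<longleftrightarrow> nat_trans (ucat T) (ucat T') \<alpha> \<and> site_ftor T T' (nsrc \<alpha>) \<and> site_ftor T T' (ntgt \<alpha>)"
  "Dom (Sit_star_hom T T') = nsrc" "Cod (Sit_star_hom T T') = ntgt"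
  "Ident (Sit_star_hom T T') = id_ntrans (ucat T) (ucat T')" "Comp (Sit_star_hom T T') = vcomp (ucat T) (ucat T')"
  by (auto simp: Sit_star_hom_def site_ftor_def dest: nat_trans_functors)

lemma Hom_Sit_star_hom: "\<alpha> \<in> Hom (Sit_star_hom T T') F G \<longleftrightarrow> nat_trans (ucat T) (ucat T') \<alpha> \<and> site_ftor T T' F \<and>
   site_ftor T T' G \<and> nsrc \<alpha> = F \<and> ntgt \<alpha> = G"
  by (auto simp: Hom_def)

lemma Sit_star_simps [simp]:
  "Ob (Sit_star U) = {T. site U T}" "HomC (Sit_star U) = Sit_star_hom" "Id1 (Sit_star U) T = id_ftor (ucat T)"
  "site_ftor T1 T2 F \<Longrightarrow> site_ftor T2 T3 G \<Longrightarrow> fob (HComp (Sit_star U) T1 T2 T3) (G, F) = ftor_comp (ucat T1) G F"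
  "\<alpha> \<in> Arr (Sit_star_hom T1 T2) \<Longrightarrow> \<beta> \<in> Arr (Sit_star_hom T2 T3) \<Longrightarrow>
    far (HComp (Sit_star U) T1 T2 T3) (\<beta>, \<alpha>) = hcomp (ucat T1) (ucat T3) \<beta> \<alpha>"
  by (auto simp: Sit_star_def)

lemma two_category_Sit_star: "two_category (Sit_star U :: (('o, 'a) site, ('o, 'a, 'o, 'a) ftor, ('o, 'a, 'o, 'a) ntrans) two_cat)"
proof (rule two_category.intro)
  fix T1 T2 T3 :: "('o, 'a) site" assume "T1 \<in> Ob (Sit_star U)" "T2 \<in> Ob (Sit_star U)" "T3 \<in> Ob (Sit_star U)"
  let ?P = "prod_cat (HomC (Sit_star U) T2 T3) (HomC (Sit_star U) T1 T2)" and ?H = "HComp (Sit_star U) T1 T2 T3"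
  interpret s: category ?P
    by (auto intro: category_prod_cat category_Sit_star_hom)
  interpret t: category "HomC (Sit_star U) T1 T3"
    by (auto intro: category_Sit_star_hom)
  show "cat_functor ?P (HomC (Sit_star U) T1 T3) ?H"
  proof
    show "fob ?H \<in> extensional (Obj ?P)" "far ?H \<in> extensional (Arr ?P)"
      by (auto simp: Sit_star_def)
  next
    fix X assume X: "X \<in> Obj ?P"
    obtain G F where [simp]: "X = (G, F)" by force
    show "fob ?H X \<in> Obj (HomC (Sit_star U) T1 T3)" using X site_ftor_comp by auto
    show "far ?H (Ident ?P X) = Ident (HomC (Sit_star U) T1 T3) (fob ?H X)"
      using X by (auto simp: nat_trans_id site_ftor_def intro!: hcomp_id_id)
  next
    fix f X Y assume "f \<in> Hom ?P X Y"
    then show "far ?H f \<in> Hom (HomC (Sit_star U) T1 T3) (fob ?H X) (fob ?H Y)"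
      by (cases f; cases X; cases Y) (auto simp: Hom_prod_cat Hom_Sit_star_hom site_ftor_comp intro: nat_trans_hcomp)
  next
    fix f g X Y Z assume "f \<in> Hom ?P X Y" "g \<in> Hom ?P Y Z"
    then show "far ?H (Comp ?P g f) = Comp (HomC (Sit_star U) T1 T3) (far ?H g) (far ?H f)"
      by (cases f; cases g; cases X; cases Y; cases Z)
        (auto simp: Hom_prod_cat Hom_Sit_star_hom nat_trans_vcomp intro: hcomp_interchange)
  qed
next
  fix T1 T2 T3 T4 :: "('o, 'a) site" and F G H
  assume "F \<in> Obj (HomC (Sit_star U) T1 T2)" "G \<in> Obj (HomC (Sit_star U) T2 T3)"
    "H \<in> Obj (HomC (Sit_star U) T3 T4)"
  then show "fob (HComp (Sit_star U) T1 T3 T4) (H, fob (HComp (Sit_star U) T1 T2 T3) (G, F)) =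
    fob (HComp (Sit_star U) T1 T2 T4) (fob (HComp (Sit_star U) T2 T3 T4) (H, G), F)"
    by (auto simp: site_ftor_comp) (auto simp: site_ftor_def ftor_comp_assoc)
next
  fix T1 T2 T3 T4 :: "('o, 'a) site" and F G H
  assume A: "F \<in> Arr (HomC (Sit_star U) T1 T2)" "G \<in> Arr (HomC (Sit_star U) T2 T3)"
    "H \<in> Arr (HomC (Sit_star U) T3 T4)"
  then show "far (HComp (Sit_star U) T1 T3 T4) (H, far (HComp (Sit_star U) T1 T2 T3) (G, F)) =
    far (HComp (Sit_star U) T1 T2 T4) (far (HComp (Sit_star U) T2 T3 T4) (H, G), F)"
    using nat_trans_hcomp[of "ucat T1" "ucat T2" F "ucat T3" G] nat_trans_hcomp[of "ucat T2" "ucat T3" G "ucat T4" H]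
    by (auto simp: site_ftor_comp intro: hcomp_assoc)
next
  fix T1 T2 :: "('o, 'a) site" and F
  assume "T1 \<in> Ob (Sit_star U)" "T2 \<in> Ob (Sit_star U)" "F \<in> Obj (HomC (Sit_star U) T1 T2)"
  then show "fob (HComp (Sit_star U) T1 T1 T2) (F, Id1 (Sit_star U) T1) = F \<and>
        fob (HComp (Sit_star U) T1 T2 T2) (Id1 (Sit_star U) T2, F) = F"
    by (auto simp: site_ftor_id site_def grothendieck_topology_def) (auto simp: site_ftor_def ftor_comp_id)
next
  fix T1 T2 :: "('o, 'a) site" and F
  assume "T1 \<in> Ob (Sit_star U)" "T2 \<in> Ob (Sit_star U)" "F \<in> Arr (HomC (Sit_star U) T1 T2)"
  then show "far (HComp (Sit_star U) T1 T1 T2) (F, Id2 (Sit_star U) T1) = F \<and>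
        far (HComp (Sit_star U) T1 T2 T2) (Id2 (Sit_star U) T2, F) = F"
    by (auto simp: site_ftor_id site_def grothendieck_topology_def hcomp_id nat_trans_id cat_functor_id_ftor)
qed (auto simp: category_Sit_star_hom site_ftor_id site_def grothendieck_topology_def)

lemma two_category_Sit: "two_category (Sit U)"
  unfolding Sit_def by (intro two_category_two_op two_category_Sit_star)

section \<open>Sheaves as families of sets with restriction maps\<close>

lemma Set_cat_simps [simp]:
  "X \<in> Obj (Set_cat U) \<longleftrightarrow> X \<subseteq> U \<and> small U X"
  "(X, Y, f) \<in> Arr (Set_cat U) \<longleftrightarrow> X \<subseteq> U \<and> small U X \<and> Y \<subseteq> U \<and> small U Y \<and> f \<in> X \<rightarrow>\<^sub>E Y"
  "Dom (Set_cat U) (X, Y, f) = X" "Cod (Set_cat U) (X, Y, f) = Y"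
  "Ident (Set_cat U) X = (X, X, \<lambda>x\<in>X. x)"
  "Comp (Set_cat U) (Y', Z, g) (X, Y, f) = (X, Z, compose X g f)"
  by (auto simp: Set_cat_def)

lemma Hom_Set_cat: "(X', Y', f) \<in> Hom (Set_cat U) X Y \<longleftrightarrow>
    X' = X \<and> Y' = Y \<and> X \<subseteq> U \<and> small U X \<and> Y \<subseteq> U \<and> small U Y \<and> f \<in> X \<rightarrow>\<^sub>E Y"
  by (auto simp: Hom_def)

lemma Hom_Set_catE:
  assumes "s \<in> Hom (Set_cat U) X Y"
  obtains f where "s = (X, Y, f)" "f \<in> X \<rightarrow>\<^sub>E Y"
  using assms by (cases s) (auto simp: Hom_Set_cat)

lemma category_Set_cat: "category (Set_cat U)"
proof (rule category.intro)
  fix f assume "f \<in> Arr (Set_cat U)"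
  then show "Dom (Set_cat U) f \<in> Obj (Set_cat U)" "Cod (Set_cat U) f \<in> Obj (Set_cat U)"
    by (cases f; simp)+
next
  fix f g X Y Z assume "f \<in> Hom (Set_cat U) X Y" "g \<in> Hom (Set_cat U) Y Z"
  then show "Comp (Set_cat U) g f \<in> Hom (Set_cat U) X Z"
    by (cases f; cases g) (auto simp: Hom_Set_cat compose_def)
next
  fix f X Y assume "f \<in> Hom (Set_cat U) X Y"
  then show "Comp (Set_cat U) f (Ident (Set_cat U) X) = f" "Comp (Set_cat U) (Ident (Set_cat U) Y) f = f"
    by (cases f; auto simp: Hom_Set_cat compose_def fun_eq_iff PiE_def extensional_def Pi_def)+
next
  fix f g h W X Y Z assume "f \<in> Hom (Set_cat U) W X" "g \<in> Hom (Set_cat U) X Y" "h \<in> Hom (Set_cat U) Y Z"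
  then show "Comp (Set_cat U) h (Comp (Set_cat U) g f) = Comp (Set_cat U) (Comp (Set_cat U) h g) f"
    by (cases f; cases g; cases h) (auto simp: Hom_Set_cat compose_def fun_eq_iff PiE_def Pi_def)
qed (auto simp: Hom_Set_cat)

text \<open>Sections may have any type \<open>'b\<close>, unlike those of a \<open>presheaf\<close>,
  which are elements of \<open>U\<close>. Tuples, pairs and sieves can thus serve as sections
  directly, and \<open>sheaf_of_data\<close> moves them into \<open>U\<close> once and for
  all.\<close>

definition presheaf_data :: "('o, 'a) cat \<Rightarrow> ('o \<Rightarrow> 'b set) \<Rightarrow> ('a \<Rightarrow> 'b \<Rightarrow> 'b) \<Rightarrow> bool" where
  "presheaf_data C S \<rho> \<longleftrightarrow> (\<forall>f \<in> Arr C. \<forall>x \<in> S (Cod C f). \<rho> f x \<in> S (Dom C f)) \<and>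
    (\<forall>X \<in> Obj C. \<forall>x \<in> S X. \<rho> (Ident C X) x = x) \<and>
    (\<forall>f \<in> Arr C. \<forall>g \<in> Arr C. Cod C g = Dom C f \<longrightarrow> (\<forall>x \<in> S (Cod C f). \<rho> (Comp C f g) x = \<rho> g (\<rho> f x)))"

definition matching :: "('o, 'a) cat \<Rightarrow> ('o \<Rightarrow> 'b set) \<Rightarrow> ('a \<Rightarrow> 'b \<Rightarrow> 'b) \<Rightarrow> 'a set \<Rightarrow> ('a \<Rightarrow> 'b) \<Rightarrow> bool" where
  "matching C S \<rho> R x \<longleftrightarrow> (\<forall>f \<in> R. x f \<in> S (Dom C f)) \<and>
     (\<forall>f \<in> R. \<forall>g \<in> Arr C. Cod C g = Dom C f \<longrightarrow> x (Comp C f g) = \<rho> g (x f))"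

definition sheaf_data :: "('o, 'a) site \<Rightarrow> ('o \<Rightarrow> 'b set) \<Rightarrow> ('a \<Rightarrow> 'b \<Rightarrow> 'b) \<Rightarrow> bool" where
  "sheaf_data T S \<rho> \<longleftrightarrow> presheaf_data (ucat T) S \<rho> \<and>
    (\<forall>X \<in> Obj (ucat T). \<forall>R \<in> cov T X. \<forall>x. matching (ucat T) S \<rho> R x
       \<longrightarrow> (\<exists>!s. s \<in> S X \<and> (\<forall>f \<in> R. \<rho> f s = x f)))"

lemma matching_family_iff: "matching_family C P R x \<longleftrightarrow> matching C (fob P) (restr P) R x"
  by (simp add: matching_family_def matching_def)

lemma is_sheaf_functor: "is_sheaf U T P \<Longrightarrow> cat_functor (op_cat (ucat T)) (Set_cat U) P"
  by (simp add: is_sheaf_def presheaf_cat_def)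

lemma far_presheaf:
  assumes "cat_functor (op_cat C) (Set_cat U) P" "f \<in> Arr C"
  shows "far P f = (fob P (Cod C f), fob P (Dom C f), restr P f)" "restr P f \<in> fob P (Cod C f) \<rightarrow>\<^sub>E fob P (Dom C f)"
proof -
  interpret cat_functor "op_cat C" "Set_cat U" P by fact
  have "far P f \<in> Hom (Set_cat U) (fob P (Cod C f)) (fob P (Dom C f))"
    using assms(2) by (intro far_in) (auto simp: Hom_def)
  then show "far P f = (fob P (Cod C f), fob P (Dom C f), restr P f)" "restr P f \<in> fob P (Cod C f) \<rightarrow>\<^sub>E fob P (Dom C f)"
    by (auto elim!: Hom_Set_catE simp: restr_def)
qed

lemma presheaf_data_of_functor:
  assumes "cat_functor (op_cat C) (Set_cat U) P"
  shows "presheaf_data C (fob P) (restr P)"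
proof -
  interpret cat_functor "op_cat C" "Set_cat U" P by fact
  note far = far_presheaf[OF assms]
  show ?thesis
    unfolding presheaf_data_def
  proof (intro conjI ballI impI)
    fix f x assume "f \<in> Arr C" "x \<in> fob P (Cod C f)"
    then show "restr P f x \<in> fob P (Dom C f)" using far(2) by blast
  next
    fix X x assume X: "X \<in> Obj C" "x \<in> fob P X"
    then have "far P (Ident C X) = (fob P X, fob P X, \<lambda>x\<in>fob P X. x)"
      using far_Ident[of X] by simp
    then show "restr P (Ident C X) x = x" using X by (simp add: restr_def)
  next
    fix f g x assume A: "f \<in> Arr C" "g \<in> Arr C" "Cod C g = Dom C f" "x \<in> fob P (Cod C f)"
    then have "far P (Comp C f g) = Comp (Set_cat U) (far P g) (far P f)"
      using far_Comp_Arr[of f g] by simp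
    then show "restr P (Comp C f g) x = restr P g (restr P f x)"
      using A by (simp add: far(1)) (simp add: restr_def compose_def)
  qed
qed

lemma is_sheaf_iff:
  "is_sheaf U T P \<longleftrightarrow> cat_functor (op_cat (ucat T)) (Set_cat U) P \<and> sheaf_data T (fob P) (restr P)"
  unfolding is_sheaf_def sheaf_data_def matching_family_iff presheaf_cat_def
  using presheaf_data_of_functor by auto

text \<open>Each small set \<open>S X\<close> is injected into \<open>U\<close> by a chosen
  \<open>e X\<close>, and the restriction maps are transported along these injections. Gluing is a
  property of the data up to bijection, so it survives.\<close>

lemma sheaf_of_data:
  assumes "grothendieck_topology T" and S: "sheaf_data T S \<rho>" and small: "\<And>X. X \<in> Obj (ucat T) \<Longrightarrow> small U (S X)"
  obtains P e where "is_sheaf U T P" "\<And>X. X \<in> Obj (ucat T) \<Longrightarrow> bij_betw (e X) (S X) (fob P X)"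
    "\<And>f x. f \<in> Arr (ucat T) \<Longrightarrow> x \<in> S (Cod (ucat T) f) \<Longrightarrow>
      restr P f (e (Cod (ucat T) f) x) = e (Dom (ucat T) f) (\<rho> f x)"
proof -
  interpret grothendieck_topology T by fact
  interpret op: category "op_cat (ucat T)" by (rule category_op_cat) unfold_locales
  interpret Set: category "Set_cat U" by (rule category_Set_cat)
  let ?C = "ucat T"
  note [simp] = Dom_in Cod_in Ident_Arr Comp_Arr
  have "\<forall>X\<in>Obj ?C. \<exists>e. inj_on e (S X) \<and> e ` S X \<subseteq> U"
    by (intro ballI small_embed small)
  from bchoice[OF this] have "\<exists>e. \<forall>X\<in>Obj ?C. inj_on (e X) (S X) \<and> e X ` S X \<subseteq> U" .
  then obtain e where e: "\<And>X. X \<in> Obj ?C \<Longrightarrow> inj_on (e X) (S X)" "\<And>X. X \<in> Obj ?C \<Longrightarrow> e X ` S X \<subseteq> U"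
    by blast
  define d where "d X = inv_into (S X) (e X)" for X
  have de [simp]: "d X (e X x) = x" if "X \<in> Obj ?C" "x \<in> S X" for X x
    using that e by (simp add: d_def)
  \<comment> \<open>This is \<rho> \<open>f\<close> conjugated by the injections, cut off outside
    the image because arrows of \<open>Set_cat\<close> are extensional.\<close>
  define r where "r f = (\<lambda>y\<in>e (Cod ?C f) ` S (Cod ?C f). e (Dom ?C f) (\<rho> f (d (Cod ?C f) y)))" for f
  define P :: "('a, 'b, 'd) presheaf" where "P = \<lparr>fob = (\<lambda>X\<in>Obj ?C. e X ` S X),
     far = (\<lambda>f\<in>Arr ?C. (e (Cod ?C f) ` S (Cod ?C f), e (Dom ?C f) ` S (Dom ?C f), r f))\<rparr>"
  have pd: "presheaf_data ?C S \<rho>" using S by (simp add: sheaf_data_def)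
  have \<rho> [simp]: "\<rho> f x \<in> S (Dom ?C f)" if "f \<in> Arr ?C" "x \<in> S (Cod ?C f)" for f x
    using pd that by (simp add: presheaf_data_def)
  have \<rho>_id: "\<rho> (Ident ?C X) x = x" if "X \<in> Obj ?C" "x \<in> S X" for X x
    using pd that by (simp add: presheaf_data_def)
  have \<rho>_Comp: "\<rho> (Comp ?C f g) x = \<rho> g (\<rho> f x)" if "f \<in> Arr ?C" "g \<in> Arr ?C" "Cod ?C g = Dom ?C f" "x \<in> S (Cod ?C f)" for f g x
    using pd that by (simp add: presheaf_data_def)
  have fobP: "fob P X = e X ` S X" if "X \<in> Obj ?C" for X using that by (simp add: P_def)
  have r: "r f (e (Cod ?C f) x) = e (Dom ?C f) (\<rho> f x)" if "f \<in> Arr ?C" "x \<in> S (Cod ?C f)" for f x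
    using that by (simp add: r_def)
  have restr: "restr P f = r f" if "f \<in> Arr ?C" for f using that by (simp add: P_def restr_def)
  have P: "cat_functor (op_cat ?C) (Set_cat U) P"
  proof unfold_locales
    fix X assume X: "X \<in> Obj (op_cat ?C)"
    then show "fob P X \<in> Obj (Set_cat U)" using e small by (auto simp: P_def intro: small_image)
    show "far P (Ident (op_cat ?C) X) = Ident (Set_cat U) (fob P X)"
      using X \<rho>_id by (auto simp: P_def r_def fun_eq_iff)
  next
    fix f X Y assume f: "f \<in> Hom (op_cat ?C) X Y"
    then have f: "f \<in> Arr ?C" "X = Cod ?C f" "Y = Dom ?C f" by (auto simp: Hom_def)
    have "r f \<in> e X ` S X \<rightarrow>\<^sub>E e Y ` S Y"
      using f(1) unfolding f(2,3) r_def by auto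
    then show "far P f \<in> Hom (Set_cat U) (fob P X) (fob P Y)"
      using f e small by (auto simp: P_def Hom_Set_cat intro!: small_image)
  next
    fix f g X Y Z assume "f \<in> Hom (op_cat ?C) X Y" "g \<in> Hom (op_cat ?C) Y Z"
    then have f: "f \<in> Arr ?C" "g \<in> Arr ?C" "Cod ?C g = Dom ?C f" by (auto simp: Hom_def)
    have "r (Comp ?C f g) = compose (e (Cod ?C f) ` S (Cod ?C f)) (r g) (r f)"
    proof
      fix y show "r (Comp ?C f g) y = compose (e (Cod ?C f) ` S (Cod ?C f)) (r g) (r f) y"
      proof (cases "y \<in> e (Cod ?C f) ` S (Cod ?C f)")
        case True
        then obtain x where x: "x \<in> S (Cod ?C f)" "y = e (Cod ?C f) x" by blast
        then show ?thesis using f r[of f x] r[of "Comp ?C f g" x] r[of g "\<rho> f x"] by (simp add: compose_def \<rho>_Comp)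
      qed (use f in \<open>simp add: r_def compose_def\<close>)
    qed
    then show "far P (Comp (op_cat ?C) g f) = Comp (Set_cat U) (far P g) (far P f)"
      using f by (simp add: P_def)
  qed (auto simp: P_def)
  have "sheaf_data T (fob P) (restr P)"
    unfolding sheaf_data_def
  proof (intro conjI ballI allI impI)
    show "presheaf_data ?C (fob P) (restr P)" by (rule presheaf_data_of_functor[OF P])
    fix X R x assume X: "X \<in> Obj ?C" and R: "R \<in> cov T X" and m: "matching ?C (fob P) (restr P) R x"
    have RA: "f \<in> Arr ?C" "Cod ?C f = X" if "f \<in> R" for f
      using cov_sieve[OF X R] that by (auto simp: sieve_def)
    define x' where "x' f = d (Dom ?C f) (x f)" for f
    have xP: "x f \<in> e (Dom ?C f) ` S (Dom ?C f)" if "f \<in> R" for f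
      using m that RA by (auto simp: matching_def fobP)
    have x': "x' f \<in> S (Dom ?C f)" "e (Dom ?C f) (x' f) = x f" if "f \<in> R" for f
      using xP[OF that] RA that by (auto simp: x'_def)
    have "matching ?C S \<rho> R x'"
      unfolding matching_def
    proof (intro conjI ballI impI)
      fix f g assume A: "f \<in> R" "g \<in> Arr ?C" "Cod ?C g = Dom ?C f"
      then have "x (Comp ?C f g) = restr P g (e (Dom ?C f) (x' f))"
        using m x' by (simp add: matching_def)
      also have "\<dots> = e (Dom ?C g) (\<rho> g (x' f))"
        using A RA x' r[of g "x' f"] by (simp add: restr)
      finally show "x' (Comp ?C f g) = \<rho> g (x' f)"
        using A RA x' \<rho>[of g "x' f"] by (simp add: x'_def)
    qed (use x' in auto)
    then obtain s where s: "s \<in> S X" "\<And>f. f \<in> R \<Longrightarrow> \<rho> f s = x' f"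
      and u: "\<And>t. t \<in> S X \<Longrightarrow> \<forall>f\<in>R. \<rho> f t = x' f \<Longrightarrow> t = s"
      using S X R unfolding sheaf_data_def by metis
    have rs: "r f (e X s) = x f" if "f \<in> R" for f
      using r[OF RA(1)[OF that], of s] RA(2)[OF that] s x' that by simp
    show "\<exists>!s. s \<in> fob P X \<and> (\<forall>f\<in>R. restr P f s = x f)"
    proof (rule ex1I[of _ "e X s"])
      show "e X s \<in> fob P X \<and> (\<forall>f\<in>R. restr P f (e X s) = x f)"
        using s RA X rs by (auto simp: fobP restr)
    next
      fix t assume t: "t \<in> fob P X \<and> (\<forall>f\<in>R. restr P f t = x f)"
      then obtain t' where t': "t' \<in> S X" "t = e X t'" using X by (auto simp: fobP)
      have "\<rho> f t' = x' f" if "f \<in> R" for f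
      proof -
        have "e (Dom ?C f) (\<rho> f t') = x f" using t t' that RA r[of f t'] by (auto simp: restr)
        then show ?thesis using that RA t' \<rho>[of f t'] by (metis Dom_in de x'_def)
      qed
      then show "t = e X s" using u t' by blast
    qed
  qed
  with P have "is_sheaf U T P" by (simp add: is_sheaf_iff)
  moreover have "bij_betw (e X) (S X) (fob P X)" if "X \<in> Obj ?C" for X
    using that e by (simp add: bij_betw_def fobP)
  moreover have "restr P f (e (Cod ?C f) x) = e (Dom ?C f) (\<rho> f x)" if "f \<in> Arr ?C" "x \<in> S (Cod ?C f)" for f x
    using r[OF that] that by (simp add: restr)
  ultimately show ?thesis using that by blast
qed

section \<open>Morphisms of sheaves as natural families of maps\<close>

definition ap :: "('o, 'a, 'u set, 'u set \<times> 'u set \<times> ('u \<Rightarrow> 'u)) ntrans \<Rightarrow> 'o \<Rightarrow> 'u \<Rightarrow> 'u" where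
  "ap \<sigma> X = snd (snd (ncmp \<sigma> X))"

lemma Hom_Sh: "\<sigma> \<in> Hom (Sh U T) P Q \<longleftrightarrow> is_sheaf U T P \<and> is_sheaf U T Q \<and>
    nat_trans (op_cat (ucat T)) (Set_cat U) \<sigma> \<and> nsrc \<sigma> = P \<and> ntgt \<sigma> = Q"
  by (auto simp: Sh_def Hom_full_subcat presheaf_cat_def Hom_functor_cat)

lemma Obj_Sh: "P \<in> Obj (Sh U T) \<longleftrightarrow> is_sheaf U T P"
  by (auto simp: Sh_def is_sheaf_def)

lemma category_Sh: "category (Sh U T)"
  unfolding Sh_def presheaf_cat_def by (intro category_full_subcat category_functor_cat)

lemma ncmp_presheaf:
  assumes "nat_trans (op_cat C) (Set_cat U) \<sigma>" "X \<in> Obj C"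
  shows "ncmp \<sigma> X = (fob (nsrc \<sigma>) X, fob (ntgt \<sigma>) X, ap \<sigma> X)" "ap \<sigma> X \<in> fob (nsrc \<sigma>) X \<rightarrow>\<^sub>E fob (ntgt \<sigma>) X"
proof -
  interpret nat_trans "op_cat C" "Set_cat U" \<sigma> by fact
  have "ncmp \<sigma> X \<in> Hom (Set_cat U) (fob (nsrc \<sigma>) X) (fob (ntgt \<sigma>) X)"
    using assms(2) by (intro ncmp_in) auto
  then show "ncmp \<sigma> X = (fob (nsrc \<sigma>) X, fob (ntgt \<sigma>) X, ap \<sigma> X)" "ap \<sigma> X \<in> fob (nsrc \<sigma>) X \<rightarrow>\<^sub>E fob (ntgt \<sigma>) X"
    by (auto elim!: Hom_Set_catE simp: ap_def)
qed

lemma ap_in: "\<sigma> \<in> Hom (Sh U T) P Q \<Longrightarrow> X \<in> Obj (ucat T) \<Longrightarrow> x \<in> fob P X \<Longrightarrow> ap \<sigma> X x \<in> fob Q X"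
  using ncmp_presheaf(2)[of "ucat T" U \<sigma> X] by (auto simp: Hom_Sh)

lemma ap_restr:
  assumes "category (ucat T)" "\<sigma> \<in> Hom (Sh U T) P Q" "f \<in> Arr (ucat T)" "Cod (ucat T) f = X" "x \<in> fob P X"
  shows "ap \<sigma> (Dom (ucat T) f) (restr P f x) = restr Q f (ap \<sigma> X x)"
proof -
  let ?C = "ucat T"
  interpret category ?C by fact
  have A: "is_sheaf U T P" "is_sheaf U T Q" "nat_trans (op_cat ?C) (Set_cat U) \<sigma>" and [simp]: "nsrc \<sigma> = P" "ntgt \<sigma> = Q"
    using assms by (auto simp: Hom_Sh)
  interpret nat_trans "op_cat ?C" "Set_cat U" \<sigma> by fact
  have "Comp (Set_cat U) (ncmp \<sigma> (Dom ?C f)) (far P f) = Comp (Set_cat U) (far Q f) (ncmp \<sigma> X)"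
    using naturality_Arr[of f] assms by simp
  then have eq: "compose (fob P X) (ap \<sigma> (Dom ?C f)) (restr P f) = compose (fob P X) (restr Q f) (ap \<sigma> X)"
    using assms A by (auto simp: far_presheaf[OF is_sheaf_functor] ncmp_presheaf Dom_in Cod_in)
  show ?thesis using fun_cong[OF eq, of x] assms(5) by (simp add: compose_def)
qed

lemma Sh_Hom_eqI:
  assumes "\<sigma> \<in> Hom (Sh U T) P Q" "\<tau> \<in> Hom (Sh U T) P Q"
    and "\<And>X x. X \<in> Obj (ucat T) \<Longrightarrow> x \<in> fob P X \<Longrightarrow> ap \<sigma> X x = ap \<tau> X x"
  shows "\<sigma> = \<tau>"
proof (rule nat_trans_eqI)
  show s: "nat_trans (op_cat (ucat T)) (Set_cat U) \<sigma>" and t: "nat_trans (op_cat (ucat T)) (Set_cat U) \<tau>"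
    using assms by (auto simp: Hom_Sh)
  have [simp]: "nsrc \<sigma> = P" "ntgt \<sigma> = Q" "nsrc \<tau> = P" "ntgt \<tau> = Q" using assms by (auto simp: Hom_Sh)
  show "nsrc \<sigma> = nsrc \<tau>" "ntgt \<sigma> = ntgt \<tau>" by auto
  fix X assume "X \<in> Obj (op_cat (ucat T))"
  then have X: "X \<in> Obj (ucat T)" by simp
  have "ap \<sigma> X = ap \<tau> X"
    using PiE_ext[OF ncmp_presheaf(2)[OF s X, simplified] ncmp_presheaf(2)[OF t X, simplified]] assms(3)[OF X] by blast
  then show "ncmp \<sigma> X = ncmp \<tau> X"
    using X ncmp_presheaf(1)[OF s] ncmp_presheaf(1)[OF t] by simp
qed

lemma Sh_Hom_ex:
  assumes "category (ucat T)" and P: "is_sheaf U T P" and Q: "is_sheaf U T Q"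
    and h: "\<And>X x. X \<in> Obj (ucat T) \<Longrightarrow> x \<in> fob P X \<Longrightarrow> h X x \<in> fob Q X"
    and nat: "\<And>f x. f \<in> Arr (ucat T) \<Longrightarrow> x \<in> fob P (Cod (ucat T) f) \<Longrightarrow>
      h (Dom (ucat T) f) (restr P f x) = restr Q f (h (Cod (ucat T) f) x)"
  obtains \<sigma> where "\<sigma> \<in> Hom (Sh U T) P Q" "\<And>X x. X \<in> Obj (ucat T) \<Longrightarrow> x \<in> fob P X \<Longrightarrow> ap \<sigma> X x = h X x"
proof -
  let ?C = "ucat T"
  interpret category ?C by fact
  interpret P: cat_functor "op_cat ?C" "Set_cat U" P by (rule is_sheaf_functor[OF P])
  interpret Q: cat_functor "op_cat ?C" "Set_cat U" Q by (rule is_sheaf_functor[OF Q])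
  define \<sigma> where "\<sigma> = \<lparr>nsrc = P, ntgt = Q, ncmp = (\<lambda>X\<in>Obj ?C. (fob P X, fob Q X, \<lambda>x\<in>fob P X. h X x))\<rparr>"
  have "nat_trans (op_cat ?C) (Set_cat U) \<sigma>"
  proof (rule nat_transI)
    fix X assume X: "X \<in> Obj (op_cat ?C)"
    then show "ncmp \<sigma> X \<in> Hom (Set_cat U) (fob (nsrc \<sigma>) X) (fob (ntgt \<sigma>) X)"
      using P.fob_in[of X] Q.fob_in[of X] h by (auto simp: \<sigma>_def Hom_Set_cat)
  next
    fix f assume "f \<in> Arr (op_cat ?C)"
    then have f: "f \<in> Arr ?C" by simp
    note r = far_presheaf(2)[OF is_sheaf_functor[OF P] f]
    have "compose (fob P (Cod ?C f)) (\<lambda>x\<in>fob P (Dom ?C f). h (Dom ?C f) x) (restr P f)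
      = compose (fob P (Cod ?C f)) (restr Q f) (\<lambda>x\<in>fob P (Cod ?C f). h (Cod ?C f) x)"
      using r nat f by (auto simp: compose_def fun_eq_iff PiE_iff)
    then show "Comp (Set_cat U) (ncmp \<sigma> (Cod (op_cat ?C) f)) (far (nsrc \<sigma>) f) =
      Comp (Set_cat U) (far (ntgt \<sigma>) f) (ncmp \<sigma> (Dom (op_cat ?C) f))"
      using f by (simp add: \<sigma>_def far_presheaf[OF is_sheaf_functor[OF P]] far_presheaf[OF is_sheaf_functor[OF Q]] Dom_in Cod_in)
  qed (auto simp: \<sigma>_def is_sheaf_functor P Q)
  then have "\<sigma> \<in> Hom (Sh U T) P Q" using P Q by (simp add: Hom_Sh \<sigma>_def)
  moreover have "ap \<sigma> X x = h X x" if "X \<in> Obj ?C" "x \<in> fob P X" for X x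
    using that by (simp add: ap_def \<sigma>_def)
  ultimately show ?thesis using that by blast
qed

lemma ap_Comp:
  assumes "\<sigma> \<in> Hom (Sh U T) P Q" "\<tau> \<in> Hom (Sh U T) Q R" "X \<in> Obj (ucat T)" "x \<in> fob P X"
  shows "ap (Comp (Sh U T) \<tau> \<sigma>) X x = ap \<tau> X (ap \<sigma> X x)"
proof -
  have [simp]: "nsrc \<sigma> = P" "ntgt \<sigma> = Q" "nsrc \<tau> = Q" "ntgt \<tau> = R"
    and n: "nat_trans (op_cat (ucat T)) (Set_cat U) \<sigma>" "nat_trans (op_cat (ucat T)) (Set_cat U) \<tau>"
    using assms by (auto simp: Hom_Sh)
  have "ncmp (Comp (Sh U T) \<tau> \<sigma>) X = Comp (Set_cat U) (ncmp \<tau> X) (ncmp \<sigma> X)"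
    using assms(3) by (simp add: Sh_def presheaf_cat_def)
  also have "\<dots> = (fob P X, fob R X, compose (fob P X) (ap \<tau> X) (ap \<sigma> X))"
    using n assms(3) by (simp add: ncmp_presheaf)
  finally show ?thesis using assms(4) by (simp add: ap_def[of "Comp (Sh U T) \<tau> \<sigma>"] compose_def)
qed

section \<open>Categories of sheaves\<close>

text \<open>Besides the sheaf \<open>P\<close>, it remembers the bijections \<open>e X\<close>, so
  that elements of \<open>fob P X\<close> can always be named by sections in the convenient type.
  All constructions below speak of \<open>S\<close> and \<rho> and reach \<open>P\<close> only
  through this relation.\<close>

definition encodes :: "'u set \<Rightarrow> ('o, 'a) site \<Rightarrow> ('o \<Rightarrow> 'b set) \<Rightarrow> ('a \<Rightarrow> 'b \<Rightarrow> 'b)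
    \<Rightarrow> ('o, 'a, 'u) presheaf \<Rightarrow> ('o \<Rightarrow> 'b \<Rightarrow> 'u) \<Rightarrow> bool" where
  "encodes U T S \<rho> P e \<longleftrightarrow> presheaf_data (ucat T) S \<rho> \<and> is_sheaf U T P \<and>
    (\<forall>X \<in> Obj (ucat T). bij_betw (e X) (S X) (fob P X)) \<and>
    (\<forall>f \<in> Arr (ucat T). \<forall>x \<in> S (Cod (ucat T) f).
      restr P f (e (Cod (ucat T) f) x) = e (Dom (ucat T) f) (\<rho> f x))"

lemma encodesD:
  assumes "encodes U T S \<rho> P e"
  shows "is_sheaf U T P" "X \<in> Obj (ucat T) \<Longrightarrow> x \<in> S X \<Longrightarrow> e X x \<in> fob P X"
    "X \<in> Obj (ucat T) \<Longrightarrow> y \<in> fob P X \<Longrightarrow> \<exists>x\<in>S X. y = e X x"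
    "X \<in> Obj (ucat T) \<Longrightarrow> x \<in> S X \<Longrightarrow> x' \<in> S X \<Longrightarrow> e X x = e X x' \<Longrightarrow> x = x'"
    "f \<in> Arr (ucat T) \<Longrightarrow> x \<in> S (Cod (ucat T) f) \<Longrightarrow>
      restr P f (e (Cod (ucat T) f) x) = e (Dom (ucat T) f) (\<rho> f x)"
    "f \<in> Arr (ucat T) \<Longrightarrow> x \<in> S (Cod (ucat T) f) \<Longrightarrow> \<rho> f x \<in> S (Dom (ucat T) f)"
  using assms unfolding encodes_def presheaf_data_def bij_betw_def inj_on_def by blast+

lemma encodes_arrow_into:
  assumes "category (ucat T)" and enc: "encodes U T S \<rho> P e" and Q: "is_sheaf U T Q"
    and h: "\<And>X y. X \<in> Obj (ucat T) \<Longrightarrow> y \<in> fob Q X \<Longrightarrow> h X y \<in> S X"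
    and nat: "\<And>f y. f \<in> Arr (ucat T) \<Longrightarrow> y \<in> fob Q (Cod (ucat T) f) \<Longrightarrow>
      h (Dom (ucat T) f) (restr Q f y) = \<rho> f (h (Cod (ucat T) f) y)"
  obtains \<sigma> where "\<sigma> \<in> Hom (Sh U T) Q P"
    "\<And>X y. X \<in> Obj (ucat T) \<Longrightarrow> y \<in> fob Q X \<Longrightarrow> ap \<sigma> X y = e X (h X y)"
proof -
  interpret category "ucat T" by fact
  note e = encodesD[OF enc]
  show ?thesis
  proof (rule Sh_Hom_ex[OF assms(1) Q e(1), of "\<lambda>X y. e X (h X y)"])
    fix f y assume "f \<in> Arr (ucat T)" "y \<in> fob Q (Cod (ucat T) f)"
    then show "e (Dom (ucat T) f) (h (Dom (ucat T) f) (restr Q f y)) =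
        restr P f (e (Cod (ucat T) f) (h (Cod (ucat T) f) y))"
      using e(5) h nat Cod_in by simp
  qed (use e(2) h that in auto)
qed

lemma encodes_arrow_from:
  assumes "category (ucat T)" and enc: "encodes U T S \<rho> P e" and Q: "is_sheaf U T Q"
    and h: "\<And>X x. X \<in> Obj (ucat T) \<Longrightarrow> x \<in> S X \<Longrightarrow> h X x \<in> fob Q X"
    and nat: "\<And>f x. f \<in> Arr (ucat T) \<Longrightarrow> x \<in> S (Cod (ucat T) f) \<Longrightarrow>
      h (Dom (ucat T) f) (\<rho> f x) = restr Q f (h (Cod (ucat T) f) x)"
  obtains \<sigma> where "\<sigma> \<in> Hom (Sh U T) P Q"
    "\<And>X x. X \<in> Obj (ucat T) \<Longrightarrow> x \<in> S X \<Longrightarrow> ap \<sigma> X (e X x) = h X x"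
proof -
  interpret category "ucat T" by fact
  note e = encodesD[OF enc]
  \<comment> \<open>The family \<open>h\<close> read on the codes, by way of the inverse of the
    bijection \<open>e X\<close>.\<close>
  define k where "k X y = h X (inv_into (S X) (e X) y)" for X y
  have k: "k X (e X x) = h X x" if "X \<in> Obj (ucat T)" "x \<in> S X" for X x
    using that e(4) by (simp add: k_def inv_into_f_f inj_on_def)
  show ?thesis
  proof (rule Sh_Hom_ex[OF assms(1) e(1) Q, of k])
    fix X y assume "X \<in> Obj (ucat T)" "y \<in> fob P X"
    then show "k X y \<in> fob Q X" using e(3) k h by metis
  next
    fix f y assume A: "f \<in> Arr (ucat T)" "y \<in> fob P (Cod (ucat T) f)"
    then obtain x where x: "x \<in> S (Cod (ucat T) f)" "y = e (Cod (ucat T) f) x" using e(3) Cod_in by metis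
    then show "k (Dom (ucat T) f) (restr P f y) = restr Q f (k (Cod (ucat T) f) y)"
      using e(5,6) k nat Cod_in Dom_in A by simp
  next
    fix \<sigma> assume "\<sigma> \<in> Hom (Sh U T) P Q" "\<And>X x. X \<in> Obj (ucat T) \<Longrightarrow> x \<in> fob P X \<Longrightarrow> ap \<sigma> X x = k X x"
    then show thesis using that[of \<sigma>] k e(2) by simp
  qed
qed

text \<open>Objects and arrows of the site may form a proper class relative to \<open>U\<close>.
  Fixing one small set \<open>G\<close> of generators gives every later smallness argument something
  small to refer to.\<close>

locale generated_site = universe_set U + site U T for U :: "'u set" and T :: "('o, 'a) site" +
  fixes G :: "'o set"
  assumes small_G: "small U G" and generators_G: "topological_generators T G"
begin

abbreviation "C \<equiv> ucat T"

lemmas [simp] = Dom_in Cod_in Ident_Arr Comp_Arr Arr_Comp_Ident Arr_Ident_Comp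

lemma category_C: "category C" by unfold_locales

lemma cov_Arr: "X \<in> Obj C \<Longrightarrow> R \<in> cov T X \<Longrightarrow> f \<in> R \<Longrightarrow> f \<in> Arr C \<and> Cod C f = X"
  using cov_sieve by (auto simp: sieve_def)

lemma sieve_pullback: "sieve C (Dom C f) (pullback_sieve C f R)" if "sieve C X R" "f \<in> Arr C" "Cod C f = X"
  using that unfolding sieve_def pullback_sieve_def by (auto simp: Arr_assoc)

lemma pullback_pullback: "pullback_sieve C g (pullback_sieve C f R) = pullback_sieve C (Comp C f g) R"
  if "f \<in> Arr C" "g \<in> Arr C" "Cod C g = Dom C f"
  using that unfolding pullback_sieve_def by (auto simp: Arr_assoc)

lemma pullback_maximal: "pullback_sieve C f R = {g \<in> Arr C. Cod C g = Dom C f}" if "sieve C X R" "f \<in> R"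
  using that unfolding sieve_def pullback_sieve_def by auto

lemma pullback_maximal_iff: "Ident C (Dom C f) \<in> pullback_sieve C f R \<longleftrightarrow> f \<in> R" if "f \<in> Arr C"
  using that by (auto simp: pullback_sieve_def)

lemma cov_pullback: "pullback_sieve C f R \<in> cov T (Dom C f)" if "R \<in> cov T X" "f \<in> Arr C" "Cod C f = X"
  using cov_stable[of f "Dom C f" X R] that by (auto simp: Hom_def)

text \<open>Pulled back along a member of \<open>R\<close>, the larger sieve becomes maximal, so
  transitivity applies.\<close>

lemma cov_superset: "R' \<in> cov T X" if X: "X \<in> Obj C" and R: "R \<in> cov T X" "R \<subseteq> R'" "sieve C X R'"
proof (rule cov_transitive[OF X R(1) R(3)])
  fix f assume "f \<in> R"
  then show "pullback_sieve C f R' \<in> cov T (Dom C f)"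
    using R X cov_Arr[of X R f] cov_maximal[of "Dom C f"] pullback_maximal[OF R(3), of f] by auto
qed

text \<open>Some family of arrows from \<open>G\<close> covers \<open>X\<close>; such a sieve
  contains the sieve which that family generates.\<close>

lemma cov_if_generators: "R \<in> cov T X" if X: "X \<in> Obj C" and R: "sieve C X R"
  "\<And>f. f \<in> Arr C \<Longrightarrow> Cod C f = X \<Longrightarrow> Dom C f \<in> G \<Longrightarrow> f \<in> R"
proof -
  obtain \<Phi> where \<Phi>: "covering_family T X \<Phi>" "\<forall>f\<in>\<Phi>. Dom C f \<in> G"
    using X generators_G by (auto simp: topological_generators_def)
  have "h \<in> R" if h: "h \<in> generated_sieve C \<Phi>" for h
  proof -
    obtain f g where f: "h = Comp C f g" "f \<in> \<Phi>" "g \<in> Arr C" "Cod C g = Dom C f"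
      using h by (auto simp: generated_sieve_def)
    then have "f \<in> R" using \<Phi> R(2)[of f] by (auto simp: covering_family_def)
    then show "h \<in> R" using f R(1) by (simp add: sieve_def)
  qed
  then have "generated_sieve C \<Phi> \<subseteq> R" by blast
  then show ?thesis using \<Phi> R X cov_superset by (auto simp: covering_family_def)
qed

lemma G_Obj: "X \<in> G \<Longrightarrow> X \<in> Obj C"
  using generators_G by (auto simp: topological_generators_def)

lemma small_fob: "is_sheaf U T P \<Longrightarrow> X \<in> Obj C \<Longrightarrow> small U (fob P X)"
  using cat_functor.fob_in[OF is_sheaf_functor, of U T P X] by simp

context
  fixes P assumes P: "is_sheaf U T P"
begin

lemma restr_in [simp]: "f \<in> Arr C \<Longrightarrow> Cod C f = X \<Longrightarrow> x \<in> fob P X \<Longrightarrow> restr P f x \<in> fob P (Dom C f)"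
  and restr_Ident [simp]: "X \<in> Obj C \<Longrightarrow> x \<in> fob P X \<Longrightarrow> restr P (Ident C X) x = x"
  and restr_Comp: "f \<in> Arr C \<Longrightarrow> g \<in> Arr C \<Longrightarrow> Cod C g = Dom C f \<Longrightarrow> x \<in> fob P (Cod C f) \<Longrightarrow>
    restr P (Comp C f g) x = restr P g (restr P f x)"
  using P by (auto simp: is_sheaf_iff sheaf_data_def presheaf_data_def)

lemma sheaf_glue:
  assumes "X \<in> Obj C" "R \<in> cov T X" "matching C (fob P) (restr P) R x"
  shows "\<exists>s\<in>fob P X. \<forall>f\<in>R. restr P f s = x f"
  using P assms unfolding is_sheaf_iff sheaf_data_def by metis

text \<open>Both sections glue the matching family of restrictions of \<open>x\<close>, and gluings
  are unique.\<close>

lemma sheaf_separated: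
  assumes X: "X \<in> Obj C" and R: "R \<in> cov T X" and x: "x \<in> fob P X" "y \<in> fob P X"
    and eq: "\<And>f. f \<in> R \<Longrightarrow> restr P f x = restr P f y"
  shows "x = y"
proof -
  have "matching C (fob P) (restr P) R (\<lambda>f. restr P f x)"
    unfolding matching_def using cov_Arr[OF X R] x restr_Comp by simp
  then show ?thesis
    using P X R x eq unfolding is_sheaf_iff sheaf_data_def by metis
qed

text \<open>The arrows along which \<open>x\<close> and \<open>y\<close> agree form a sieve. It
  contains all arrows from \<open>G\<close>, hence covers.\<close>

lemma sheaf_separated_generators:
  assumes X: "X \<in> Obj C" and x: "x \<in> fob P X" "y \<in> fob P X"
    and eq: "\<And>f. f \<in> Arr C \<Longrightarrow> Cod C f = X \<Longrightarrow> Dom C f \<in> G \<Longrightarrow> restr P f x = restr P f y"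
  shows "x = y"
proof (rule sheaf_separated[OF X _ x])
  show "{f \<in> Arr C. Cod C f = X \<and> restr P f x = restr P f y} \<in> cov T X"
    by (rule cov_if_generators[OF X]) (use X x restr_Comp eq in \<open>auto simp: sieve_def\<close>)
qed auto

end

lemma Sh_Hom_sheaf: "\<sigma> \<in> Hom (Sh U T) P Q \<Longrightarrow> is_sheaf U T P" "\<sigma> \<in> Hom (Sh U T) P Q \<Longrightarrow> is_sheaf U T Q"
  by (auto simp: Hom_Sh)

lemma Sh_Hom_eq_generators:
  assumes s: "\<sigma> \<in> Hom (Sh U T) P Q" and t: "\<tau> \<in> Hom (Sh U T) P Q"
    and eq: "\<And>X x. X \<in> G \<Longrightarrow> x \<in> fob P X \<Longrightarrow> ap \<sigma> X x = ap \<tau> X x"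
  shows "\<sigma> = \<tau>"
proof (rule Sh_Hom_eqI[OF s t])
  fix X x assume X: "X \<in> Obj C" and x: "x \<in> fob P X"
  show "ap \<sigma> X x = ap \<tau> X x"
  proof (rule sheaf_separated_generators[OF Sh_Hom_sheaf(2)[OF s] X])
    fix f assume f: "f \<in> Arr C" "Cod C f = X" "Dom C f \<in> G"
    then show "restr Q f (ap \<sigma> X x) = restr Q f (ap \<tau> X x)"
      using ap_restr[OF category_C s, of f X x] ap_restr[OF category_C t, of f X x] x eq[OF f(3)]
        restr_in[OF Sh_Hom_sheaf(1)[OF s] f(1,2) x] by simp
  qed (rule ap_in[OF s X x] ap_in[OF t X x])+
qed

text \<open>Separatedness makes a morphism depend only on its components at \<open>G\<close>. Their
  joint graph is a subset of a small set, whereas the family of all components need not be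
  small.\<close>

theorem Sh_locally_small: "small U (Hom (Sh U T) P Q)" if P: "is_sheaf U T P" and Q: "is_sheaf U T Q"
proof (rule small_inj_into)
  let ?V = "\<Union>X\<in>G. fob P X" and ?W = "\<Union>X\<in>G. fob Q X"
  show "inj_on (\<lambda>\<sigma>. {(X, x, ap \<sigma> X x) | X x. X \<in> G \<and> x \<in> fob P X}) (Hom (Sh U T) P Q)"
  proof (rule inj_onI)
    fix \<sigma> \<tau> assume A: "\<sigma> \<in> Hom (Sh U T) P Q" "\<tau> \<in> Hom (Sh U T) P Q"
      and eq: "{(X, x, ap \<sigma> X x) | X x. X \<in> G \<and> x \<in> fob P X} = {(X, x, ap \<tau> X x) | X x. X \<in> G \<and> x \<in> fob P X}"
    show "\<sigma> = \<tau>"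
    proof (rule Sh_Hom_eq_generators[OF A])
      fix X x assume "X \<in> G" "x \<in> fob P X"
      then have "(X, x, ap \<sigma> X x) \<in> {(X, x, ap \<tau> X x) | X x. X \<in> G \<and> x \<in> fob P X}" using eq by blast
      then show "ap \<sigma> X x = ap \<tau> X x" by simp
    qed
  qed
  show "(\<lambda>\<sigma>. {(X, x, ap \<sigma> X x) | X x. X \<in> G \<and> x \<in> fob P X}) ` Hom (Sh U T) P Q \<subseteq> Pow (G \<times> ?V \<times> ?W)"
    using ap_in G_Obj by fastforce
  show "small U (Pow (G \<times> ?V \<times> ?W))"
    by (intro small_Pow small_Times small_UN small_G small_fob G_Obj P Q)
qed

lemma encodes_ex:
  assumes "sheaf_data T S \<rho>" "\<And>X. X \<in> Obj C \<Longrightarrow> small U (S X)"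
  shows "\<exists>P e. encodes U T S \<rho> P e"
proof -
  obtain P e where "is_sheaf U T P" "\<And>X. X \<in> Obj (ucat T) \<Longrightarrow> bij_betw (e X) (S X) (fob P X)"
    "\<And>f x. f \<in> Arr (ucat T) \<Longrightarrow> x \<in> S (Cod (ucat T) f) \<Longrightarrow>
      restr P f (e (Cod (ucat T) f) x) = e (Dom (ucat T) f) (\<rho> f x)"
    using sheaf_of_data[OF grothendieck_topology_axioms assms] by blast
  then have "encodes U T S \<rho> P e" using assms(1) by (simp add: sheaf_data_def encodes_def)
  then show ?thesis by blast
qed

subsection \<open>Limits of sheaves\<close>

text \<open>Limits are computed objectwise, on compatible tuples of sections. Coordinates are glued
  one by one.\<close>

theorem Sh_has_finite_limits: "has_finite_limits (Sh U T)"
  unfolding has_finite_limits_def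
proof (intro allI impI)
  fix J :: "(nat, nat) cat" and D assume D: "finite_diagram J (Sh U T) D"
  then interpret D: cat_functor J "Sh U T" D by (simp add: finite_diagram_def)
  have sh: "is_sheaf U T (fob D i)" if "i \<in> Obj J" for i
    using D.fob_in[OF that] by (simp add: Obj_Sh)
  have farD: "far D h \<in> Hom (Sh U T) (fob D (Dom J h)) (fob D (Cod J h))" if "h \<in> Arr J" for h
    using that by (intro D.far_in) (simp add: Hom_def)
  define S where "S X = {x \<in> \<Pi>\<^sub>E i\<in>Obj J. fob (fob D i) X.
      \<forall>h\<in>Arr J. ap (far D h) X (x (Dom J h)) = x (Cod J h)}" for X
  define \<rho> where "\<rho> f x = (\<lambda>i\<in>Obj J. restr (fob D i) f (x i))" for f and x :: "nat \<Rightarrow> 'u"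
  have S_in: "x i \<in> fob (fob D i) X" if "x \<in> S X" "i \<in> Obj J" for x X i
    using that by (auto simp: S_def)
  have S_ap: "ap (far D h) X (x (Dom J h)) = x (Cod J h)" if "x \<in> S X" "h \<in> Arr J" for x X h
    using that by (auto simp: S_def)
  have S_I: "x \<in> S X" if "x \<in> extensional (Obj J)" "\<And>i. i \<in> Obj J \<Longrightarrow> x i \<in> fob (fob D i) X"
      "\<And>h. h \<in> Arr J \<Longrightarrow> ap (far D h) X (x (Dom J h)) = x (Cod J h)" for x X
    using that by (auto simp: S_def PiE_def)
  have S_ext: "x = y" if "x \<in> S X" "y \<in> S X" "\<And>i. i \<in> Obj J \<Longrightarrow> x i = y i" for x y X
    using that by (auto simp: S_def intro: PiE_ext)
  have \<rho>_in: "\<rho> f x \<in> S (Dom C f)" if f: "f \<in> Arr C" and x: "x \<in> S (Cod C f)" for f x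
  proof (rule S_I)
    fix h assume h: "h \<in> Arr J"
    then show "ap (far D h) (Dom C f) (\<rho> f x (Dom J h)) = \<rho> f x (Cod J h)"
      using ap_restr[OF category_C farD[OF h] f refl S_in[OF x]] S_ap[OF x h]
      by (simp add: \<rho>_def D.source.Dom_in D.source.Cod_in)
  qed (use f x S_in sh in \<open>auto simp: \<rho>_def\<close>)
  have data: "sheaf_data T S \<rho>"
    unfolding sheaf_data_def presheaf_data_def
  proof (intro conjI ballI allI impI)
    fix X x assume "X \<in> Obj C" "x \<in> S X"
    then show "\<rho> (Ident C X) x = x"
      using S_in[of x X] \<rho>_in[of "Ident C X" x] sh by (intro S_ext[of _ X]) (auto simp: \<rho>_def)
  next
    fix f g x assume A: "f \<in> Arr C" "g \<in> Arr C" "Cod C g = Dom C f" "x \<in> S (Cod C f)"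
    then show "\<rho> (Comp C f g) x = \<rho> g (\<rho> f x)"
      using S_in[of x "Cod C f"] sh by (auto simp: \<rho>_def fun_eq_iff restr_Comp)
  next
    fix X R x assume X: "X \<in> Obj C" and R: "R \<in> cov T X" and x: "matching C S \<rho> R x"
    note RA = cov_Arr[OF X R]
    have xS: "x f \<in> S (Dom C f)" if "f \<in> R" for f using x that by (simp add: matching_def)
    have "\<exists>s\<in>fob (fob D i) X. \<forall>f\<in>R. restr (fob D i) f s = x f i" if i: "i \<in> Obj J" for i
    proof (rule sheaf_glue[OF sh[OF i] X R])
      show "matching C (fob (fob D i)) (restr (fob D i)) R (\<lambda>f. x f i)"
        using x i xS S_in unfolding matching_def by (simp add: \<rho>_def)
    qed
    then obtain s0 where s0: "\<And>i. i \<in> Obj J \<Longrightarrow> s0 i \<in> fob (fob D i) X"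
      "\<And>i f. i \<in> Obj J \<Longrightarrow> f \<in> R \<Longrightarrow> restr (fob D i) f (s0 i) = x f i" by metis
    define s where "s = (\<lambda>i\<in>Obj J. s0 i)"
    have s: "s i \<in> fob (fob D i) X" "\<And>f. f \<in> R \<Longrightarrow> restr (fob D i) f (s i) = x f i" if "i \<in> Obj J" for i
      using s0 that by (auto simp: s_def)
    have sS: "s \<in> S X"
    proof (rule S_I)
      fix h assume h: "h \<in> Arr J"
      note hD = farD[OF h]
      have i: "Dom J h \<in> Obj J" "Cod J h \<in> Obj J" using h by (auto simp: D.source.Dom_in D.source.Cod_in)
      show "ap (far D h) X (s (Dom J h)) = s (Cod J h)"
      \<comment> \<open>The coordinates were glued independently of each other; that they are
        compatible again is a local question, and on the cover they restrict to the compatible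
        tuples \<open>x f\<close>.\<close>
      proof (rule sheaf_separated[OF sh[OF i(2)] X R])
        fix f assume f: "f \<in> R"
        then show "restr (fob D (Cod J h)) f (ap (far D h) X (s (Dom J h))) = restr (fob D (Cod J h)) f (s (Cod J h))"
          using ap_restr[OF category_C hD _ _ s(1)[OF i(1)], of f] RA[OF f] i s(2) S_ap[OF xS[OF f] h] by simp
      qed (use s i ap_in[OF hD X] in auto)
    qed (use s in \<open>auto simp: s_def\<close>)
    show "\<exists>!s. s \<in> S X \<and> (\<forall>f\<in>R. \<rho> f s = x f)"
    proof (rule ex1I[of _ s])
      have "\<rho> f s = x f" if f: "f \<in> R" for f
      proof (rule S_ext[OF _ xS[OF f]])
        show "\<rho> f s \<in> S (Dom C f)" using \<rho>_in[of f s] RA[OF f] sS by simp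
      qed (use s f in \<open>auto simp: \<rho>_def\<close>)
      then show "s \<in> S X \<and> (\<forall>f\<in>R. \<rho> f s = x f)" using sS by blast
    next
      fix t assume t: "t \<in> S X \<and> (\<forall>f\<in>R. \<rho> f t = x f)"
      show "t = s"
      proof (rule S_ext)
        fix i assume i: "i \<in> Obj J"
        show "t i = s i"
        proof (rule sheaf_separated[OF sh[OF i] X R])
          fix f assume f: "f \<in> R"
          then have "\<rho> f t i = x f i" using t by simp
          then show "restr (fob D i) f (t i) = restr (fob D i) f (s i)"
            using s f i by (simp add: \<rho>_def)
        qed (use t S_in sS i in auto)
      qed (use t sS in auto)
    qed
  qed (use \<rho>_in in auto)
  have "small U (S X)" if "X \<in> Obj C" for X
  proof (rule small_functions)
    show "small U (Obj J)" by (rule small_nat)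
    show "small U (\<Union>i\<in>Obj J. fob (fob D i) X)" by (intro small_UN small_nat small_fob sh that)
  qed (auto simp: S_def)
  then obtain L e where enc: "encodes U T S \<rho> L e" using encodes_ex[OF data] by blast
  note e = encodesD[OF enc]
  have "\<exists>\<sigma>. \<sigma> \<in> Hom (Sh U T) L (fob D i) \<and> (\<forall>X\<in>Obj C. \<forall>x\<in>S X. ap \<sigma> X (e X x) = x i)" if i: "i \<in> Obj J" for i
  proof (rule encodes_arrow_from[OF category_C enc sh[OF i], of "\<lambda>X x. x i"])
    fix f x show "\<rho> f x i = restr (fob D i) f (x i)" using i by (simp add: \<rho>_def)
  qed (use S_in i in auto)
  then obtain p where p: "\<And>i. i \<in> Obj J \<Longrightarrow> p i \<in> Hom (Sh U T) L (fob D i)"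
    "\<And>i X x. i \<in> Obj J \<Longrightarrow> X \<in> Obj C \<Longrightarrow> x \<in> S X \<Longrightarrow> ap (p i) X (e X x) = x i" by metis
  have "is_limit J (Sh U T) D L p"
    unfolding is_limit_def
  proof (intro conjI allI impI)
    show "is_cone J (Sh U T) D L p"
      unfolding is_cone_def
    proof (intro conjI ballI)
      fix h assume h: "h \<in> Arr J"
      then have i: "Dom J h \<in> Obj J" "Cod J h \<in> Obj J" by (auto simp: D.source.Dom_in D.source.Cod_in)
      show "Comp (Sh U T) (far D h) (p (Dom J h)) = p (Cod J h)"
      proof (rule Sh_Hom_eqI[OF D.target.Comp_in[OF p(1)[OF i(1)] farD[OF h]] p(1)[OF i(2)]])
        fix X y assume X: "X \<in> Obj C" "y \<in> fob L X"
        then obtain x where "x \<in> S X" "y = e X x" using e(3) by blast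
        then show "ap (Comp (Sh U T) (far D h) (p (Dom J h))) X y = ap (p (Cod J h)) X y"
          using X ap_Comp[OF p(1)[OF i(1)] farD[OF h] X] p(2) i S_ap[of x X h] h by simp
      qed
    qed (use p e(1) in \<open>auto simp: Obj_Sh\<close>)
  next
    fix M q assume q: "is_cone J (Sh U T) D M q"
    then have M: "is_sheaf U T M" by (simp add: is_cone_def Obj_Sh)
    have qH: "q i \<in> Hom (Sh U T) M (fob D i)" if "i \<in> Obj J" for i
      using q that by (simp add: is_cone_def)
    \<comment> \<open>The mediating morphism collects the values of all legs of the cone in one
      tuple.\<close>
    define h where "h X y = (\<lambda>i\<in>Obj J. ap (q i) X y)" for X y
    have hS: "h X y \<in> S X" if X: "X \<in> Obj C" and y: "y \<in> fob M X" for X y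
    proof (rule S_I)
      fix k assume k: "k \<in> Arr J"
      then have i: "Dom J k \<in> Obj J" "Cod J k \<in> Obj J" by (auto simp: D.source.Dom_in D.source.Cod_in)
      have "ap (q (Cod J k)) X y = ap (Comp (Sh U T) (far D k) (q (Dom J k))) X y"
        using q k by (simp add: is_cone_def)
      also have "\<dots> = ap (far D k) X (ap (q (Dom J k)) X y)"
        by (rule ap_Comp[OF qH[OF i(1)] farD[OF k] X y])
      finally show "ap (far D k) X (h X y (Dom J k)) = h X y (Cod J k)" using i by (simp add: h_def)
    qed (use ap_in[OF qH X y] in \<open>auto simp: h_def\<close>)
    obtain m where m: "m \<in> Hom (Sh U T) M L" "\<And>X y. X \<in> Obj C \<Longrightarrow> y \<in> fob M X \<Longrightarrow> ap m X y = e X (h X y)"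
    proof (rule encodes_arrow_into[OF category_C enc M, of h])
      fix f y assume "f \<in> Arr C" "y \<in> fob M (Cod C f)"
      then show "h (Dom C f) (restr M f y) = \<rho> f (h (Cod C f) y)"
        using ap_restr[OF category_C qH, of _ f "Cod C f" y] by (auto simp: h_def \<rho>_def)
    qed (use hS in auto)
    show "\<exists>!m. m \<in> Hom (Sh U T) M L \<and> (\<forall>i\<in>Obj J. Comp (Sh U T) (p i) m = q i)"
    proof (rule ex1I[of _ m])
      have "Comp (Sh U T) (p i) m = q i" if i: "i \<in> Obj J" for i
      proof (rule Sh_Hom_eqI[OF D.target.Comp_in[OF m(1) p(1)[OF i]] qH[OF i]])
        fix X y assume "X \<in> Obj C" "y \<in> fob M X"
        then show "ap (Comp (Sh U T) (p i) m) X y = ap (q i) X y"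
          using ap_Comp[OF m(1) p(1)[OF i]] m(2) p(2)[OF i] hS i by (simp add: h_def)
      qed
      then show "m \<in> Hom (Sh U T) M L \<and> (\<forall>i\<in>Obj J. Comp (Sh U T) (p i) m = q i)" using m by blast
    next
      fix n assume n: "n \<in> Hom (Sh U T) M L \<and> (\<forall>i\<in>Obj J. Comp (Sh U T) (p i) n = q i)"
      then have nH: "n \<in> Hom (Sh U T) M L" by blast
      show "n = m"
      proof (rule Sh_Hom_eqI[OF nH m(1)])
        fix X y assume X: "X \<in> Obj C" "y \<in> fob M X"
        then obtain x where x: "x \<in> S X" "ap n X y = e X x" using e(3)[OF X(1) ap_in[OF nH X]] by blast
        have "x i = h X y i" if i: "i \<in> Obj J" for i
          using n p(2)[OF i X(1) x(1)] ap_Comp[OF nH p(1)[OF i] X] x i by (auto simp: h_def)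
        then have "x = h X y" by (intro S_ext[OF x(1) hS[OF X]])
        then show "ap n X y = ap m X y" using x m X by simp
      qed
    qed
  qed
  then show "\<exists>L p. is_limit J (Sh U T) D L p" by blast
qed

end

context generated_site begin

subsection \<open>Closed sieves and epimorphic families of sheaves\<close>

definition sieve_closure :: "'o \<Rightarrow> 'a set \<Rightarrow> 'a set" where
  "sieve_closure X R = {f \<in> Arr C. Cod C f = X \<and> pullback_sieve C f R \<in> cov T (Dom C f)}"

text \<open>The sections over \<open>X\<close> of the subobject classifier of the category of
  sheaves.\<close>

definition closed_sieves :: "'o \<Rightarrow> 'a set set" where
  "closed_sieves X = {R. sieve C X R \<and> sieve_closure X R \<subseteq> R}"

text \<open>Both sides are conditions on \<open>Comp C f g\<close>. This makes closed sieves a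
  presheaf, and the characteristic map of an image natural.\<close>

lemma pullback_sieve_closure: "pullback_sieve C f (sieve_closure X R) = sieve_closure (Dom C f) (pullback_sieve C f R)"
  if "f \<in> Arr C" "Cod C f = X"
proof (intro set_eqI)
  fix g
  show "g \<in> pullback_sieve C f (sieve_closure X R) \<longleftrightarrow> g \<in> sieve_closure (Dom C f) (pullback_sieve C f R)"
    using that pullback_pullback[of f g R]
    by (cases "g \<in> Arr C \<and> Cod C g = Dom C f")
      (auto simp: sieve_closure_def pullback_sieve_def[of C f "{f \<in> _. _ f}"])
qed

lemma sieve_sieve_closure: "sieve C X (sieve_closure X R)" if "sieve C X R"
  using that unfolding sieve_def
proof (intro conjI ballI impI)
  fix f g assume f: "f \<in> sieve_closure X R" and g: "g \<in> Arr C" "Cod C g = Dom C f"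
  then have "f \<in> Arr C" "Cod C f = X" "pullback_sieve C f R \<in> cov T (Dom C f)"
    by (auto simp: sieve_closure_def)
  then show "Comp C f g \<in> sieve_closure X R"
    using g cov_pullback[of "pullback_sieve C f R" "Dom C f" g] pullback_pullback[of f g R]
    by (simp add: sieve_closure_def)
qed (auto simp: sieve_closure_def)

lemma subset_sieve_closure: "R \<subseteq> sieve_closure X R" if R: "sieve C X R"
proof
  fix f assume f: "f \<in> R"
  then show "f \<in> sieve_closure X R"
    using R cov_maximal[of "Dom C f"] pullback_maximal[OF R f] by (auto simp: sieve_closure_def sieve_def)
qed

text \<open>Idempotence of the closure is the transitivity axiom of the topology.\<close>

lemma sieve_closure_closed: "sieve_closure X R \<in> closed_sieves X" if R: "sieve C X R"
proof -
  have "f \<in> sieve_closure X R" if "f \<in> sieve_closure X (sieve_closure X R)" for f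
  proof -
    have f: "f \<in> Arr C" "Cod C f = X" and cov: "pullback_sieve C f (sieve_closure X R) \<in> cov T (Dom C f)"
      using that by (auto simp: sieve_closure_def)
    have "pullback_sieve C f R \<in> cov T (Dom C f)"
    proof (rule cov_transitive[OF _ cov sieve_pullback[OF R f]])
      fix g assume "g \<in> pullback_sieve C f (sieve_closure X R)"
      then show "pullback_sieve C g (pullback_sieve C f R) \<in> cov T (Dom C g)"
        using f by (auto simp: pullback_sieve_def[of C f] sieve_closure_def pullback_pullback[symmetric])
    qed (use f in auto)
    then show ?thesis using f by (simp add: sieve_closure_def)
  qed
  then show ?thesis using sieve_sieve_closure[OF R] by (auto simp: closed_sieves_def)
qed

lemma closed_sieves_pullback: "pullback_sieve C f R \<in> closed_sieves (Dom C f)"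
  if R: "R \<in> closed_sieves X" and f: "f \<in> Arr C" "Cod C f = X"
proof -
  have s: "sieve C X R" and eq: "sieve_closure X R = R"
    using R subset_sieve_closure by (auto simp: closed_sieves_def)
  show ?thesis using pullback_sieve_closure[OF f, of R] sieve_pullback[OF s f] by (simp add: eq closed_sieves_def)
qed

text \<open>For \<open>g\<close> in \<open>K\<close>, the pullback of \<open>L\<close> along
  \<open>g\<close> contains that of \<open>R\<close>, hence covers, and \<open>L\<close> is closed.
  Exchanging \<open>K\<close> and \<open>L\<close> gives the other inclusion.\<close>

lemma closed_sieves_eqI:
  assumes X: "X \<in> Obj C" and R: "R \<in> cov T X" and K: "K \<in> closed_sieves X" "L \<in> closed_sieves X"
    and eq: "\<And>f. f \<in> R \<Longrightarrow> pullback_sieve C f K = pullback_sieve C f L"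
  shows "K \<subseteq> L"
proof
  have sK: "sieve C X K" and sL: "sieve C X L" using K by (auto simp: closed_sieves_def)
  fix g assume g: "g \<in> K"
  then have gA: "g \<in> Arr C" "Cod C g = X" using sK by (auto simp: sieve_def)
  have "pullback_sieve C g L \<in> cov T (Dom C g)"
  proof (rule cov_superset[OF _ cov_pullback[OF R gA] _ sieve_pullback[OF sL gA]])
    show "pullback_sieve C g R \<subseteq> pullback_sieve C g L"
    proof
      fix k assume "k \<in> pullback_sieve C g R"
      then have k: "k \<in> Arr C" "Cod C k = Dom C g" "Comp C g k \<in> R" by (auto simp: pullback_sieve_def)
      have "Comp C g k \<in> K" using k g sK by (simp add: sieve_def)
      then have "Comp C g k \<in> L"
        using eq[OF k(3)] pullback_maximal_iff[of "Comp C g k" K] pullback_maximal_iff[of "Comp C g k" L] k gA by simp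
      then show "k \<in> pullback_sieve C g L" using k by (simp add: pullback_sieve_def)
    qed
  qed (use gA in auto)
  then show "g \<in> L" using K gA by (auto simp: closed_sieves_def sieve_closure_def)
qed

text \<open>A closed sieve is determined by its arrows from \<open>G\<close>: if \<open>L\<close>
  has the same ones as \<open>K\<close>, then for \<open>g\<close> in \<open>K\<close> the pullback
  of \<open>L\<close> along \<open>g\<close> contains every arrow from \<open>G\<close>, so it
  covers and \<open>g\<close> is in \<open>L\<close>. The arrows from \<open>G\<close> to
  \<open>X\<close> form a small set by local smallness.\<close>

lemma small_closed_sieves: "small U (closed_sieves X)" if X: "X \<in> Obj C"
proof (rule small_inj_into)
  show "inj_on (\<lambda>R. {f \<in> R. Dom C f \<in> G}) (closed_sieves X)"
  proof -
    have "K \<subseteq> L" if K: "K \<in> closed_sieves X" "L \<in> closed_sieves X"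
      and eq: "{f \<in> K. Dom C f \<in> G} = {f \<in> L. Dom C f \<in> G}" for K L
    proof
      have sK: "sieve C X K" and sL: "sieve C X L" using K by (auto simp: closed_sieves_def)
      fix g assume g: "g \<in> K"
      then have gA: "g \<in> Arr C" "Cod C g = X" using sK by (auto simp: sieve_def)
      have "pullback_sieve C g L \<in> cov T (Dom C g)"
      proof (rule cov_if_generators[OF _ sieve_pullback[OF sL gA]])
        fix f assume f: "f \<in> Arr C" "Cod C f = Dom C g" "Dom C f \<in> G"
        then have "Comp C g f \<in> {f \<in> K. Dom C f \<in> G}" using g sK gA by (simp add: sieve_def)
        then show "f \<in> pullback_sieve C g L" using f unfolding eq by (simp add: pullback_sieve_def)
      qed (use gA in auto)
      then show "g \<in> L" using K gA by (auto simp: closed_sieves_def sieve_closure_def)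
    qed
    then show ?thesis by (intro inj_onI subset_antisym) auto
  qed
  show "(\<lambda>R. {f \<in> R. Dom C f \<in> G}) ` closed_sieves X \<subseteq> Pow (\<Union>Y\<in>G. Hom C Y X)"
    by (auto simp: closed_sieves_def sieve_def Hom_def)
  show "small U (Pow (\<Union>Y\<in>G. Hom C Y X))"
    by (intro small_Pow small_UN small_G locally_small X G_Obj)
qed

text \<open>A matching family of closed sieves is glued by taking the union of its composites with
  the members of the cover and closing it. Uniqueness is \<open>closed_sieves_eqI\<close>.\<close>

lemma closed_sieves_sheaf: "sheaf_data T closed_sieves (pullback_sieve C)"
  unfolding sheaf_data_def presheaf_data_def
proof (intro conjI ballI allI impI)
  fix f x assume "f \<in> Arr C" "x \<in> closed_sieves (Cod C f)"
  then show "pullback_sieve C f x \<in> closed_sieves (Dom C f)" by (intro closed_sieves_pullback) auto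
next
  fix X x assume "X \<in> Obj C" "x \<in> closed_sieves X"
  then show "pullback_sieve C (Ident C X) x = x" 
    by (auto simp: pullback_sieve_def closed_sieves_def sieve_def)
next
  fix f g x assume "f \<in> Arr C" "g \<in> Arr C" "Cod C g = Dom C f"
  then show "pullback_sieve C (Comp C f g) x = pullback_sieve C g (pullback_sieve C f x)" by (simp add: pullback_pullback)
next
  fix X R x assume X: "X \<in> Obj C" and R: "R \<in> cov T X" and m: "matching C closed_sieves (pullback_sieve C) R x"
  note RA = cov_Arr[OF X R]
  have sR: "sieve C X R" by (rule cov_sieve[OF X R])
  \<comment> \<open>That the identity belongs to \<open>x f\<close> says that \<open>x f\<close> is
    the maximal sieve.\<close>
  define K where "K = {f \<in> R. Ident C (Dom C f) \<in> x f}"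
  have x: "x f \<in> closed_sieves (Dom C f)" "sieve C (Dom C f) (x f)" if "f \<in> R" for f
    using m that by (auto simp: matching_def closed_sieves_def)
  have xC: "x (Comp C f g) = pullback_sieve C g (x f)" if "f \<in> R" "g \<in> Arr C" "Cod C g = Dom C f" for f g
    using m that by (simp add: matching_def)
  \<comment> \<open>Matching turns \<open>x (Comp C f g)\<close> into the pullback of
    \<open>x f\<close> along \<open>g\<close>, and this contains the identity exactly when
    \<open>x f\<close> contains \<open>g\<close>.\<close>
  have K_iff: "Comp C f g \<in> K \<longleftrightarrow> g \<in> x f" if "f \<in> R" "g \<in> Arr C" "Cod C g = Dom C f" for f g
    using that sR RA xC[OF that] pullback_maximal_iff[of g "x f"] by (auto simp: K_def sieve_def)
  have K_pull: "pullback_sieve C f K = x f" if "f \<in> R" for f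
    using K_iff that x(2)[OF that] by (auto simp: pullback_sieve_def sieve_def)
  have sK: "sieve C X K"
    unfolding sieve_def
  proof (intro conjI ballI impI)
    fix f g assume f: "f \<in> K" and g: "g \<in> Arr C" "Cod C g = Dom C f"
    have fR: "f \<in> R" "Ident C (Dom C f) \<in> x f" using f by (auto simp: K_def)
    have "\<forall>h\<in>x f. \<forall>g\<in>Arr C. Cod C g = Dom C h \<longrightarrow> Comp C h g \<in> x f"
      using x(2)[OF fR(1)] by (simp add: sieve_def)
    from bspec[OF bspec[OF this fR(2)] g(1)] have "g \<in> x f" using g RA[OF fR(1)] by simp
    then show "Comp C f g \<in> K" using K_iff fR g by simp
  qed (use X RA in \<open>auto simp: K_def\<close>)
  show "\<exists>!s. s \<in> closed_sieves X \<and> (\<forall>f\<in>R. pullback_sieve C f s = x f)"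
  \<comment> \<open>Closing \<open>K\<close> does not disturb its pullbacks along members of
    \<open>R\<close>: they are the sieves \<open>x f\<close>, which are closed already.\<close>
  proof (rule ex1I[of _ "sieve_closure X K"])
    have "pullback_sieve C f (sieve_closure X K) = x f" if f: "f \<in> R" for f
      using pullback_sieve_closure[of f X K] RA[OF f] K_pull[OF f] x[OF f] subset_sieve_closure[OF x(2)[OF f]]
      by (auto simp: closed_sieves_def)
    then show "sieve_closure X K \<in> closed_sieves X \<and> (\<forall>f\<in>R. pullback_sieve C f (sieve_closure X K) = x f)"
      using sieve_closure_closed[OF sK] by blast
    fix s assume s: "s \<in> closed_sieves X \<and> (\<forall>f\<in>R. pullback_sieve C f s = x f)"
    show "s = sieve_closure X K"
      using closed_sieves_eqI[OF X R] s sieve_closure_closed[OF sK] 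
        \<open>\<And>f. f \<in> R \<Longrightarrow> pullback_sieve C f (sieve_closure X K) = x f\<close>
      by (intro subset_antisym) auto
  qed
qed

text \<open>The section \<open>s\<close> lies in the union of the images of \<Phi>, in the sense of
  sheaves, exactly when this sieve covers. It consists of the arrows along which \<open>s\<close>
  acquires a preimage under some member of \<Phi>.\<close>

definition image_sieve :: "(('o, 'a, 'u) presheaf, ('o, 'a, 'u set, 'u set \<times> 'u set \<times> ('u \<Rightarrow> 'u)) ntrans) cat
    \<Rightarrow> ('o, 'a, 'u) presheaf \<Rightarrow> ('o, 'a, 'u set, 'u set \<times> 'u set \<times> ('u \<Rightarrow> 'u)) ntrans set \<Rightarrow> 'o \<Rightarrow> 'u \<Rightarrow> 'a set" where
  "image_sieve E Q \<Phi> X s = {f \<in> Arr C. Cod C f = X \<and>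
     (\<exists>\<sigma>\<in>\<Phi>. \<exists>y\<in>fob (Dom E \<sigma>) (Dom C f). restr Q f s = ap \<sigma> (Dom C f) y)}"

abbreviation "Sh_image \<equiv> image_sieve (Sh U T)"

context
  fixes Q \<Phi> assumes Q: "is_sheaf U T Q" and \<Phi>: "\<Phi> \<subseteq> {\<sigma> \<in> Arr (Sh U T). Cod (Sh U T) \<sigma> = Q}"
begin

lemma \<Phi>_Hom: "\<sigma> \<in> \<Phi> \<Longrightarrow> \<sigma> \<in> Hom (Sh U T) (Dom (Sh U T) \<sigma>) Q"
  using \<Phi> by (auto simp: Hom_def)

lemma sieve_image: "sieve C X (Sh_image Q \<Phi> X s)" if X: "X \<in> Obj C" and s: "s \<in> fob Q X"
  unfolding sieve_def
proof (intro conjI ballI impI)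
  fix f g assume f: "f \<in> Sh_image Q \<Phi> X s" and g: "g \<in> Arr C" "Cod C g = Dom C f"
  then obtain \<sigma> y where \<sigma>: "f \<in> Arr C" "Cod C f = X" "\<sigma> \<in> \<Phi>" "y \<in> fob (Dom (Sh U T) \<sigma>) (Dom C f)" "restr Q f s = ap \<sigma> (Dom C f) y"
    by (auto simp: image_sieve_def)
  have "restr Q (Comp C f g) s = ap \<sigma> (Dom C g) (restr (Dom (Sh U T) \<sigma>) g y)"
    using ap_restr[OF category_C \<Phi>_Hom[OF \<sigma>(3)] g \<sigma>(4)] \<sigma> g s restr_Comp[OF Q] by simp
  moreover have "restr (Dom (Sh U T) \<sigma>) g y \<in> fob (Dom (Sh U T) \<sigma>) (Dom C g)"
    using restr_in[OF Sh_Hom_sheaf(1)[OF \<Phi>_Hom[OF \<sigma>(3)]] g \<sigma>(4)] .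
  ultimately show "Comp C f g \<in> Sh_image Q \<Phi> X s"
    using \<sigma> g by (auto simp: image_sieve_def)
qed (use X in \<open>auto simp: image_sieve_def\<close>)

lemma pullback_image: "pullback_sieve C f (Sh_image Q \<Phi> X s) = Sh_image Q \<Phi> (Dom C f) (restr Q f s)"
  if "f \<in> Arr C" "Cod C f = X" "s \<in> fob Q X"
proof (intro set_eqI)
  fix g
  show "g \<in> pullback_sieve C f (Sh_image Q \<Phi> X s) \<longleftrightarrow> g \<in> Sh_image Q \<Phi> (Dom C f) (restr Q f s)"
    using that
    by (cases "g \<in> Arr C \<and> Cod C g = Dom C f") (auto simp: image_sieve_def pullback_sieve_def restr_Comp[OF Q])
qed

text \<open>
  Compare the characteristic map of the union of the images with the constant map to the maximal
  sieve: they agree on the family.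
\<close>

lemma jointly_epi_imp_locally_surjective:
  assumes epi: "jointly_epi (Sh U T) Q \<Phi>" and X: "X \<in> Obj C" and s: "s \<in> fob Q X"
  shows "Sh_image Q \<Phi> X s \<in> cov T X"
proof -
  obtain \<Omega> e where enc: "encodes U T closed_sieves (pullback_sieve C) \<Omega> e"
    using encodes_ex[OF closed_sieves_sheaf small_closed_sieves] by blast
  note e = encodesD[OF enc]
  define top where "top X = {f \<in> Arr C. Cod C f = X}" for X
  have top_pull: "pullback_sieve C f (top X) = top (Dom C f)" if "f \<in> Arr C" "Cod C f = X" for f X
    using that by (auto simp: top_def pullback_sieve_def)
  have top_cl: "top X \<in> closed_sieves X" if "X \<in> Obj C" for X
    using that by (auto simp: top_def closed_sieves_def sieve_def sieve_closure_def)
  let ?\<chi> = "\<lambda>X s. sieve_closure X (Sh_image Q \<Phi> X s)"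
  obtain a where a: "a \<in> Hom (Sh U T) Q \<Omega>" "\<And>X y. X \<in> Obj C \<Longrightarrow> y \<in> fob Q X \<Longrightarrow> ap a X y = e X (?\<chi> X y)"
    by (rule encodes_arrow_into[OF category_C enc Q, of ?\<chi>])
      (auto simp: sieve_closure_closed sieve_image pullback_sieve_closure pullback_image)
  obtain b where b: "b \<in> Hom (Sh U T) Q \<Omega>" "\<And>X y. X \<in> Obj C \<Longrightarrow> y \<in> fob Q X \<Longrightarrow> ap b X y = e X (top X)"
    by (rule encodes_arrow_into[OF category_C enc Q, of "\<lambda>X y. top X"])
      (auto simp: top_cl top_pull)
  interpret Sh: category "Sh U T" by (rule category_Sh)
  have "Comp (Sh U T) a \<sigma> = Comp (Sh U T) b \<sigma>" if \<sigma>: "\<sigma> \<in> \<Phi>" for \<sigma>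
  proof (rule Sh_Hom_eqI[OF Sh.Comp_in[OF \<Phi>_Hom[OF \<sigma>] a(1)] Sh.Comp_in[OF \<Phi>_Hom[OF \<sigma>] b(1)]])
    fix X y assume X: "X \<in> Obj C" and y: "y \<in> fob (Dom (Sh U T) \<sigma>) X"
    have \<sigma>y: "ap \<sigma> X y \<in> fob Q X" by (rule ap_in[OF \<Phi>_Hom[OF \<sigma>] X y])
    \<comment> \<open>A value of \<sigma> has a preimage along every arrow, so its image sieve is
      maximal. This is why \<open>a\<close> and \<open>b\<close> agree after \<sigma>.\<close>
    have "top X \<subseteq> Sh_image Q \<Phi> X (ap \<sigma> X y)"
    proof
      fix f assume "f \<in> top X"
      then have f: "f \<in> Arr C" "Cod C f = X" by (auto simp: top_def)
      show "f \<in> Sh_image Q \<Phi> X (ap \<sigma> X y)"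
        unfolding image_sieve_def
        using f \<sigma> ap_restr[OF category_C \<Phi>_Hom[OF \<sigma>] f y, symmetric] restr_in[OF Sh_Hom_sheaf(1)[OF \<Phi>_Hom[OF \<sigma>]] f y]
        by blast
    qed
    then have "top X \<subseteq> ?\<chi> X (ap \<sigma> X y)"
      using subset_sieve_closure[OF sieve_image[OF X \<sigma>y]] by blast
    then have "?\<chi> X (ap \<sigma> X y) = top X" by (auto simp: top_def sieve_closure_def)
    then show "ap (Comp (Sh U T) a \<sigma>) X y = ap (Comp (Sh U T) b \<sigma>) X y"
      using ap_Comp[OF \<Phi>_Hom[OF \<sigma>] a(1) X y] ap_Comp[OF \<Phi>_Hom[OF \<sigma>] b(1) X y] a(2)[OF X \<sigma>y] b(2)[OF X \<sigma>y] by simp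
  qed
  then have "a = b" using epi a(1) b(1) encodesD(1)[OF enc] by (auto simp: jointly_epi_def Obj_Sh)
  then have "?\<chi> X s = top X"
    using a(2)[OF X s] b(2)[OF X s] e(4)[OF X sieve_closure_closed[OF sieve_image[OF X s]] top_cl[OF X]] by simp
  \<comment> \<open>The identity belongs to the closure of a sieve precisely when the sieve itself
    covers.\<close>
  then have "Ident C X \<in> ?\<chi> X s" using X by (simp add: top_def)
  then show ?thesis
    using X s pullback_image[of "Ident C X" X s] by (simp add: sieve_closure_def Q)
qed

end

text \<open>Local surjectivity writes \<phi> of a section \<open>x\<close> of \<open>P\<close>
  locally as \<sigma> of some \<open>z\<close>, with \<sigma> in \<open>R\<close>. Then
  \<open>(x, z)\<close> is a section of the fibre product of \<phi> and \<sigma>, whose projection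
  to \<open>P\<close> belongs to the pulled back sieve. Two morphisms that agree on this sieve
  therefore agree locally, hence everywhere.\<close>

theorem Sh_jointly_epi_stable:
  assumes R: "sieve (Sh U T) Q R" "jointly_epi (Sh U T) Q R" and \<phi>: "\<phi> \<in> Hom (Sh U T) P Q"
  shows "jointly_epi (Sh U T) P (pullback_sieve (Sh U T) \<phi> R)"
  unfolding jointly_epi_def
proof (intro ballI impI)
  fix W a b assume a: "a \<in> Hom (Sh U T) P W" and b: "b \<in> Hom (Sh U T) P W"
    and eq: "\<forall>f\<in>pullback_sieve (Sh U T) \<phi> R. Comp (Sh U T) a f = Comp (Sh U T) b f"
  interpret Sh: category "Sh U T" by (rule category_Sh)
  have Q: "is_sheaf U T Q" and P: "is_sheaf U T P" and W: "is_sheaf U T W" using \<phi> a Sh_Hom_sheaf by auto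
  have RA: "R \<subseteq> {\<sigma> \<in> Arr (Sh U T). Cod (Sh U T) \<sigma> = Q}" using R by (simp add: sieve_def)
  have local_eq: "ap a X x = ap b X x" if \<sigma>: "\<sigma> \<in> R" and X: "X \<in> Obj C" and x: "x \<in> fob P X"
    and z: "z \<in> fob (Dom (Sh U T) \<sigma>) X" "ap \<phi> X x = ap \<sigma> X z" for \<sigma> X x z
  proof -
    let ?Z = "Dom (Sh U T) \<sigma>"
    have \<sigma>H: "\<sigma> \<in> Hom (Sh U T) ?Z Q" by (rule \<Phi>_Hom[OF Q RA \<sigma>])
    then have Z: "is_sheaf U T ?Z" by (rule Sh_Hom_sheaf)
    \<comment> \<open>The fibre product is built explicitly, because the pair \<open>(x, z)\<close>
      has to be one of its sections; its universal property alone would not show this.\<close>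
    define S where "S X = {(x, z). x \<in> fob P X \<and> z \<in> fob ?Z X \<and> ap \<phi> X x = ap \<sigma> X z}" for X
    define \<rho> where "\<rho> f = map_prod (restr P f) (restr ?Z f)" for f
    have \<rho>_in: "\<rho> f p \<in> S (Dom C f)" if "f \<in> Arr C" "p \<in> S (Cod C f)" for f p
      using that ap_restr[OF category_C \<phi> that(1) refl] ap_restr[OF category_C \<sigma>H that(1) refl] P Z
      by (auto simp: S_def \<rho>_def)
    have "sheaf_data T S \<rho>"
      unfolding sheaf_data_def presheaf_data_def
    proof (intro conjI ballI allI impI)
      fix Y R' p assume Y: "Y \<in> Obj C" and R': "R' \<in> cov T Y" and p: "matching C S \<rho> R' p"
      note RA = cov_Arr[OF Y R']
      have pS: "p f \<in> S (Dom C f)" if "f \<in> R'" for f using p that by (simp add: matching_def)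
      have pC: "p (Comp C f g) = \<rho> g (p f)" if "f \<in> R'" "g \<in> Arr C" "Cod C g = Dom C f" for f g
        using p that by (simp add: matching_def)
      have "matching C (fob P) (restr P) R' (\<lambda>f. fst (p f))" "matching C (fob ?Z) (restr ?Z) R' (\<lambda>f. snd (p f))"
        unfolding matching_def using pS pC by (auto simp: S_def \<rho>_def case_prod_beta)
      then obtain u v where u: "u \<in> fob P Y" "\<forall>f\<in>R'. restr P f u = fst (p f)"
        and v: "v \<in> fob ?Z Y" "\<forall>f\<in>R'. restr ?Z f v = snd (p f)"
        using sheaf_glue[OF P Y R'] sheaf_glue[OF Z Y R'] by meson
      have "ap \<phi> Y u = ap \<sigma> Y v"
      proof (rule sheaf_separated[OF Q Y R'])
        fix f assume f: "f \<in> R'"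
        then show "restr Q f (ap \<phi> Y u) = restr Q f (ap \<sigma> Y v)"
          using RA[OF f] u v pS[OF f] ap_restr[OF category_C \<phi> _ _ u(1), of f] ap_restr[OF category_C \<sigma>H _ _ v(1), of f]
          by (auto simp: S_def case_prod_beta)
      qed (rule ap_in[OF \<phi> Y u(1)] ap_in[OF \<sigma>H Y v(1)])+
      show "\<exists>!s. s \<in> S Y \<and> (\<forall>f\<in>R'. \<rho> f s = p f)"
      proof (rule ex1I[of _ "(u, v)"])
        show "(u, v) \<in> S Y \<and> (\<forall>f\<in>R'. \<rho> f (u, v) = p f)"
          using u v \<open>ap \<phi> Y u = ap \<sigma> Y v\<close> by (auto simp: S_def \<rho>_def)
        fix s assume s: "s \<in> S Y \<and> (\<forall>f\<in>R'. \<rho> f s = p f)"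
        obtain u' v' where [simp]: "s = (u', v')" by force
        have s': "u' \<in> fob P Y" "v' \<in> fob ?Z Y" using s by (auto simp: S_def)
        have p': "p f = (restr P f u', restr ?Z f v')" if "f \<in> R'" for f
          using s that by (auto simp: \<rho>_def)
        have "u' = u" by (rule sheaf_separated[OF P Y R' s'(1) u(1)]) (use u p' in simp)
        moreover have "v' = v" by (rule sheaf_separated[OF Z Y R' s'(2) v(1)]) (use v p' in simp)
        ultimately show "s = (u, v)" by simp
      qed
    qed (use \<rho>_in P Z in \<open>auto simp: S_def \<rho>_def restr_Comp\<close>)
    moreover have "small U (S Y)" if Y: "Y \<in> Obj C" for Y
      by (rule small_mono[OF small_Times[OF small_fob[OF P Y] small_fob[OF Z Y]]]) (auto simp: S_def)
    ultimately obtain V e where enc: "encodes U T S \<rho> V e" using encodes_ex by blast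
    obtain g where g: "g \<in> Hom (Sh U T) V P" "\<And>X p. X \<in> Obj C \<Longrightarrow> p \<in> S X \<Longrightarrow> ap g X (e X p) = fst p"
      by (rule encodes_arrow_from[OF category_C enc P, of "\<lambda>X p. fst p"]) (auto simp: S_def \<rho>_def)
    obtain h where h: "h \<in> Hom (Sh U T) V ?Z" "\<And>X p. X \<in> Obj C \<Longrightarrow> p \<in> S X \<Longrightarrow> ap h X (e X p) = snd p"
      by (rule encodes_arrow_from[OF category_C enc Z, of "\<lambda>X p. snd p"]) (auto simp: S_def \<rho>_def)
    have "Comp (Sh U T) \<phi> g = Comp (Sh U T) \<sigma> h"
    proof (rule Sh_Hom_eqI[OF Sh.Comp_in[OF g(1) \<phi>] Sh.Comp_in[OF h(1) \<sigma>H]])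
      fix X y assume X: "X \<in> Obj C" and y: "y \<in> fob V X"
      then obtain p where p: "p \<in> S X" "y = e X p" using encodesD(3)[OF enc] by blast
      then show "ap (Comp (Sh U T) \<phi> g) X y = ap (Comp (Sh U T) \<sigma> h) X y"
        using ap_Comp[OF g(1) \<phi> X y] ap_Comp[OF h(1) \<sigma>H X y] g(2)[OF X p(1)] h(2)[OF X p(1)]
        by (auto simp: S_def)
    qed
    moreover have "Comp (Sh U T) \<sigma> h \<in> R" using R(1) \<sigma> h(1) by (auto simp: sieve_def Hom_def)
    \<comment> \<open>The square makes \<phi> after the first projection equal to \<sigma> after the
      second, which is in the sieve \<open>R\<close>.\<close>
    ultimately have "g \<in> pullback_sieve (Sh U T) \<phi> R" using g(1) \<phi> by (auto simp: pullback_sieve_def Hom_def)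
    then have "Comp (Sh U T) a g = Comp (Sh U T) b g" using eq by blast
    moreover have xz: "(x, z) \<in> S X" using x z by (simp add: S_def)
    ultimately show ?thesis
      using ap_Comp[OF g(1) a X encodesD(2)[OF enc X xz]] ap_Comp[OF g(1) b X encodesD(2)[OF enc X xz]] g(2)[OF X xz]
      by simp
  qed
  show "a = b"
  proof (rule Sh_Hom_eqI[OF a b])
    fix X x assume X: "X \<in> Obj C" and x: "x \<in> fob P X"
    let ?I = "Sh_image Q R X (ap \<phi> X x)"
    have "?I \<in> cov T X"
      by (rule jointly_epi_imp_locally_surjective[OF Q RA R(2) X ap_in[OF \<phi> X x]])
    then show "ap a X x = ap b X x"
    proof (rule sheaf_separated[OF W X])
      fix f assume "f \<in> ?I"
      then obtain \<sigma> z where f: "f \<in> Arr C" "Cod C f = X" "\<sigma> \<in> R" "z \<in> fob (Dom (Sh U T) \<sigma>) (Dom C f)"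
        "restr Q f (ap \<phi> X x) = ap \<sigma> (Dom C f) z" by (auto simp: image_sieve_def)
      then show "restr W f (ap a X x) = restr W f (ap b X x)"
        using local_eq[of \<sigma> "Dom C f" "restr P f x" z] ap_restr[OF category_C \<phi> f(1,2) x]
          ap_restr[OF category_C a f(1,2) x] ap_restr[OF category_C b f(1,2) x] restr_in[OF P f(1,2) x] by simp
    qed (rule ap_in[OF a X x] ap_in[OF b X x])+
  qed
qed

subsection \<open>Generators\<close>

text \<open>
  Sheaves generated by a single section stand in for the quotients of the sheafified representable
  presheaves, so that no sheafification has to be constructed.
\<close>

definition orbit_sieve :: "('o, 'a, 'u) presheaf \<Rightarrow> 'o \<Rightarrow> 'u \<Rightarrow> 'o \<Rightarrow> 'u \<Rightarrow> 'a set" where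
  "orbit_sieve P X s Y t = {k \<in> Arr C. Cod C k = Y \<and> (\<exists>g\<in>Hom C (Dom C k) X. restr P k t = restr P g s)}"

text \<open>By the Yoneda lemma, \<open>s\<close> is a map from the presheaf represented by
  \<open>X\<close> to \<open>P\<close>. The condition on orbits says that this map is locally
  surjective.\<close>

definition generated_by :: "('o, 'a, 'u) presheaf \<Rightarrow> 'o \<Rightarrow> 'u \<Rightarrow> bool" where
  "generated_by P X s \<longleftrightarrow> is_sheaf U T P \<and> s \<in> fob P X \<and>
     (\<forall>Y\<in>Obj C. \<forall>t\<in>fob P Y. orbit_sieve P X s Y t \<in> cov T Y)"

text \<open>The kernel pair of the map that \<open>s\<close> represents, recorded at objects of
  \<open>G\<close> only. For \<open>X\<close> in \<open>G\<close> this leaves a small set of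
  possible values.\<close>

definition section_kernel :: "('o, 'a, 'u) presheaf \<Rightarrow> 'o \<Rightarrow> 'u \<Rightarrow> ('a \<times> 'a) set" where
  "section_kernel P X s = {(g, h). \<exists>Y\<in>G. g \<in> Hom C Y X \<and> h \<in> Hom C Y X \<and> restr P g s = restr P h s}"

lemma sieve_orbit: "sieve C Y (orbit_sieve P X s Y t)"
  if P: "is_sheaf U T P" and s: "s \<in> fob P X" and Y: "Y \<in> Obj C" and t: "t \<in> fob P Y"
  unfolding sieve_def
proof (intro conjI ballI impI)
  fix f g assume f: "f \<in> orbit_sieve P X s Y t" and g: "g \<in> Arr C" "Cod C g = Dom C f"
  then obtain h where h: "f \<in> Arr C" "Cod C f = Y" "h \<in> Arr C" "Dom C h = Dom C f" "Cod C h = X"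
    "restr P f t = restr P h s" by (auto simp: orbit_sieve_def Hom_def)
  then have "restr P (Comp C f g) t = restr P (Comp C h g) s" using g s t by (simp add: restr_Comp[OF P])
  then show "Comp C f g \<in> orbit_sieve P X s Y t" using h g
    by (auto simp: orbit_sieve_def Hom_def intro!: exI[of _ "Comp C h g"])
qed (use Y in \<open>auto simp: orbit_sieve_def\<close>)

lemma pullback_orbit: "pullback_sieve C f (orbit_sieve P X s Y t) = orbit_sieve P X s (Dom C f) (restr P f t)"
  if "is_sheaf U T P" "f \<in> Arr C" "Cod C f = Y" "t \<in> fob P Y"
proof (intro set_eqI)
  fix g
  show "g \<in> pullback_sieve C f (orbit_sieve P X s Y t) \<longleftrightarrow> g \<in> orbit_sieve P X s (Dom C f) (restr P f t)"
    using that
    by (cases "g \<in> Arr C \<and> Cod C g = Dom C f") (auto simp: orbit_sieve_def pullback_sieve_def restr_Comp)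
qed

text \<open>The sections of \<open>Q\<close> that are locally restrictions of \<open>s\<close> form
  a subsheaf, the image of the map that \<open>s\<close> represents. Passing to a subsheaf that
  contains \<open>s\<close> does not change the kernel.\<close>

lemma generated_subsheaf:
  assumes Q: "is_sheaf U T Q" and X: "X \<in> Obj C" and s: "s \<in> fob Q X"
  shows "\<exists>P s'. generated_by P X s' \<and> section_kernel P X s' = section_kernel Q X s"
proof -
  define S where "S Y = {t \<in> fob Q Y. orbit_sieve Q X s Y t \<in> cov T Y}" for Y
  have S_in: "restr Q f t \<in> S (Dom C f)" if "f \<in> Arr C" "t \<in> S (Cod C f)" for f t
    using that cov_pullback[of "orbit_sieve Q X s (Cod C f) t" "Cod C f" f] pullback_orbit[OF Q that(1) refl, of t] Q
    by (auto simp: S_def)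
  have "sheaf_data T S (restr Q)"
    unfolding sheaf_data_def presheaf_data_def
  proof (intro conjI ballI allI impI)
    fix Y R x assume Y: "Y \<in> Obj C" and R: "R \<in> cov T Y" and x: "matching C S (restr Q) R x"
    note RA = cov_Arr[OF Y R]
    have xS: "x f \<in> S (Dom C f)" if "f \<in> R" for f using x that by (simp add: matching_def)
    have "matching C (fob Q) (restr Q) R x" using x by (auto simp: matching_def S_def)
    then obtain t where t: "t \<in> fob Q Y" "\<forall>f\<in>R. restr Q f t = x f" using sheaf_glue[OF Q Y R] by blast
    have "orbit_sieve Q X s Y t \<in> cov T Y"
    proof (rule cov_transitive[OF Y R sieve_orbit[OF Q s Y t(1)]])
      fix f assume f: "f \<in> R"
      then show "pullback_sieve C f (orbit_sieve Q X s Y t) \<in> cov T (Dom C f)"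
        using pullback_orbit[OF Q, of f Y t X s] RA[OF f] t xS[OF f] by (simp add: S_def)
    qed
    then have "t \<in> S Y" using t by (simp add: S_def)
    show "\<exists>!s. s \<in> S Y \<and> (\<forall>f\<in>R. restr Q f s = x f)"
    proof (rule ex1I[of _ t])
      show "t \<in> S Y \<and> (\<forall>f\<in>R. restr Q f t = x f)" using \<open>t \<in> S Y\<close> t by blast
      fix t' assume t': "t' \<in> S Y \<and> (\<forall>f\<in>R. restr Q f t' = x f)"
      then have "t' \<in> fob Q Y" by (simp add: S_def)
      then show "t' = t" by (rule sheaf_separated[OF Q Y R _ t(1)]) (use t t' in simp)
    qed
  qed (use S_in Q in \<open>auto simp: S_def restr_Comp\<close>)
  moreover have "small U (S Y)" if Y: "Y \<in> Obj C" for Y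
    by (rule small_mono[OF small_fob[OF Q Y]]) (auto simp: S_def)
  ultimately obtain P e where enc: "encodes U T S (restr Q) P e" using encodes_ex by blast
  note e = encodesD[OF enc]
  have sS: "s \<in> S X"
  proof -
    have "k \<in> orbit_sieve Q X s X s" if "k \<in> Arr C" "Cod C k = X" for k
      using that by (auto simp: orbit_sieve_def Hom_def)
    then have "orbit_sieve Q X s X s \<in> cov T X"
      by (intro cov_superset[OF X cov_maximal[OF X] _ sieve_orbit[OF Q s X s]]) auto
    then show ?thesis using s by (simp add: S_def)
  qed
  \<comment> \<open>Orbit sieves and kernels are both defined by equations of this form, so this
    equivalence carries both from \<open>Q\<close> to its coded subsheaf.\<close>
  have eq_iff: "restr P k (e Y t) = restr P g (e X s) \<longleftrightarrow> restr Q k t = restr Q g s"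
    if k: "k \<in> Arr C" "Cod C k = Y" "t \<in> S Y" and g: "g \<in> Hom C (Dom C k) X" for k Y t g
  proof -
    have gA: "g \<in> Arr C" "Cod C g = X" "Dom C g = Dom C k" using g by (auto simp: Hom_def)
    have "restr P k (e Y t) = e (Dom C k) (restr Q k t)" "restr P g (e X s) = e (Dom C k) (restr Q g s)"
      using e(5)[OF k(1)] e(5)[OF gA(1)] k gA sS by auto
    then show ?thesis
      using e(4)[of "Dom C k" "restr Q k t" "restr Q g s"] S_in[OF k(1)] S_in[OF gA(1)] k gA sS by auto
  qed
  have "generated_by P X (e X s)"
    unfolding generated_by_def
  proof (intro conjI ballI)
    fix Y t assume Y: "Y \<in> Obj C" and t: "t \<in> fob P Y"
    obtain t' where t': "t' \<in> S Y" "t = e Y t'" using e(3)[OF Y t] by blast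
    have "orbit_sieve P X (e X s) Y t = orbit_sieve Q X s Y t'"
      using t' eq_iff by (auto simp: orbit_sieve_def)
    then show "orbit_sieve P X (e X s) Y t \<in> cov T Y" using t' by (simp add: S_def)
  qed (use e X sS in auto)
  moreover have "section_kernel P X (e X s) = section_kernel Q X s"
    using eq_iff[OF _ _ sS] by (auto simp: section_kernel_def Hom_def)
  ultimately show ?thesis by blast
qed

text \<open>The kernel is recorded at \<open>G\<close> only. Equality of two restrictions in
  \<open>Q\<close> can be tested after composing with arrows from \<open>G\<close>, so the inclusion
  of kernels spreads to every object.\<close>

lemma section_kernel_subset:
  assumes P: "is_sheaf U T P" "s \<in> fob P X" and Q: "is_sheaf U T Q" "s' \<in> fob Q X"
    and K: "section_kernel P X s \<subseteq> section_kernel Q X s'"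
    and g: "g \<in> Hom C Z X" "h \<in> Hom C Z X" "restr P g s = restr P h s"
  shows "restr Q g s' = restr Q h s'"
proof -
  have gA: "g \<in> Arr C" "h \<in> Arr C" "Dom C g = Z" "Dom C h = Z" "Cod C g = X" "Cod C h = X" 
    using g by (auto simp: Hom_def)
  show ?thesis
  proof (rule sheaf_separated_generators[OF Q(1)])
    fix f assume f: "f \<in> Arr C" "Cod C f = Z" "Dom C f \<in> G"
    then have "(Comp C g f, Comp C h f) \<in> section_kernel P X s"
      using gA P(2) g(3) by (auto simp: section_kernel_def Hom_def restr_Comp[OF P(1)])
    then have "(Comp C g f, Comp C h f) \<in> section_kernel Q X s'" using K by blast
    then show "restr Q f (restr Q g s') = restr Q f (restr Q h s')"
      using f gA Q(2) by (auto simp: section_kernel_def restr_Comp[OF Q(1)])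
  qed (use gA Dom_in restr_in[OF Q(1) gA(1,5) Q(2)] restr_in[OF Q(1) gA(2,6) Q(2)] in auto)
qed

text \<open>A section \<open>t\<close> of \<open>P\<close> is locally of the form
  \<open>restr P g s\<close>, and its image has to be locally \<open>restr Q g s'\<close>. The
  inclusion of kernels makes this independent of \<open>g\<close>, so that the local values match
  and glue.\<close>

lemma generated_arrow:
  assumes P: "generated_by P X s" and Q: "is_sheaf U T Q" "s' \<in> fob Q X" and X: "X \<in> Obj C"
    and K: "section_kernel P X s \<subseteq> section_kernel Q X s'"
  shows "\<exists>\<sigma>\<in>Hom (Sh U T) P Q. ap \<sigma> X s = s'"
proof -
  have Psh: "is_sheaf U T P" and s: "s \<in> fob P X"
    and orb: "\<And>Y t. Y \<in> Obj C \<Longrightarrow> t \<in> fob P Y \<Longrightarrow> orbit_sieve P X s Y t \<in> cov T Y"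
    using P by (auto simp: generated_by_def)
  note wd = section_kernel_subset[OF Psh s Q K]
  \<comment> \<open>The condition is stated for every representative \<open>g\<close>, not just for
    the chosen ones. In this form it determines \<open>t'\<close> and yields naturality
    below.\<close>
  have ex: "\<exists>t'\<in>fob Q Y. \<forall>k\<in>Arr C. \<forall>g\<in>Hom C (Dom C k) X. Cod C k = Y \<longrightarrow> restr P k t = restr P g s
      \<longrightarrow> restr Q k t' = restr Q g s'" if Y: "Y \<in> Obj C" and t: "t \<in> fob P Y" for Y t
  proof -
    \<comment> \<open>One representative for each arrow of the orbit sieve; different choices have
      the same restriction of \<open>s'\<close>.\<close>
    define c where "c k = (SOME g. g \<in> Hom C (Dom C k) X \<and> restr P k t = restr P g s)" for k
    have c: "c k \<in> Hom C (Dom C k) X" "restr P k t = restr P (c k) s" if "k \<in> orbit_sieve P X s Y t" for k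
      using that someI_ex[of "\<lambda>g. g \<in> Hom C (Dom C k) X \<and> restr P k t = restr P g s"]
      by (auto simp: orbit_sieve_def c_def)
    have "matching C (fob Q) (restr Q) (orbit_sieve P X s Y t) (\<lambda>k. restr Q (c k) s')"
      unfolding matching_def
    proof (intro conjI ballI impI)
      fix k assume k: "k \<in> orbit_sieve P X s Y t"
      then show "restr Q (c k) s' \<in> fob Q (Dom C k)"
        using c[OF k] restr_in[OF Q(1), of "c k" X s'] Q(2) by (auto simp: Hom_def)
      fix g assume g: "g \<in> Arr C" "Cod C g = Dom C k"
      have kA: "k \<in> Arr C" "Cod C k = Y" using k by (auto simp: orbit_sieve_def)
      have kg: "Comp C k g \<in> orbit_sieve P X s Y t"
        using sieve_orbit[OF Psh s Y t] k g by (simp add: sieve_def)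
      have cA: "c k \<in> Arr C" "Dom C (c k) = Dom C k" "Cod C (c k) = X" using c(1)[OF k] by (auto simp: Hom_def)
      have "restr P (c (Comp C k g)) s = restr P (Comp C (c k) g) s"
        using c(2)[OF k] c(2)[OF kg] kA g cA t s by (simp add: restr_Comp[OF Psh])
      then have "restr Q (c (Comp C k g)) s' = restr Q (Comp C (c k) g) s'"
        using c(1)[OF kg] kA g cA by (intro wd[of _ "Dom C g"]) (auto simp: Hom_def)
      then show "restr Q (c (Comp C k g)) s' = restr Q g (restr Q (c k) s')"
        using cA g Q(2) by (simp add: restr_Comp[OF Q(1)])
    qed
    then obtain t' where t': "t' \<in> fob Q Y" "\<forall>k\<in>orbit_sieve P X s Y t. restr Q k t' = restr Q (c k) s'"
      using sheaf_glue[OF Q(1) Y orb[OF Y t]] by blast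
    have "restr Q k t' = restr Q g s'"
      if "k \<in> Arr C" "g \<in> Hom C (Dom C k) X" "Cod C k = Y" "restr P k t = restr P g s" for k g
    proof -
      have k: "k \<in> orbit_sieve P X s Y t" using that by (auto simp: orbit_sieve_def)
      then show ?thesis using t' c[OF k] wd[OF c(1)[OF k] that(2)] that(4) by simp
    qed
    then show ?thesis using t' by blast
  qed
  then obtain h where h: "\<And>Y t. Y \<in> Obj C \<Longrightarrow> t \<in> fob P Y \<Longrightarrow> h Y t \<in> fob Q Y"
    "\<And>Y t k g. Y \<in> Obj C \<Longrightarrow> t \<in> fob P Y \<Longrightarrow> k \<in> Arr C \<Longrightarrow> Cod C k = Y \<Longrightarrow> g \<in> Hom C (Dom C k) X
      \<Longrightarrow> restr P k t = restr P g s \<Longrightarrow> restr Q k (h Y t) = restr Q g s'"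
    by metis
  have "\<exists>\<sigma>. \<sigma> \<in> Hom (Sh U T) P Q \<and> (\<forall>X\<in>Obj C. \<forall>x\<in>fob P X. ap \<sigma> X x = h X x)"
  proof (rule Sh_Hom_ex[OF category_C Psh Q(1), of h])
    fix f t assume f: "f \<in> Arr C" and t: "t \<in> fob P (Cod C f)"
    have ft: "restr P f t \<in> fob P (Dom C f)" using f t Psh by simp
    have D: "Dom C f \<in> Obj C" using f by simp
    show "h (Dom C f) (restr P f t) = restr Q f (h (Cod C f) t)"
    proof (rule sheaf_separated[OF Q(1) D orb[OF D ft]])
      fix k assume "k \<in> orbit_sieve P X s (Dom C f) (restr P f t)"
      then obtain g where k: "k \<in> Arr C" "Cod C k = Dom C f" "g \<in> Hom C (Dom C k) X"
        "restr P k (restr P f t) = restr P g s" by (auto simp: orbit_sieve_def)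
      have "restr Q k (h (Dom C f) (restr P f t)) = restr Q g s'"
        by (rule h(2)[OF D ft k])
      moreover have "restr Q (Comp C f k) (h (Cod C f) t) = restr Q g s'"
        using f t k by (intro h(2)) (auto simp: restr_Comp[OF Psh])
      ultimately show "restr Q k (h (Dom C f) (restr P f t)) = restr Q k (restr Q f (h (Cod C f) t))"
        using f k t h(1) by (simp add: restr_Comp[OF Q(1)])
    qed (use f t ft h(1) Q(1) in auto)
  qed (use h(1) in auto)
  then obtain \<sigma> where \<sigma>: "\<sigma> \<in> Hom (Sh U T) P Q" "\<And>X x. X \<in> Obj C \<Longrightarrow> x \<in> fob P X \<Longrightarrow> ap \<sigma> X x = h X x" by blast
  \<comment> \<open>The identity represents \<open>s\<close> itself, which gives the value of the
    morphism at \<open>s\<close>.\<close>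
  have "restr Q (Ident C X) (h X s) = restr Q (Ident C X) s'"
    using X s by (intro h(2)) (auto simp: Hom_def)
  then have "ap \<sigma> X s = s'" using \<sigma>(2)[OF X s] h(1)[OF X s] X Q by simp
  then show ?thesis using \<sigma>(1) by blast
qed

text \<open>The sheaves generated by one section over an object of \<open>G\<close> may form a large
  collection, but only a small set of pairs of object and kernel occurs. One representative for each
  pair suffices, since \<open>generated_arrow\<close> maps it to every sheaf with a section of that
  kernel.\<close>

theorem Sh_small_generators:
  "\<exists>S. small U S \<and> S \<subseteq> Obj (Sh U T) \<and> (\<forall>Q \<in> Obj (Sh U T).
     jointly_epi (Sh U T) Q {\<sigma> \<in> Arr (Sh U T). Dom (Sh U T) \<sigma> \<in> S \<and> Cod (Sh U T) \<sigma> = Q})"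
proof -
  define codes where "codes = {(X, K). X \<in> G \<and> (\<exists>P s. generated_by P X s \<and> section_kernel P X s = K)}"
  define rep where "rep = (\<lambda>(X, K). SOME P. \<exists>s. generated_by P X s \<and> section_kernel P X s = K)"
  have rep: "\<exists>s. generated_by (rep (X, K)) X s \<and> section_kernel (rep (X, K)) X s = K" if "(X, K) \<in> codes" for X K
    using that someI_ex[of "\<lambda>P. \<exists>s. generated_by P X s \<and> section_kernel P X s = K"]
    by (auto simp: codes_def rep_def)
  let ?H = "\<Union>X\<in>G. \<Union>Y\<in>G. Hom C Y X"
  have "small U (G \<times> Pow (?H \<times> ?H))"
    by (intro small_Times small_Pow small_UN small_G locally_small G_Obj)
  moreover have "codes \<subseteq> G \<times> Pow (?H \<times> ?H)" by (auto simp: codes_def section_kernel_def)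
  ultimately have "small U codes" by (rule small_mono)
  then have "small U (rep ` codes)" by (rule small_image)
  moreover have "rep ` codes \<subseteq> Obj (Sh U T)"
    using rep by (fastforce simp: Obj_Sh generated_by_def)
  moreover have "jointly_epi (Sh U T) Q {\<sigma> \<in> Arr (Sh U T). Dom (Sh U T) \<sigma> \<in> rep ` codes \<and> Cod (Sh U T) \<sigma> = Q}"
    if Q: "Q \<in> Obj (Sh U T)" for Q
    unfolding jointly_epi_def
  proof (intro ballI impI)
    fix W a b assume a: "a \<in> Hom (Sh U T) Q W" and b: "b \<in> Hom (Sh U T) Q W"
      and eq: "\<forall>f\<in>{\<sigma> \<in> Arr (Sh U T). Dom (Sh U T) \<sigma> \<in> rep ` codes \<and> Cod (Sh U T) \<sigma> = Q}. Comp (Sh U T) a f = Comp (Sh U T) b f"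
    have Qsh: "is_sheaf U T Q" using Q by (simp add: Obj_Sh)
    show "a = b"
    proof (rule Sh_Hom_eq_generators[OF a b])
      fix X x assume XG: "X \<in> G" and x: "x \<in> fob Q X"
      have X: "X \<in> Obj C" by (rule G_Obj[OF XG])
      let ?K = "section_kernel Q X x"
      \<comment> \<open>The kernel of \<open>x\<close> occurs among the codes because of the
        subsheaf that \<open>x\<close> generates. The representative of the code may be another
        sheaf, which is harmless: it still has a morphism to \<open>Q\<close> hitting
        \<open>x\<close>.\<close>
      have code: "(X, ?K) \<in> codes" using generated_subsheaf[OF Qsh X x] XG by (auto simp: codes_def)
      then obtain s where s: "generated_by (rep (X, ?K)) X s" "section_kernel (rep (X, ?K)) X s = ?K"
        using rep by blast
      then obtain \<sigma> where \<sigma>: "\<sigma> \<in> Hom (Sh U T) (rep (X, ?K)) Q" "ap \<sigma> X s = x"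
        using generated_arrow[OF s(1) Qsh x X] by auto
      then have "Comp (Sh U T) a \<sigma> = Comp (Sh U T) b \<sigma>" using eq code by (auto simp: Hom_def)
      then show "ap a X x = ap b X x"
        using ap_Comp[OF \<sigma>(1) a X] ap_Comp[OF \<sigma>(1) b X] \<sigma>(2) s(1) by (auto simp: generated_by_def)
    qed
  qed
  ultimately show ?thesis by blast
qed

end

section \<open>Transport along equivalences\<close>

lemma jointly_epi_mono: "jointly_epi E X \<Phi> \<Longrightarrow> \<Phi> \<subseteq> \<Psi> \<Longrightarrow> jointly_epi E X \<Psi>"
  by (simp add: jointly_epi_def) (meson subsetD)

lemma (in category) sieve_generated:
  assumes "X \<in> Obj C" "\<Phi> \<subseteq> {f \<in> Arr C. Cod C f = X}"
  shows "sieve C X (generated_sieve C \<Phi>)" "\<Phi> \<subseteq> generated_sieve C \<Phi>"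
proof -
  show "sieve C X (generated_sieve C \<Phi>)"
    unfolding sieve_def
  proof (intro conjI ballI impI)
    fix f g assume "f \<in> generated_sieve C \<Phi>" and g: "g \<in> Arr C" "Cod C g = Dom C f"
    then obtain h k where h: "f = Comp C h k" "h \<in> \<Phi>" "k \<in> Arr C" "Cod C k = Dom C h"
      by (auto simp: generated_sieve_def)
    moreover have "h \<in> Arr C" using h assms by auto
    ultimately have "Comp C f g = Comp C h (Comp C k g)" "Comp C k g \<in> Arr C" "Cod C (Comp C k g) = Dom C h"
      using g by (simp_all add: Arr_assoc Comp_Arr)
    then show "Comp C f g \<in> generated_sieve C \<Phi>" using h by (auto simp: generated_sieve_def)
  qed (use assms in \<open>auto simp: generated_sieve_def Comp_Arr\<close>)
  show "\<Phi> \<subseteq> generated_sieve C \<Phi>"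
  proof
    fix f assume "f \<in> \<Phi>"
    then show "f \<in> generated_sieve C \<Phi>"
      using assms Arr_Comp_Ident[of f "Dom C f"] Ident_Arr[of "Dom C f"] Dom_in[of f]
      unfolding generated_sieve_def by (intro CollectI exI[of _ f] exI[of _ "Ident C (Dom C f)"]) auto
  qed
qed

lemma (in category) jointly_epi_generated:
  assumes "\<Phi> \<subseteq> {f \<in> Arr C. Cod C f = X}"
  shows "jointly_epi C X (generated_sieve C \<Phi>) \<longleftrightarrow> jointly_epi C X \<Phi>"
proof
  assume L: "jointly_epi C X (generated_sieve C \<Phi>)"
  show "jointly_epi C X \<Phi>"
    unfolding jointly_epi_def
  proof (intro ballI impI)
    fix Y a b assume Y: "Y \<in> Obj C" and a: "a \<in> Hom C X Y" and b: "b \<in> Hom C X Y"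
      and eq: "\<forall>f\<in>\<Phi>. Comp C a f = Comp C b f"
    have "Comp C a f = Comp C b f" if f: "f \<in> generated_sieve C \<Phi>" for f
    proof -
      obtain h k where h: "f = Comp C h k" "h \<in> \<Phi>" "k \<in> Arr C" "Cod C k = Dom C h"
        using f by (auto simp: generated_sieve_def)
      then have "h \<in> Arr C" "Cod C h = X" "Comp C a h = Comp C b h" using assms eq by auto
      then show ?thesis using h a b by (simp add: Hom_def Arr_assoc)
    qed
    then show "a = b" using L Y a b by (auto simp: jointly_epi_def)
  qed
next
  assume R: "jointly_epi C X \<Phi>"
  show "jointly_epi C X (generated_sieve C \<Phi>)"
    unfolding jointly_epi_def
  proof (intro ballI impI)
    fix Y a b assume Y: "Y \<in> Obj C" and a: "a \<in> Hom C X Y" and b: "b \<in> Hom C X Y"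
      and eq: "\<forall>f\<in>generated_sieve C \<Phi>. Comp C a f = Comp C b f"
    have "X \<in> Obj C" using a Dom_in by (auto simp: Hom_def)
    then show "a = b" using R Y a b eq sieve_generated(2)[OF _ assms] unfolding jointly_epi_def by blast
  qed
qed

text \<open>With this form of equivalence, properties are reflected by lifting arrows and replacing
  objects, without carrying a quasi-inverse and its naturality squares along.\<close>

locale equivalence = cat_functor C D F
  for C :: "('o, 'a) cat" and D :: "('p, 'b) cat" and F :: "('o, 'a, 'p, 'b) ftor" +
  assumes faithful: "\<lbrakk>f \<in> Hom C X Y; g \<in> Hom C X Y; far F f = far F g\<rbrakk> \<Longrightarrow> f = g"
    and full: "\<lbrakk>X \<in> Obj C; Y \<in> Obj C; k \<in> Hom D (fob F X) (fob F Y)\<rbrakk> \<Longrightarrow> \<exists>f\<in>Hom C X Y. far F f = k"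
    and essentially_surjective: "Z \<in> Obj D \<Longrightarrow> \<exists>X\<in>Obj C. \<exists>i\<in>Hom D (fob F X) Z. \<exists>j\<in>Hom D Z (fob F X).
      Comp D i j = Ident D Z \<and> Comp D j i = Ident D (fob F X)"

lemma iso_ntrans_components:
  assumes "iso_arrow (functor_cat C D) \<alpha>"
  shows "\<exists>\<beta>. nat_trans C D \<beta> \<and> nsrc \<beta> = ntgt \<alpha> \<and> ntgt \<beta> = nsrc \<alpha> \<and>
    (\<forall>X \<in> Obj C. Comp D (ncmp \<beta> X) (ncmp \<alpha> X) = Ident D (fob (nsrc \<alpha>) X)) \<and>
    (\<forall>X \<in> Obj C. Comp D (ncmp \<alpha> X) (ncmp \<beta> X) = Ident D (fob (ntgt \<alpha>) X))"
proof -
  obtain \<beta> where \<beta>: "nat_trans C D \<beta>" "nsrc \<beta> = ntgt \<alpha>" "ntgt \<beta> = nsrc \<alpha>"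
    "vcomp C D \<beta> \<alpha> = id_ntrans C D (nsrc \<alpha>)" "vcomp C D \<alpha> \<beta> = id_ntrans C D (ntgt \<alpha>)"
    using assms by (auto simp: iso_arrow_def Hom_functor_cat)
  have "Comp D (ncmp \<beta> X) (ncmp \<alpha> X) = Ident D (fob (nsrc \<alpha>) X)"
    "Comp D (ncmp \<alpha> X) (ncmp \<beta> X) = Ident D (fob (ntgt \<alpha>) X)" if "X \<in> Obj C" for X
    using arg_cong[OF \<beta>(4), of "\<lambda>\<gamma>. ncmp \<gamma> X"] arg_cong[OF \<beta>(5), of "\<lambda>\<gamma>. ncmp \<gamma> X"] that by auto
  then show ?thesis using \<beta>(1-3) by blast
qed

text \<open>The isomorphisms in \<open>equivalent_cats\<close> satisfy no triangle identities.
  Fullness is therefore deduced from faithfulness of the quasi-inverse \<open>G\<close>.\<close>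

lemma equivalent_cats_equivalence:
  assumes "equivalent_cats C D"
  shows "\<exists>F. equivalence C D F"
proof -
  obtain F G \<eta> \<epsilon> where F: "cat_functor C D F" and G: "cat_functor D C G"
    and \<eta>: "\<eta> \<in> Hom (functor_cat C C) (id_ftor C) (ftor_comp C G F)" "iso_arrow (functor_cat C C) \<eta>"
    and \<epsilon>: "\<epsilon> \<in> Hom (functor_cat D D) (ftor_comp D F G) (id_ftor D)" "iso_arrow (functor_cat D D) \<epsilon>"
    using assms unfolding equivalent_cats_def by blast
  interpret F: cat_functor C D F by fact
  interpret G: cat_functor D C G by fact
  interpret \<eta>: nat_trans C C \<eta> using \<eta> by (simp add: Hom_functor_cat)
  interpret \<epsilon>: nat_trans D D \<epsilon> using \<epsilon> by (simp add: Hom_functor_cat)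
  have [simp]: "nsrc \<eta> = id_ftor C" "ntgt \<eta> = ftor_comp C G F" "nsrc \<epsilon> = ftor_comp D F G" "ntgt \<epsilon> = id_ftor D"
    using \<eta> \<epsilon> by (auto simp: Hom_functor_cat)
  obtain \<eta>' where \<eta>': "nat_trans C C \<eta>'" "nsrc \<eta>' = ntgt \<eta>" "ntgt \<eta>' = nsrc \<eta>"
    "\<And>X. X \<in> Obj C \<Longrightarrow> Comp C (ncmp \<eta>' X) (ncmp \<eta> X) = Ident C (fob (nsrc \<eta>) X)"
    "\<And>X. X \<in> Obj C \<Longrightarrow> Comp C (ncmp \<eta> X) (ncmp \<eta>' X) = Ident C (fob (ntgt \<eta>) X)"
    using iso_ntrans_components[OF \<eta>(2)] by blast
  interpret \<eta>': nat_trans C C \<eta>' by fact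
  obtain \<epsilon>' where \<epsilon>': "nat_trans D D \<epsilon>'" "nsrc \<epsilon>' = ntgt \<epsilon>" "ntgt \<epsilon>' = nsrc \<epsilon>"
    "\<And>X. X \<in> Obj D \<Longrightarrow> Comp D (ncmp \<epsilon>' X) (ncmp \<epsilon> X) = Ident D (fob (nsrc \<epsilon>) X)"
    "\<And>X. X \<in> Obj D \<Longrightarrow> Comp D (ncmp \<epsilon> X) (ncmp \<epsilon>' X) = Ident D (fob (ntgt \<epsilon>) X)"
    using iso_ntrans_components[OF \<epsilon>(2)] by blast
  interpret \<epsilon>': nat_trans D D \<epsilon>' by fact
  note [simp] = F.fob_in G.fob_in F.far_Arr G.far_Arr \<eta>.ncmp_Arr \<eta>'.ncmp_Arr \<epsilon>.ncmp_Arr \<epsilon>'.ncmp_Arr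
    \<eta>'(2,3) \<epsilon>'(2,3) F.source.Comp_Arr F.target.Comp_Arr F.source.Dom_in F.source.Cod_in
    F.target.Dom_in F.target.Cod_in
  have F_faithful: "f = g" if "f \<in> Hom C X Y" "g \<in> Hom C X Y" "far F f = far F g" for f g X Y
  proof -
    have f: "f \<in> Arr C" "Dom C f = X" "Cod C f = Y" and g: "g \<in> Arr C" "Dom C g = X" "Cod C g = Y"
      using that by (auto simp: Hom_def)
    have Y: "Y \<in> Obj C" using f by auto
    \<comment> \<open>Naturality of \<eta> recovers \<open>h\<close> from
      \<open>far G (far F h)\<close>.\<close>
    have *: "h = Comp C (ncmp \<eta>' Y) (Comp C (far G (far F h)) (ncmp \<eta> X))"
      if h: "h \<in> Arr C" "Dom C h = X" "Cod C h = Y" for h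
    proof -
      have "Comp C (far G (far F h)) (ncmp \<eta> X) = Comp C (ncmp \<eta> Y) h"
        using \<eta>.naturality_Arr[of h] h by simp
      then show ?thesis using h Y \<eta>'(4)[OF Y] by (simp add: F.source.Arr_assoc F.source.Arr_Ident_Comp)
    qed
    show ?thesis using *[OF f] *[OF g] that(3) by simp
  qed
  have G_faithful: "f = g" if "f \<in> Hom D X Y" "g \<in> Hom D X Y" "far G f = far G g" for f g X Y
  proof -
    have f: "f \<in> Arr D" "Dom D f = X" "Cod D f = Y" and g: "g \<in> Arr D" "Dom D g = X" "Cod D g = Y"
      using that by (auto simp: Hom_def)
    have X: "X \<in> Obj D" using f by auto
    have *: "h = Comp D (Comp D (ncmp \<epsilon> Y) (far F (far G h))) (ncmp \<epsilon>' X)"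
      if h: "h \<in> Arr D" "Dom D h = X" "Cod D h = Y" for h
    proof -
      have "Comp D (ncmp \<epsilon> Y) (far F (far G h)) = Comp D h (ncmp \<epsilon> X)"
        using \<epsilon>.naturality_Arr[of h] h by simp
      then show ?thesis using h X \<epsilon>'(5)[OF X]
        by (simp add: F.target.Arr_assoc[symmetric] F.target.Arr_Comp_Ident)
    qed
    show ?thesis using *[OF f] *[OF g] that(3) by simp
  qed
  have "equivalence C D F"
  proof
    fix X Y k assume X: "X \<in> Obj C" and Y: "Y \<in> Obj C" and k: "k \<in> Hom D (fob F X) (fob F Y)"
    then have kA: "k \<in> Arr D" "Dom D k = fob F X" "Cod D k = fob F Y" by (auto simp: Hom_def)
    \<comment> \<open>Conjugating \<open>far G k\<close> by \<eta> produces an arrow with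
      \<open>far G (far F a) = far G k\<close>; then \<open>G\<close> is cancelled.\<close>
    define a where "a = Comp C (ncmp \<eta>' Y) (Comp C (far G k) (ncmp \<eta> X))"
    have a: "a \<in> Arr C" "Dom C a = X" "Cod C a = Y" using X Y kA by (simp_all add: a_def)
    have "far G (far F a) = Comp C (far G (far F a)) (Comp C (ncmp \<eta> X) (ncmp \<eta>' X))"
      using X \<eta>'(5)[OF X] a by (simp add: F.source.Arr_Comp_Ident)
    also have "\<dots> = Comp C (Comp C (far G (far F a)) (ncmp \<eta> X)) (ncmp \<eta>' X)"
      using X a by (intro F.source.Arr_assoc) simp_all
    also have "Comp C (far G (far F a)) (ncmp \<eta> X) = Comp C (ncmp \<eta> Y) a"
      using \<eta>.naturality_Arr[of a] a by simp
    also have "\<dots> = Comp C (far G k) (ncmp \<eta> X)"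
      using X Y kA \<eta>'(5)[OF Y] by (simp add: a_def F.source.Arr_assoc F.source.Arr_Ident_Comp)
    also have "Comp C \<dots> (ncmp \<eta>' X) = Comp C (far G k) (Comp C (ncmp \<eta> X) (ncmp \<eta>' X))"
      using X kA by (intro F.source.Arr_assoc[symmetric]) simp_all
    also have "\<dots> = far G k" using X \<eta>'(5)[OF X] kA by (simp add: F.source.Arr_Comp_Ident)
    finally have "far F a = k" using G_faithful[of "far F a" "fob F X" "fob F Y" k] k a by (simp add: Hom_def)
    then show "\<exists>f\<in>Hom C X Y. far F f = k" using a by (auto simp: Hom_def)
  next
    fix Z assume Z: "Z \<in> Obj D"
    show "\<exists>X\<in>Obj C. \<exists>i\<in>Hom D (fob F X) Z. \<exists>j\<in>Hom D Z (fob F X).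
      Comp D i j = Ident D Z \<and> Comp D j i = Ident D (fob F X)"
      using Z \<epsilon>'(4,5)[OF Z]
      by (intro bexI[of _ "fob G Z"] bexI[of _ "ncmp \<epsilon> Z"] bexI[of _ "ncmp \<epsilon>' Z"]) (auto simp: Hom_def)
  qed (rule F_faithful)
  then show ?thesis by blast
qed

context equivalence begin

text \<open>A limit in \<open>D\<close> of the image diagram is isomorphic to some
  \<open>fob F L\<close>. Fullness lifts the legs and mediating arrows, and faithfulness lifts the
  equations.\<close>

lemma has_finite_limits_reflected:
  assumes "has_finite_limits D"
  shows "has_finite_limits C"
  unfolding has_finite_limits_def
proof (intro allI impI)
  fix J :: "(nat, nat) cat" and K assume K: "finite_diagram J C K"
  then interpret K: cat_functor J C K by (simp add: finite_diagram_def)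
  note [simp] = K.source.Dom_in K.source.Cod_in K.fob_in K.far_Arr far_Arr target.Comp_Arr source.Comp_Arr
  have "finite_diagram J D (ftor_comp J F K)"
    by (rule finite_diagram_ftor_comp[OF K]) unfold_locales
  then obtain L' p' where lim: "is_limit J D (ftor_comp J F K) L' p'"
    using assms unfolding has_finite_limits_def by blast
  have L': "L' \<in> Obj D" and p': "\<And>a. a \<in> Obj J \<Longrightarrow> p' a \<in> Arr D \<and> Dom D (p' a) = L' \<and> Cod D (p' a) = fob F (fob K a)"
    and p'J: "\<And>h. h \<in> Arr J \<Longrightarrow> Comp D (far F (far K h)) (p' (Dom J h)) = p' (Cod J h)"
    using lim by (auto simp: is_limit_def is_cone_def Hom_def)
  obtain L i j where L: "L \<in> Obj C" and i: "i \<in> Arr D" "Dom D i = fob F L" "Cod D i = L'"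
    and j: "j \<in> Arr D" "Dom D j = L'" "Cod D j = fob F L" 
    and ij: "Comp D i j = Ident D L'" "Comp D j i = Ident D (fob F L)"
    using essentially_surjective[OF L'] by (auto simp: Hom_def)
  have "\<exists>f\<in>Hom C L (fob K a). far F f = Comp D (p' a) i" if "a \<in> Obj J" for a
    using p'[OF that] i L that by (intro full) (auto simp: Hom_def)
  then obtain p where p0: "\<And>a. a \<in> Obj J \<Longrightarrow> p a \<in> Hom C L (fob K a)"
    "\<And>a. a \<in> Obj J \<Longrightarrow> far F (p a) = Comp D (p' a) i" by metis
  have p: "p a \<in> Arr C" "Dom C (p a) = L" "Cod C (p a) = fob K a" if "a \<in> Obj J" for a
    using p0[OF that] by (auto simp: Hom_def)
  have "is_limit J C K L p"
    unfolding is_limit_def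
  proof (intro conjI allI impI)
    show "is_cone J C K L p"
      unfolding is_cone_def
    proof (intro conjI ballI)
      fix h assume h: "h \<in> Arr J"
      have d: "Dom J h \<in> Obj J" "Cod J h \<in> Obj J" using h by auto
      show "Comp C (far K h) (p (Dom J h)) = p (Cod J h)"
      proof (rule faithful)
        have "far F (Comp C (far K h) (p (Dom J h))) = Comp D (Comp D (far F (far K h)) (p' (Dom J h))) i"
          using h p[OF d(1)] p0(2)[OF d(1)] p'[OF d(1)] i by (simp add: far_Comp_Arr target.Arr_assoc)
        then show "far F (Comp C (far K h) (p (Dom J h))) = far F (p (Cod J h))"
          using p0(2)[OF d(2)] p'J[OF h] by simp
      qed (use h p d in \<open>auto simp: Hom_def\<close>)
    qed (use L p0 in auto)
  next
    fix M q assume q: "is_cone J C K M q"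
    have M: "M \<in> Obj C" and qA: "\<And>a. a \<in> Obj J \<Longrightarrow> q a \<in> Arr C \<and> Dom C (q a) = M \<and> Cod C (q a) = fob K a"
      and qJ: "\<And>h. h \<in> Arr J \<Longrightarrow> Comp C (far K h) (q (Dom J h)) = q (Cod J h)"
      using q by (auto simp: is_cone_def Hom_def)
    have "is_cone J D (ftor_comp J F K) (fob F M) (\<lambda>a. far F (q a))"
      unfolding is_cone_def
      using M qA qJ fob_in by (auto simp: Hom_def far_Comp_Arr[symmetric])
    then obtain m' where m': "m' \<in> Hom D (fob F M) L'" "\<And>a. a \<in> Obj J \<Longrightarrow> Comp D (p' a) m' = far F (q a)"
      and u: "\<And>n. n \<in> Hom D (fob F M) L' \<Longrightarrow> \<forall>a\<in>Obj J. Comp D (p' a) n = far F (q a) \<Longrightarrow> n = m'"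
      using lim unfolding is_limit_def by metis
    have m'A: "m' \<in> Arr D" "Dom D m' = fob F M" "Cod D m' = L'" using m' by (auto simp: Hom_def)
    obtain m where m: "m \<in> Hom C M L" "far F m = Comp D j m'"
      using full[OF M L, of "Comp D j m'"] m'A j by (auto simp: Hom_def)
    have mA: "m \<in> Arr C" "Dom C m = M" "Cod C m = L" using m by (auto simp: Hom_def)
    show "\<exists>!m. m \<in> Hom C M L \<and> (\<forall>a\<in>Obj J. Comp C (p a) m = q a)"
    proof (rule ex1I[of _ m])
      have "Comp C (p a) m = q a" if a: "a \<in> Obj J" for a
      proof (rule faithful)
        have "far F (Comp C (p a) m) = Comp D (Comp D (p' a) i) (Comp D j m')"
          using p[OF a] mA m(2) p0(2)[OF a] by (simp add: far_Comp_Arr)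
        also have "\<dots> = Comp D (p' a) (Comp D i (Comp D j m'))"
          using p'[OF a] i j m'A by (intro target.Arr_assoc[symmetric]) auto
        also have "Comp D i (Comp D j m') = Comp D (Comp D i j) m'"
          using i j m'A by (intro target.Arr_assoc) auto
        also have "\<dots> = m'" using m'A ij by (simp add: target.Arr_Ident_Comp)
        finally show "far F (Comp C (p a) m) = far F (q a)" using m'(2)[OF a] by simp
      qed (use a p mA qA in \<open>auto simp: Hom_def\<close>)
      then show "m \<in> Hom C M L \<and> (\<forall>a\<in>Obj J. Comp C (p a) m = q a)" using m by blast
    next
      fix n assume n: "n \<in> Hom C M L \<and> (\<forall>a\<in>Obj J. Comp C (p a) n = q a)"
      then have nA: "n \<in> Arr C" "Dom C n = M" "Cod C n = L" by (auto simp: Hom_def)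
      \<comment> \<open>Uniqueness can be used only for arrows into \<open>L'\<close>, so
        \<open>far F n\<close> is first moved there along the isomorphism \<open>i\<close>.\<close>
      have "Comp D i (far F n) = m'"
      proof (rule u)
        show "\<forall>a\<in>Obj J. Comp D (p' a) (Comp D i (far F n)) = far F (q a)"
        proof
          fix a assume a: "a \<in> Obj J"
          have "Comp D (p' a) (Comp D i (far F n)) = Comp D (Comp D (p' a) i) (far F n)"
            using p'[OF a] i nA by (intro target.Arr_assoc) auto
          also have "\<dots> = far F (Comp C (p a) n)" using p[OF a] p0(2)[OF a] nA by (simp add: far_Comp_Arr)
          finally show "Comp D (p' a) (Comp D i (far F n)) = far F (q a)" using n a by simp
        qed
      qed (use i nA in \<open>auto simp: Hom_def\<close>)
      then have "Comp D j m' = Comp D (Comp D j i) (far F n)"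
        using i j nA target.Arr_assoc[of "far F n" i j] by simp
      then have "far F n = far F m" using ij nA m(2) by (simp add: target.Arr_Ident_Comp)
      then show "n = m" using faithful n m by blast
    qed
  qed
  then show "\<exists>L p. is_limit J C K L p" by blast
qed

text \<open>A test object \<open>Z\<close> of \<open>D\<close> is isomorphic to some
  \<open>fob F Y\<close>. Both test arrows, composed with that isomorphism, lift to
  \<open>C\<close>.\<close>

lemma jointly_epi_preserved:
  assumes epi: "jointly_epi C X R" and R: "R \<subseteq> {f \<in> Arr C. Cod C f = X}" and X: "X \<in> Obj C"
  shows "jointly_epi D (fob F X) (far F ` R)"
  unfolding jointly_epi_def
proof (intro ballI impI)
  fix Z a b assume Z: "Z \<in> Obj D" and a: "a \<in> Hom D (fob F X) Z" and b: "b \<in> Hom D (fob F X) Z"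
    and eq: "\<forall>f\<in>far F ` R. Comp D a f = Comp D b f"
  note [simp] = far_Arr target.Comp_Arr source.Comp_Arr
  obtain Y i j where Y: "Y \<in> Obj C" and i: "i \<in> Arr D" "Dom D i = fob F Y" "Cod D i = Z"
    and j: "j \<in> Arr D" "Dom D j = Z" "Cod D j = fob F Y" 
    and ij: "Comp D i j = Ident D Z" "Comp D j i = Ident D (fob F Y)"
    using essentially_surjective[OF Z] by (auto simp: Hom_def)
  have aA: "a \<in> Arr D" "Dom D a = fob F X" "Cod D a = Z" and bA: "b \<in> Arr D" "Dom D b = fob F X" "Cod D b = Z"
    using a b by (auto simp: Hom_def)
  obtain a' b' where a': "a' \<in> Hom C X Y" "far F a' = Comp D j a" and b': "b' \<in> Hom C X Y" "far F b' = Comp D j b"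
    using full[OF X Y, of "Comp D j a"] full[OF X Y, of "Comp D j b"] j aA bA by (auto simp: Hom_def)
  have "Comp C a' r = Comp C b' r" if r: "r \<in> R" for r
  proof (rule faithful)
    have rA: "r \<in> Arr C" "Cod C r = X" using r R by auto
    show "Comp C a' r \<in> Hom C (Dom C r) Y" "Comp C b' r \<in> Hom C (Dom C r) Y"
      using a' b' rA by (auto simp: Hom_def)
    have "far F (Comp C a' r) = Comp D j (Comp D a (far F r))" "far F (Comp C b' r) = Comp D j (Comp D b (far F r))"
      using a' b' rA aA bA j by (auto simp: Hom_def far_Comp_Arr target.Arr_assoc)
    then show "far F (Comp C a' r) = far F (Comp C b' r)" using eq r by simp
  qed
  then have "a' = b'" using epi a' b' Y unfolding jointly_epi_def by blast
  then have "Comp D i (Comp D j a) = Comp D i (Comp D j b)" using a' b' by simp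
  then show "a = b" using i j aA bA ij by (simp add: target.Arr_assoc target.Arr_Ident_Comp)
qed

text \<open>The image of a sieve under \<open>F\<close> is only a family, so stability in
  \<open>D\<close> is used for the sieve it generates. Members of the pulled back sieve in
  \<open>D\<close> have arbitrary domains; up to isomorphism they come from
  \<open>C\<close>.\<close>

lemma jointly_epi_stable_reflected:
  assumes stable: "\<And>X Y R f. \<lbrakk>sieve D X R; jointly_epi D X R; f \<in> Hom D Y X\<rbrakk> \<Longrightarrow> jointly_epi D Y (pullback_sieve D f R)"
    and R: "sieve C X R" "jointly_epi C X R" and f: "f \<in> Hom C Y X"
  shows "jointly_epi C Y (pullback_sieve C f R)"
  unfolding jointly_epi_def
proof (intro ballI impI)
  fix W a b assume W: "W \<in> Obj C" and a: "a \<in> Hom C Y W" and b: "b \<in> Hom C Y W"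
    and eq: "\<forall>g\<in>pullback_sieve C f R. Comp C a g = Comp C b g"
  note [simp] = far_Arr target.Comp_Arr source.Comp_Arr
  have RA: "R \<subseteq> {f \<in> Arr C. Cod C f = X}" and X: "X \<in> Obj C" using R by (auto simp: sieve_def)
  have fA: "f \<in> Arr C" "Dom C f = Y" "Cod C f = X" using f by (auto simp: Hom_def)
  have Y: "Y \<in> Obj C" using fA source.Dom_in by auto
  have aA: "a \<in> Arr C" "Dom C a = Y" "Cod C a = W" and bA: "b \<in> Arr C" "Dom C b = Y" "Cod C b = W"
    using a b by (auto simp: Hom_def)
  define R' where "R' = generated_sieve D (far F ` R)"
  have FR: "far F ` R \<subseteq> {f \<in> Arr D. Cod D f = fob F X}" using RA by auto
  have R': "sieve D (fob F X) R'" "jointly_epi D (fob F X) R'"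
    unfolding R'_def
    using target.sieve_generated[OF fob_in[OF X] FR] target.jointly_epi_generated[OF FR]
      jointly_epi_preserved[OF R(2) RA X] by auto
  have Ff: "far F f \<in> Hom D (fob F Y) (fob F X)" using f by (rule far_in)
  have "Comp D (far F a) k = Comp D (far F b) k" if k: "k \<in> pullback_sieve D (far F f) R'" for k
  proof -
    have kA: "k \<in> Arr D" "Cod D k = fob F Y" using k fA by (auto simp: pullback_sieve_def)
    obtain r h where r: "r \<in> R" "h \<in> Arr D" "Cod D h = Dom D (far F r)" "Comp D (far F f) k = Comp D (far F r) h"
      using k by (auto simp: pullback_sieve_def R'_def generated_sieve_def)
    have rA: "r \<in> Arr C" "Cod C r = X" using r RA by auto
    have "Dom D (Comp D (far F f) k) = Dom D k" "Dom D (Comp D (far F r) h) = Dom D h"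
      using r(2,3) kA rA fA by simp_all
    then have hk: "Dom D h = Dom D k" using r(4) by simp
    \<comment> \<open>Precomposing \<open>k\<close> and \<open>h\<close> with \<open>i\<close> gives
      them the domain \<open>fob F Z\<close>, so that fullness can lift both.\<close>
    obtain Z i j where Z: "Z \<in> Obj C" and i: "i \<in> Arr D" "Dom D i = fob F Z" "Cod D i = Dom D k"
      and j: "j \<in> Arr D" "Dom D j = Dom D k" "Cod D j = fob F Z" and ij: "Comp D i j = Ident D (Dom D k)"
      using essentially_surjective[OF target.Dom_in[OF kA(1)]] by (auto simp: Hom_def)
    obtain k' where k': "k' \<in> Hom C Z Y" "far F k' = Comp D k i"
      using full[OF Z Y, of "Comp D k i"] kA i by (auto simp: Hom_def)
    obtain h' where h': "h' \<in> Hom C Z (Dom C r)" "far F h' = Comp D h i"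
      using full[OF Z source.Dom_in[OF rA(1)], of "Comp D h i"] r hk rA i by (auto simp: Hom_def)
    have kA': "k' \<in> Arr C" "Dom C k' = Z" "Cod C k' = Y" and hA': "h' \<in> Arr C" "Dom C h' = Z" "Cod C h' = Dom C r"
      using k' h' by (auto simp: Hom_def)
    have "Comp C f k' = Comp C r h'"
    proof (rule faithful)
      have "far F (Comp C f k') = Comp D (Comp D (far F f) k) i"
        using fA kA' k'(2) kA i by (simp add: far_Comp_Arr target.Arr_assoc)
      also have "\<dots> = far F (Comp C r h')"
        using rA hA' h'(2) r i hk by (simp add: far_Comp_Arr target.Arr_assoc)
      finally show "far F (Comp C f k') = far F (Comp C r h')" .
    qed (use fA kA' rA hA' in \<open>auto simp: Hom_def\<close>)
    moreover have "Comp C r h' \<in> R" using R(1) r(1) hA' by (simp add: sieve_def)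
    ultimately have "k' \<in> pullback_sieve C f R" using kA' fA by (simp add: pullback_sieve_def)
    then have "far F (Comp C a k') = far F (Comp C b k')" using eq by simp
    then have "Comp D (Comp D (far F a) k) i = Comp D (Comp D (far F b) k) i"
      using aA bA kA' k'(2) kA i by (simp add: far_Comp_Arr target.Arr_assoc)
    \<comment> \<open>Composing with the right inverse \<open>j\<close> cancels \<open>i\<close>
      again.\<close>
    then have "Comp D (Comp D (Comp D (far F a) k) i) j = Comp D (Comp D (Comp D (far F b) k) i) j" by simp
    then show ?thesis using aA bA kA i j ij
      by (simp add: target.Arr_assoc[symmetric] target.Arr_Comp_Ident)
  qed
  moreover have "jointly_epi D (fob F Y) (pullback_sieve D (far F f) R')" by (rule stable[OF R' Ff])
  ultimately have "far F a = far F b" using far_in[OF a] far_in[OF b] fob_in[OF W] unfolding jointly_epi_def by blast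
  then show "a = b" using faithful a b by blast
qed

text \<open>Each generator of \<open>D\<close> is replaced by an object of \<open>C\<close> whose
  image is isomorphic to it. Arrows from the old generators become images of arrows from the new
  ones after precomposition with a split epimorphism.\<close>

lemma small_generators_reflected:
  assumes "small U S" "S \<subseteq> Obj D"
    "\<And>Z. Z \<in> Obj D \<Longrightarrow> jointly_epi D Z {f \<in> Arr D. Dom D f \<in> S \<and> Cod D f = Z}"
  shows "\<exists>S. small U S \<and> S \<subseteq> Obj C \<and> (\<forall>X\<in>Obj C. jointly_epi C X {f \<in> Arr C. Dom C f \<in> S \<and> Cod C f = X})"
proof -
  note [simp] = far_Arr target.Comp_Arr source.Comp_Arr
  have "\<exists>X\<in>Obj C. \<exists>i\<in>Hom D (fob F X) Z. \<exists>j\<in>Hom D Z (fob F X). Comp D i j = Ident D Z" if "Z \<in> S" for Z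
    using essentially_surjective[of Z] that assms(2) by blast
  then obtain r where r: "\<And>Z. Z \<in> S \<Longrightarrow> r Z \<in> Obj C"
    "\<And>Z. Z \<in> S \<Longrightarrow> \<exists>i\<in>Hom D (fob F (r Z)) Z. \<exists>j\<in>Hom D Z (fob F (r Z)). Comp D i j = Ident D Z" by metis
  have "jointly_epi C X {f \<in> Arr C. Dom C f \<in> r ` S \<and> Cod C f = X}" if X: "X \<in> Obj C" for X
    unfolding jointly_epi_def
  proof (intro ballI impI)
    fix W a b assume W: "W \<in> Obj C" and a: "a \<in> Hom C X W" and b: "b \<in> Hom C X W"
      and eq: "\<forall>f\<in>{f \<in> Arr C. Dom C f \<in> r ` S \<and> Cod C f = X}. Comp C a f = Comp C b f"
    have aA: "a \<in> Arr C" "Dom C a = X" "Cod C a = W" and bA: "b \<in> Arr C" "Dom C b = X" "Cod C b = W"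
      using a b by (auto simp: Hom_def)
    have "Comp D (far F a) k = Comp D (far F b) k" if k: "k \<in> Arr D" "Dom D k \<in> S" "Cod D k = fob F X" for k
    proof -
      obtain i j where i: "i \<in> Arr D" "Dom D i = fob F (r (Dom D k))" "Cod D i = Dom D k"
        and j: "j \<in> Arr D" "Dom D j = Dom D k" "Cod D j = fob F (r (Dom D k))"
        and ij: "Comp D i j = Ident D (Dom D k)"
        using r(2)[OF k(2)] by (auto simp: Hom_def)
      obtain k' where k': "k' \<in> Hom C (r (Dom D k)) X" "far F k' = Comp D k i"
        using full[OF r(1)[OF k(2)] X, of "Comp D k i"] k i by (auto simp: Hom_def)
      then have kA': "k' \<in> Arr C" "Dom C k' = r (Dom D k)" "Cod C k' = X" by (auto simp: Hom_def)
      then have "far F (Comp C a k') = far F (Comp C b k')" using eq k(2) by simp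
      then have "Comp D (Comp D (far F a) k) i = Comp D (Comp D (far F b) k) i"
        using aA bA kA' k'(2) k i by (simp add: far_Comp_Arr target.Arr_assoc)
      then have "Comp D (Comp D (Comp D (far F a) k) i) j = Comp D (Comp D (Comp D (far F b) k) i) j" by simp
      then show ?thesis using aA bA k i j ij
        by (simp add: target.Arr_assoc[symmetric] target.Arr_Comp_Ident)
    qed
    then have "far F a = far F b"
      using assms(3)[OF fob_in[OF X]] far_in[OF a] far_in[OF b] fob_in[OF W] unfolding jointly_epi_def by blast
    then show "a = b" using faithful a b by blast
  qed
  then show ?thesis using r(1) small_image[OF assms(1), of r] by (intro exI[of _ "r ` S"]) auto
qed

end

section \<open>The properties of topoi that the construction relies on\<close>

locale topos_category = universe_set U + category E for U :: "'u set" and E :: "('o, 'a) cat" +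
  assumes Hom_small: "\<lbrakk>X \<in> Obj E; Y \<in> Obj E\<rbrakk> \<Longrightarrow> small U (Hom E X Y)"
    and E_finite_limits: "has_finite_limits E"
    and jointly_epi_stable: "\<lbrakk>sieve E X R; jointly_epi E X R; f \<in> Hom E Y X\<rbrakk>
      \<Longrightarrow> jointly_epi E Y (pullback_sieve E f R)"
    and E_small_generators: "\<exists>S. small U S \<and> S \<subseteq> Obj E \<and>
      (\<forall>X\<in>Obj E. jointly_epi E X {f \<in> Arr E. Dom E f \<in> S \<and> Cod E f = X})"

lemma topos_category_if_topos:
  assumes "universe U" "topos U E"
  shows "topos_category U E"
proof -
  obtain T :: "('a, 'a) site" where T: "site U T" "equivalent_cats E (Sh U T)"
    using assms(2) unfolding topos_def by blast
  interpret T: site U T by fact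
  obtain G where G: "small U G" "topological_generators T G" using T.small_generators by blast
  interpret generated_site U T G
    by unfold_locales (use assms G in auto)
  obtain F where "equivalence E (Sh U T) F" using equivalent_cats_equivalence[OF T(2)] by blast
  then interpret F: equivalence E "Sh U T" F .
  show ?thesis
  proof
    fix X Y assume X: "X \<in> Obj E" and Y: "Y \<in> Obj E"
    have "small U (Hom (Sh U T) (fob F X) (fob F Y))"
      using F.fob_in X Y by (intro Sh_locally_small) (auto simp: Obj_Sh)
    moreover have "inj_on (far F) (Hom E X Y)" by (intro inj_onI F.faithful)
    moreover have "far F ` Hom E X Y \<subseteq> Hom (Sh U T) (fob F X) (fob F Y)" using F.far_in by blast
    ultimately show "small U (Hom E X Y)" by (intro small_inj_into[of "far F"])
  next
    show "has_finite_limits E" by (rule F.has_finite_limits_reflected[OF Sh_has_finite_limits])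
  next
    fix X R f Y assume "sieve E X R" "jointly_epi E X R" "f \<in> Hom E Y X"
    then show "jointly_epi E Y (pullback_sieve E f R)"
      by - (rule F.jointly_epi_stable_reflected; (rule Sh_jointly_epi_stable; assumption | assumption))
  next
    show "\<exists>S. small U S \<and> S \<subseteq> Obj E \<and>
      (\<forall>X\<in>Obj E. jointly_epi E X {f \<in> Arr E. Dom E f \<in> S \<and> Cod E f = X})"
      using Sh_small_generators F.small_generators_reflected by fast
  qed
qed

section \<open>Small generating subcategories as sites\<close>

lemma (in category) generated_sieve_full_subcat_subset:
  "generated_sieve (full_subcat C S) \<Phi> \<subseteq> generated_sieve C \<Phi>"
  by (auto simp: generated_sieve_def)

text \<open>The sieve that \<Phi> generates in the subcategory lies between \<Phi> and the sieve it
  generates in \<open>C\<close>. The two extremes are jointly epimorphic together, and the property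
  is monotone.\<close>

lemma (in category) covering_family_canonical_site_on:
  assumes "S \<subseteq> Obj C"
  shows "covering_family (canonical_site_on C S) X \<Phi> \<longleftrightarrow>
    X \<in> S \<and> \<Phi> \<subseteq> {f \<in> Arr C. Dom C f \<in> S \<and> Cod C f = X} \<and> jointly_epi C X \<Phi>" (is "?L \<longleftrightarrow> ?R")
proof -
  interpret s: category "full_subcat C S" by (rule category_full_subcat) unfold_locales
  show ?thesis
  proof
    assume ?L
    then have X: "X \<in> S" and \<Phi>: "\<Phi> \<subseteq> {f \<in> Arr C. Dom C f \<in> S \<and> Cod C f = X}"
      and epi: "jointly_epi C X (generated_sieve (full_subcat C S) \<Phi>)"
      by (auto simp: covering_family_def canonical_site_on_def)
    then show ?R using jointly_epi_generated[of \<Phi> X] jointly_epi_mono[OF epi generated_sieve_full_subcat_subset] by auto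
  next
    assume R: ?R
    then have \<Phi>: "X \<in> Obj (full_subcat C S)" "\<Phi> \<subseteq> {f \<in> Arr (full_subcat C S). Cod (full_subcat C S) f = X}"
      using assms by auto
    show ?L
      using s.sieve_generated[OF \<Phi>] jointly_epi_mono[of C X \<Phi>] R \<Phi>
      by (simp add: covering_family_def canonical_site_on_def)
  qed
qed

section \<open>Limits in full subcategories\<close>

lemma cat_functor_into_full_subcat:
  assumes "cat_functor J (full_subcat C S) K" "category C"
  shows "cat_functor J C K" "fob K ` Obj J \<subseteq> S"
proof -
  interpret K: cat_functor J "full_subcat C S" K by fact
  interpret category C by fact
  show "cat_functor J C K"
    using K.fob_ext K.far_ext K.fob_in K.far_in K.far_Ident K.far_Comp
    by unfold_locales (auto simp: Hom_full_subcat)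
  show "fob K ` Obj J \<subseteq> S" using K.fob_in by auto
qed

lemma finite_diagram_full_subcat:
  assumes "finite_diagram J (full_subcat C S) K" "category C"
  shows "finite_diagram J C K" "fob K ` Obj J \<subseteq> S"
  using assms cat_functor_into_full_subcat[of J C S K] by (auto simp: finite_diagram_def)

lemma is_cone_full_subcat:
  assumes "fob K ` Obj J \<subseteq> S"
  shows "is_cone J (full_subcat C S) K M q \<longleftrightarrow> is_cone J C K M q \<and> M \<in> S"
  using assms by (auto simp: is_cone_def Hom_full_subcat)

lemma is_limit_full_subcatI:
  assumes "is_limit J C K L p" "fob K ` Obj J \<subseteq> S" "L \<in> S"
  shows "is_limit J (full_subcat C S) K L p"
  using assms unfolding is_limit_def is_cone_full_subcat[OF assms(2)] by (auto simp: Hom_full_subcat)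

lemma is_limitD:
  assumes "is_limit J C K L p" "is_cone J C K M q"
  shows "\<exists>m\<in>Hom C M L. \<forall>i\<in>Obj J. Comp C (p i) m = q i"
    and "\<lbrakk>m \<in> Hom C M L; n \<in> Hom C M L; \<And>i. i \<in> Obj J \<Longrightarrow> Comp C (p i) m = q i;
      \<And>i. i \<in> Obj J \<Longrightarrow> Comp C (p i) n = q i\<rbrakk> \<Longrightarrow> m = n"
proof -
  have "\<exists>!m. m \<in> Hom C M L \<and> (\<forall>i\<in>Obj J. Comp C (p i) m = q i)"
    using assms unfolding is_limit_def by blast
  then show "\<exists>m\<in>Hom C M L. \<forall>i\<in>Obj J. Comp C (p i) m = q i"
    and "\<lbrakk>m \<in> Hom C M L; n \<in> Hom C M L; \<And>i. i \<in> Obj J \<Longrightarrow> Comp C (p i) m = q i;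
      \<And>i. i \<in> Obj J \<Longrightarrow> Comp C (p i) n = q i\<rbrakk> \<Longrightarrow> m = n"
    by blast+
qed

context category begin

text \<open>Exactness of a restricted functor concerns every limit cone of the subcategory,
  including those that have nothing to do with the limits chosen in the closure.\<close>

lemma is_limit_if_full_subcat:
  assumes closed: "closed_under_finite_limits C S" and K: "finite_diagram J (full_subcat C S) K"
    and lim: "is_limit J (full_subcat C S) K L p"
  shows "is_limit J C K L p"
proof -
  interpret K: cat_functor J "full_subcat C S" K using K by (simp add: finite_diagram_def)
  note KC = finite_diagram_full_subcat[OF K category_axioms]
  obtain L0 p0 where L0S: "L0 \<in> S" and lim0: "is_limit J C K L0 p0"
    using closed KC unfolding closed_under_finite_limits_def by blast
  have cone: "is_cone J C K L p" "L \<in> S" and cone0: "is_cone J C K L0 p0"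
    using lim lim0 is_cone_full_subcat[OF KC(2)] by (auto simp: is_limit_def)
  have pA: "p a \<in> Hom C L (fob K a)" and p0A: "p0 a \<in> Hom C L0 (fob K a)" if "a \<in> Obj J" for a
    using cone cone0 that by (auto simp: is_cone_def)
  have LO: "L \<in> Obj C" "L0 \<in> Obj C" using cone cone0 by (auto simp: is_cone_def)
  have fcone: "is_cone J (full_subcat C S) K L p" "is_cone J (full_subcat C S) K L0 p0"
    using cone cone0 L0S by (simp_all add: is_cone_full_subcat[OF KC(2)])
  obtain i where i: "i \<in> Hom C L L0" "\<And>a. a \<in> Obj J \<Longrightarrow> Comp C (p0 a) i = p a"
    using is_limitD(1)[OF lim0 cone(1)] by blast
  obtain j where j: "j \<in> Hom C L0 L" "\<And>a. a \<in> Obj J \<Longrightarrow> Comp C (p a) j = p0 a"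
    using is_limitD(1)[OF lim fcone(2)] by (auto simp: Hom_full_subcat)
  \<comment> \<open>Uniqueness is tested inside the subcategory, where \<open>L\<close> is a limit.
    This one identity suffices later: a mediating arrow \<open>n\<close> satisfies
    \<open>n = j i n = j m0\<close>.\<close>
  have ji: "Comp C j i = Ident C L"
  proof (rule is_limitD(2)[OF lim fcone(1)])
    fix a assume a: "a \<in> Obj J"
    show "Comp (full_subcat C S) (p a) (Comp C j i) = p a"
      using Comp_assoc[OF i(1) j(1) pA[OF a]] i(2)[OF a] j(2)[OF a] by simp
    show "Comp (full_subcat C S) (p a) (Ident C L) = p a"
      using Comp_Ident[OF pA[OF a]] by simp
  qed (use Comp_in[OF i(1) j(1)] Ident_in[OF LO(1)] cone(2) in \<open>auto simp: Hom_full_subcat\<close>)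
  show ?thesis
    unfolding is_limit_def
  proof (intro conjI allI impI)
    fix M q assume q: "is_cone J C K M q"
    obtain m0 where m0: "m0 \<in> Hom C M L0" "\<And>a. a \<in> Obj J \<Longrightarrow> Comp C (p0 a) m0 = q a"
      using is_limitD(1)[OF lim0 q] by blast
    show "\<exists>!m. m \<in> Hom C M L \<and> (\<forall>a\<in>Obj J. Comp C (p a) m = q a)"
    proof (rule ex1I[of _ "Comp C j m0"])
      show "Comp C j m0 \<in> Hom C M L \<and> (\<forall>a\<in>Obj J. Comp C (p a) (Comp C j m0) = q a)"
        using Comp_in[OF m0(1) j(1)] Comp_assoc[OF m0(1) j(1) pA] j(2) m0(2) by simp
    next
      fix n assume n: "n \<in> Hom C M L \<and> (\<forall>a\<in>Obj J. Comp C (p a) n = q a)"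
      then have "Comp C i n = m0"
        using Comp_assoc[OF conjunct1[OF n] i(1) p0A] i(2) m0
        by (intro is_limitD(2)[OF lim0 q Comp_in[OF conjunct1[OF n] i(1)] m0(1)]) auto
      then show "n = Comp C j m0"
        using Comp_assoc[OF conjunct1[OF n] i(1) j(1)] ji Ident_Comp[OF conjunct1[OF n]] by simp
    qed
  qed (rule cone)
qed

end

text \<open>\<open>generating\<close> asks for some covering family with domains in
  \<open>S\<close>. Taking all arrows from \<open>S\<close> instead gives a condition that is
  visibly monotone in \<open>S\<close>, as the closure process requires.\<close>

definition generates :: "('o, 'a) cat \<Rightarrow> 'o set \<Rightarrow> bool" where
  "generates E S \<longleftrightarrow> (\<forall>X \<in> Obj E. jointly_epi E X {f \<in> Arr E. Dom E f \<in> S \<and> Cod E f = X})"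

lemma generates_mono: "generates E S \<Longrightarrow> S \<subseteq> S' \<Longrightarrow> generates E S'"
  unfolding generates_def
proof
  fix X assume "\<forall>X\<in>Obj E. jointly_epi E X {f \<in> Arr E. Dom E f \<in> S \<and> Cod E f = X}" "X \<in> Obj E" and S: "S \<subseteq> S'"
  then have "jointly_epi E X {f \<in> Arr E. Dom E f \<in> S \<and> Cod E f = X}" by blast
  then show "jointly_epi E X {f \<in> Arr E. Dom E f \<in> S' \<and> Cod E f = X}"
    by (rule jointly_epi_mono) (use S in blast)
qed

lemma (in category) generating_if_generates:
  assumes "S \<subseteq> Obj C" "generates C S"
  shows "generating C S"
  unfolding generating_def topological_generators_def
proof (intro conjI ballI)
  fix X assume "X \<in> Obj (ucat (canonical_site_on C (Obj C)))"
  then have X: "X \<in> Obj C" by (simp add: canonical_site_on_def)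
  let ?\<Phi> = "{f \<in> Arr C. Dom C f \<in> S \<and> Cod C f = X}"
  have "covering_family (canonical_site_on C (Obj C)) X ?\<Phi>"
    using X assms covering_family_canonical_site_on[of "Obj C" X ?\<Phi>] by (auto simp: generates_def)
  then show "\<exists>\<Phi>. covering_family (canonical_site_on C (Obj C)) X \<Phi> \<and>
      (\<forall>f\<in>\<Phi>. Dom (ucat (canonical_site_on C (Obj C))) f \<in> S)"
    by (intro exI[of _ ?\<Phi>]) (auto simp: canonical_site_on_def)
qed (use assms in \<open>auto simp: canonical_site_on_def\<close>)

context topos_category begin

lemma small_Arr_full_subcat:
  assumes "S \<subseteq> Obj E" "small U S"
  shows "small U (Arr (full_subcat E S))"
proof (rule small_mono)
  show "small U (\<Union>X\<in>S. \<Union>Y\<in>S. Hom E X Y)"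
    using assms by (intro small_UN Hom_small) auto
qed (auto simp: Hom_def)

lemma site_canonical_site_on:
  assumes S: "S \<subseteq> Obj E" "small U S" and gen: "generates E S" and closed: "closed_under_finite_limits E S"
  shows "site U (canonical_site_on E S)"
proof -
  let ?T = "canonical_site_on E S" and ?C = "full_subcat E S"
  interpret C: category ?C by (rule category_full_subcat) unfold_locales
  have T [simp]: "ucat ?T = ?C" by (simp add: canonical_site_on_def)
  have cov: "R \<in> cov ?T X \<longleftrightarrow> sieve ?C X R \<and> jointly_epi E X R" for X R
    by (simp add: canonical_site_on_def)
  show ?thesis
  proof (intro site.intro grothendieck_topology.intro grothendieck_topology_axioms.intro site_axioms.intro, unfold T)
    show "category ?C" by (rule C.category_axioms)
  next
    fix X R assume "X \<in> Obj ?C" "R \<in> cov ?T X"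
    then show "sieve ?C X R" by (simp add: cov)
  next
    fix X assume X: "X \<in> Obj ?C"
    have "jointly_epi E X {f \<in> Arr ?C. Cod ?C f = X}"
      unfolding jointly_epi_def
    proof (intro ballI impI)
      fix Y a b assume ab: "a \<in> Hom E X Y" "b \<in> Hom E X Y"
        and "\<forall>f\<in>{f \<in> Arr ?C. Cod ?C f = X}. Comp E a f = Comp E b f"
      then have "Comp E a (Ident E X) = Comp E b (Ident E X)" using X Ident_Arr[of X] by auto
      then show "a = b" using ab by (simp add: Comp_Ident)
    qed
    then show "{f \<in> Arr ?C. Cod ?C f = X} \<in> cov ?T X"
      using X by (auto simp: cov sieve_def Comp_Arr)
  next
    fix f Y X R assume f: "f \<in> Hom ?C Y X" and R: "R \<in> cov ?T X"
    have fE: "f \<in> Hom E Y X" "X \<in> S" "Y \<in> S" using f by (auto simp: Hom_full_subcat)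
    have fA: "f \<in> Arr E" "Dom E f = Y" "Cod E f = X" using fE by (auto simp: Hom_def)
    have XY: "X \<in> Obj E" "Y \<in> Obj E" using fE S by auto
    have sR: "sieve ?C X R" and eR: "jointly_epi E X R" using R by (auto simp: cov)
    have RA: "R \<subseteq> {f \<in> Arr E. Cod E f = X}" "\<And>r. r \<in> R \<Longrightarrow> Dom E r \<in> S"
      using sR by (auto simp: sieve_def)
    \<comment> \<open>Stability is available in \<open>E\<close> only, hence for the sieve that
      \<open>R\<close> generates there.\<close>
    have st: "jointly_epi E Y (pullback_sieve E f (generated_sieve E R))"
      using jointly_epi_stable[OF _ _ fE(1)] sieve_generated[OF XY(1) RA(1)] jointly_epi_generated[OF RA(1)] eR by blast
    have "jointly_epi E Y (pullback_sieve ?C f R)"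
      unfolding jointly_epi_def
    proof (intro ballI impI)
      fix W a b assume W: "W \<in> Obj E" and a: "a \<in> Hom E Y W" and b: "b \<in> Hom E Y W"
        and eq: "\<forall>g\<in>pullback_sieve ?C f R. Comp E a g = Comp E b g"
      have aA: "a \<in> Arr E" "Dom E a = Y" "Cod E a = W" and bA: "b \<in> Arr E" "Dom E b = Y" "Cod E b = W"
        using a b by (auto simp: Hom_def)
      have "Comp E a g = Comp E b g" if g: "g \<in> pullback_sieve E f (generated_sieve E R)" for g
      proof -
        have gA: "g \<in> Arr E" "Cod E g = Y" using g fA by (auto simp: pullback_sieve_def)
        obtain r h where r: "r \<in> R" "h \<in> Arr E" "Cod E h = Dom E r" "Comp E f g = Comp E r h"
          using g by (auto simp: pullback_sieve_def generated_sieve_def)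
        have rA: "r \<in> Arr E" "Cod E r = X" using r RA by auto
        have "Dom E (Comp E f g) = Dom E g" "Dom E (Comp E r h) = Dom E h"
          using r(2,3) rA gA fA by (simp_all add: Comp_Arr)
        then have hg: "Dom E h = Dom E g" using r(4) by simp
        have Z: "Dom E g \<in> Obj E" using gA Dom_in by simp
        \<comment> \<open>The domain of \<open>g\<close> need not be in \<open>S\<close>. Composed
          with an arrow \<open>z\<close> from an object of \<open>S\<close>, it falls into the
          pullback taken in the subcategory, where \<open>a\<close> and \<open>b\<close> agree; such
          \<open>z\<close> are jointly epimorphic.\<close>
        have agree: "Comp E (Comp E a g) z = Comp E (Comp E b g) z"
          if z: "z \<in> Arr E" "Dom E z \<in> S" "Cod E z = Dom E g" for z
        proof -
          have "Comp E f (Comp E g z) = Comp E r (Comp E h z)"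
            using fA gA z rA r hg by (simp add: Arr_assoc)
          moreover have "Comp E r (Comp E h z) \<in> R"
            using sR r z hg RA(2)[OF r(1)] by (auto simp: sieve_def Comp_Arr)
          ultimately have "Comp E g z \<in> pullback_sieve ?C f R"
            using fA gA z fE by (auto simp: pullback_sieve_def Comp_Arr)
          then show ?thesis using eq aA bA gA z by (simp add: Arr_assoc[symmetric])
        qed
        have H: "Comp E a g \<in> Hom E (Dom E g) W" "Comp E b g \<in> Hom E (Dom E g) W"
          using aA bA gA by (auto simp: Hom_def Comp_Arr)
        have "jointly_epi E (Dom E g) {z \<in> Arr E. Dom E z \<in> S \<and> Cod E z = Dom E g}"
          using gen Z by (simp add: generates_def)
        then show ?thesis using W H agree unfolding jointly_epi_def by blast
      qed
      then show "a = b" using st W a b unfolding jointly_epi_def by blast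
    qed
    moreover have "sieve ?C Y (pullback_sieve ?C f R)"
      unfolding sieve_def
    proof (intro conjI ballI impI)
      fix g h assume g: "g \<in> pullback_sieve ?C f R" and h: "h \<in> Arr ?C" "Cod ?C h = Dom ?C g"
      then have "Comp E f (Comp E g h) = Comp E (Comp E f g) h" "Comp E f g \<in> R" "Dom E (Comp E f g) = Dom E g"
        using fA by (auto simp: pullback_sieve_def Arr_assoc Comp_Arr)
      then show "Comp ?C g h \<in> pullback_sieve ?C f R"
        using g h sR by (auto simp: pullback_sieve_def Comp_Arr sieve_def)
    qed (use fE XY fA in \<open>auto simp: pullback_sieve_def\<close>)
    ultimately show "pullback_sieve ?C f R \<in> cov ?T Y" by (simp add: cov)
  next
    fix X R R' assume X: "X \<in> Obj ?C" and R: "R \<in> cov ?T X" and R': "sieve ?C X R'"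
      and loc: "\<And>f. f \<in> R \<Longrightarrow> pullback_sieve ?C f R' \<in> cov ?T (Dom ?C f)"
    have "jointly_epi E X R'"
      unfolding jointly_epi_def
    proof (intro ballI impI)
      fix W a b assume W: "W \<in> Obj E" and a: "a \<in> Hom E X W" and b: "b \<in> Hom E X W"
        and eq: "\<forall>g\<in>R'. Comp E a g = Comp E b g"
      have aA: "a \<in> Arr E" "Dom E a = X" "Cod E a = W" and bA: "b \<in> Arr E" "Dom E b = X" "Cod E b = W"
        using a b by (auto simp: Hom_def)
      have "Comp E a f = Comp E b f" if f: "f \<in> R" for f
      proof -
        have fA: "f \<in> Arr E" "Cod E f = X" using f R by (auto simp: cov sieve_def)
        have "Comp E (Comp E a f) g = Comp E (Comp E b f) g" if "g \<in> pullback_sieve ?C f R'" for g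
          using that eq aA bA fA by (auto simp: pullback_sieve_def Arr_assoc[symmetric])
        moreover have "jointly_epi E (Dom E f) (pullback_sieve ?C f R')" using loc[OF f] by (simp add: cov)
        moreover have "Comp E a f \<in> Hom E (Dom E f) W" "Comp E b f \<in> Hom E (Dom E f) W"
          using aA bA fA by (auto simp: Hom_def Comp_Arr)
        ultimately show ?thesis using W unfolding jointly_epi_def by blast
      qed
      then show "a = b" using R W a b unfolding cov jointly_epi_def by blast
    qed
    then show "R' \<in> cov ?T X" using R' by (simp add: cov)
  next
    fix X Y assume "X \<in> Obj ?C" "Y \<in> Obj ?C"
    then show "small U (Hom ?C X Y)" by (intro small_mono[OF Hom_small[of X Y]]) (auto simp: Hom_full_subcat)
  next
    show "has_finite_limits ?C"
      unfolding has_finite_limits_def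
    proof (intro allI impI)
      fix J :: "(nat, nat) cat" and K assume K: "finite_diagram J ?C K"
      note KE = finite_diagram_full_subcat[OF K category_axioms]
      obtain L p where "L \<in> S" "is_limit J E K L p"
        using closed KE unfolding closed_under_finite_limits_def by blast
      then show "\<exists>L p. is_limit J ?C K L p" by (intro exI is_limit_full_subcatI KE(2))
    qed
  next
    have "topological_generators ?T S"
      unfolding topological_generators_def
    proof (intro conjI ballI)
      fix X assume "X \<in> Obj (ucat ?T)"
      then have X: "X \<in> S" "X \<in> Obj E" by auto
      then have "covering_family ?T X {f \<in> Arr E. Dom E f \<in> S \<and> Cod E f = X}"
        using gen covering_family_canonical_site_on[OF S(1), of X] by (simp add: generates_def)
      then show "\<exists>\<Phi>. covering_family ?T X \<Phi> \<and> (\<forall>f\<in>\<Phi>. Dom (ucat ?T) f \<in> S)" by fastforce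
    qed (use S in auto)
    then show "\<exists>G. small U G \<and> topological_generators ?T G" using S by blast
  qed
qed

end

subsection \<open>Closure under finite limits and functors\<close>

definition finite_diagrams_in :: "('o, 'a) cat \<Rightarrow> 'o set \<Rightarrow> ((nat, nat) cat \<times> (nat, nat, 'o, 'a) ftor) set" where
  "finite_diagrams_in E S = {(J, K). finite_diagram J E K \<and> fob K ` Obj J \<subseteq> S}"

text \<open>For a fixed shape, extensionality reduces a diagram to its values on objects and arrows,
  and these lie in the full subcategory on \<open>S\<close>, which is small by local smallness. The
  shapes themselves are counted by \<open>small_nat_cats\<close>.\<close>

lemma (in topos_category) small_finite_diagrams_in:
  assumes S: "S \<subseteq> Obj E" "small U S"
  shows "small U (finite_diagrams_in E S)"
proof (rule small_mono)
  let ?fob = "\<lambda>J :: (nat, nat) cat. Obj J \<rightarrow>\<^sub>E S" and ?far = "\<lambda>J :: (nat, nat) cat. Arr J \<rightarrow>\<^sub>E Arr (full_subcat E S)"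
  let ?K = "\<lambda>J. (\<lambda>(a, b). (J, \<lparr>fob = a, far = b\<rparr>)) ` (?fob J \<times> ?far J)"
  show "small U (\<Union>J\<in>UNIV. ?K J)"
  proof (intro small_UN small_image small_Times small_nat_cats)
    fix J :: "(nat, nat) cat"
    show "small U (?fob J)" by (rule small_functions[OF small_nat[of "Obj J"] S(2)])
    show "small U (?far J)"
      by (rule small_functions[OF small_nat[of "Arr J"] small_Arr_full_subcat[OF S]])
  qed
  show "finite_diagrams_in E S \<subseteq> (\<Union>J\<in>UNIV. ?K J)"
  proof
    fix x assume "x \<in> finite_diagrams_in E S"
    then obtain J K where x: "x = (J, K)" "cat_functor J E K" "fob K ` Obj J \<subseteq> S"
      by (auto simp: finite_diagrams_in_def finite_diagram_def)
    interpret K: cat_functor J E K by fact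
    have "fob K \<in> ?fob J" using K.fob_ext x by (auto simp: PiE_def)
    moreover have "far K \<in> ?far J"
      using K.far_ext x K.far_Arr K.source.Dom_in K.source.Cod_in by (auto simp: PiE_def)
    ultimately show "x \<in> (\<Union>J\<in>UNIV. ?K J)"
      using x by (auto intro!: exI[of _ J] image_eqI[of _ _ "(fob K, far K)"])
  qed
qed

text \<open>The union of the countable chain is closed: the objects of a finite diagram are finite
  in number, hence lie in one stage, and its chosen limit is in the next. Likewise a functor maps
  each stage into the following one.\<close>

lemma closed_family_ex:
  fixes E :: "'x \<Rightarrow> ('o, 'a) cat" and M :: "'x \<Rightarrow> 'x \<Rightarrow> ('o, 'a, 'o, 'a) ftor set"
  assumes "universe U" and I: "small U I" and E: "\<And>i. i \<in> I \<Longrightarrow> topos_category U (E i)"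
    and M: "\<And>i j. i \<in> I \<Longrightarrow> j \<in> I \<Longrightarrow> small U (M i j)"
      "\<And>i j F. i \<in> I \<Longrightarrow> j \<in> I \<Longrightarrow> F \<in> M i j \<Longrightarrow> cat_functor (E i) (E j) F"
  shows "\<exists>S. \<forall>i\<in>I. S i \<subseteq> Obj (E i) \<and> small U (S i) \<and> generates (E i) (S i) \<and>
    closed_under_finite_limits (E i) (S i) \<and> (\<forall>j\<in>I. \<forall>F\<in>M i j. fob F ` S i \<subseteq> S j)"
proof -
  interpret universe_set U by unfold_locales fact
  have "\<exists>G. small U G \<and> G \<subseteq> Obj (E i) \<and> generates (E i) G" if "i \<in> I" for i
    using topos_category.E_small_generators[OF E[OF that]] by (simp add: generates_def)
  then obtain G where G: "\<And>i. i \<in> I \<Longrightarrow> small U (G i) \<and> G i \<subseteq> Obj (E i) \<and> generates (E i) (G i)" by metis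
  \<comment> \<open>One limit per diagram keeps each stage small; all limits of a diagram together
    might not be a small set.\<close>
  define lim :: "'x \<Rightarrow> (nat, nat) cat \<times> (nat, nat, 'o, 'a) ftor \<Rightarrow> 'o"
    where "lim i = (\<lambda>(J, K). SOME L. \<exists>p. is_limit J (E i) K L p)" for i
  have lim: "\<exists>p. is_limit J (E i) K (lim i (J, K)) p" if "i \<in> I" "finite_diagram J (E i) K" for i J K
    using topos_category.E_finite_limits[OF E[OF that(1)]] that(2) someI_ex[of "\<lambda>L. \<exists>p. is_limit J (E i) K L p"]
    by (auto simp: has_finite_limits_def lim_def)
  \<comment> \<open>All members of the family advance at once, since the functors in
    \<open>M j i\<close> bring objects from \<open>E j\<close> into \<open>E i\<close>.\<close>
  define step where "step S i = S i \<union> (\<Union>j\<in>I. \<Union>F\<in>M j i. fob F ` S j) \<union> lim i ` finite_diagrams_in (E i) (S i)" for S i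
  define S where "S n = (step ^^ n) G" for n
  have S_Suc: "S (Suc n) i = step (S n) i" for n i by (simp add: S_def)
  have S: "S n i \<subseteq> Obj (E i) \<and> small U (S n i)" if "i \<in> I" for n i
    using that
  proof (induction n arbitrary: i)
    case (Suc n)
    have "fob F x \<in> Obj (E i)" if "j \<in> I" "F \<in> M j i" "x \<in> S n j" for j F x
      using cat_functor.fob_in[OF M(2)[OF that(1) Suc.prems that(2)]] Suc.IH[OF that(1)] that(3) by blast
    moreover have "lim i x \<in> Obj (E i)" if "x \<in> finite_diagrams_in (E i) (S n i)" for x
      using that lim[OF Suc.prems] by (cases x) (auto simp: finite_diagrams_in_def is_limit_def is_cone_def)
    ultimately have "S (Suc n) i \<subseteq> Obj (E i)" using Suc.IH[OF Suc.prems] unfolding S_Suc step_def by blast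
    moreover have "small U (S (Suc n) i)"
      unfolding S_Suc step_def using Suc.IH Suc.prems
      by (intro small_Un small_UN small_image topos_category.small_finite_diagrams_in E M I) auto
    ultimately show ?case by blast
  qed (use G in \<open>auto simp: S_def\<close>)
  have mono: "S m i \<subseteq> S n i" if "m \<le> n" for m n i
    by (rule lift_Suc_mono_le[of "\<lambda>n. S n i", OF _ that]) (auto simp: S_Suc step_def)
  have finite_in: "\<exists>n. B \<subseteq> S n i" if "finite B" "B \<subseteq> (\<Union>n. S n i)" for B i
    using that
  proof (induction B rule: finite_induct)
    case (insert x B)
    then obtain m n where "x \<in> S m i" "B \<subseteq> S n i" by auto
    then have "insert x B \<subseteq> S (max m n) i" using mono[of m "max m n" i] mono[of n "max m n" i] by auto
    then show ?case by blast
  qed auto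
  have "\<forall>i\<in>I. (\<Union>n. S n i) \<subseteq> Obj (E i) \<and> small U (\<Union>n. S n i) \<and> generates (E i) (\<Union>n. S n i) \<and>
    closed_under_finite_limits (E i) (\<Union>n. S n i) \<and> (\<forall>j\<in>I. \<forall>F\<in>M i j. fob F ` (\<Union>n. S n i) \<subseteq> (\<Union>n. S n j))"
  proof (intro ballI conjI)
    fix i assume i: "i \<in> I"
    show "(\<Union>n. S n i) \<subseteq> Obj (E i)" using S[OF i] by blast
    show "small U (\<Union>n. S n i)" using S[OF i] by (intro small_UN small_nat) auto
    have "G i \<subseteq> (\<Union>n. S n i)" using UN_upper[of 0 UNIV "\<lambda>n. S n i"] by (simp add: S_def)
    then show "generates (E i) (\<Union>n. S n i)" using G[OF i] generates_mono by blast
    show "closed_under_finite_limits (E i) (\<Union>n. S n i)"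
      unfolding closed_under_finite_limits_def
    proof (intro allI impI)
      fix J :: "(nat, nat) cat" and K
      assume K: "finite_diagram J (E i) K \<and> fob K ` Obj J \<subseteq> (\<Union>n. S n i)"
      then obtain n where "fob K ` Obj J \<subseteq> S n i"
        using finite_in[of "fob K ` Obj J" i] by (auto simp: finite_diagram_def)
      then have "lim i (J, K) \<in> S (Suc n) i" using K by (auto simp: S_Suc step_def finite_diagrams_in_def)
      then have "lim i (J, K) \<in> (\<Union>n. S n i)" by (rule UN_I[OF UNIV_I])
      then show "\<exists>L\<in>\<Union>n. S n i. \<exists>p. is_limit J (E i) K L p"
        using lim[OF i conjunct1[OF K]] by (rule rev_bexI)
    qed
    fix j F assume j: "j \<in> I" "F \<in> M i j"
    have "fob F ` S n i \<subseteq> S (Suc n) j" for n using i j unfolding S_Suc step_def by blast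
    then show "fob F ` (\<Union>n. S n i) \<subseteq> (\<Union>n. S n j)" by blast
  qed
  then show ?thesis by (intro exI[of _ "\<lambda>i. \<Union>n. S n i"])
qed

section \<open>Restriction to full subcategories\<close>

text \<open>If \<open>a\<close> and \<open>b\<close> agree after every \<open>far L f\<close>, their
  transposes agree after every \<open>f\<close>, hence are equal; and transposition is
  injective.\<close>

lemma left_adjoint_jointly_epi:
  assumes adj: "left_adjoint C D L R" and X: "X \<in> Obj C" and \<Phi>: "\<Phi> \<subseteq> {f \<in> Arr C. Cod C f = X}"
    and epi: "jointly_epi C X \<Phi>"
  shows "jointly_epi D (fob L X) (far L ` \<Phi>)"
proof -
  interpret L: cat_functor C D L using adj by (simp add: left_adjoint_def)
  interpret R: cat_functor D C R using adj by (simp add: left_adjoint_def)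
  obtain \<eta> \<epsilon> where \<eta>: "\<eta> \<in> Hom (functor_cat C C) (id_ftor C) (ftor_comp C R L)"
    and \<epsilon>: "\<epsilon> \<in> Hom (functor_cat D D) (ftor_comp D L R) (id_ftor D)"
    and tri: "Comp D (ncmp \<epsilon> (fob L X)) (far L (ncmp \<eta> X)) = Ident D (fob L X)"
    using adj X unfolding left_adjoint_def by blast
  interpret \<eta>: nat_trans C C \<eta> using \<eta> by (simp add: Hom_functor_cat)
  interpret \<epsilon>: nat_trans D D \<epsilon> using \<epsilon> by (simp add: Hom_functor_cat)
  have [simp]: "nsrc \<eta> = id_ftor C" "ntgt \<eta> = ftor_comp C R L" "nsrc \<epsilon> = ftor_comp D L R" "ntgt \<epsilon> = id_ftor D"
    using \<eta> \<epsilon> by (auto simp: Hom_functor_cat)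
  note [simp] = L.fob_in R.fob_in L.far_Arr R.far_Arr \<eta>.ncmp_Arr \<epsilon>.ncmp_Arr
    L.source.Comp_Arr L.target.Comp_Arr L.source.Dom_in L.source.Cod_in L.target.Dom_in L.target.Cod_in
  show ?thesis
    unfolding jointly_epi_def
  proof (intro ballI impI)
    fix Z a b assume Z: "Z \<in> Obj D" and a: "a \<in> Hom D (fob L X) Z" and b: "b \<in> Hom D (fob L X) Z"
      and eq: "\<forall>f\<in>far L ` \<Phi>. Comp D a f = Comp D b f"
    have aA: "a \<in> Arr D" "Dom D a = fob L X" "Cod D a = Z" and bA: "b \<in> Arr D" "Dom D b = fob L X" "Cod D b = Z"
      using a b by (auto simp: Hom_def)
    have transpose: "Comp C (Comp C (far R c) (ncmp \<eta> X)) f = Comp C (far R (Comp D c (far L f))) (ncmp \<eta> (Dom C f))"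
      if c: "c \<in> Arr D" "Dom D c = fob L X" and f: "f \<in> \<Phi>" for c f
    proof -
      have fA: "f \<in> Arr C" "Cod C f = X" using f \<Phi> by auto
      have "Comp C (Comp C (far R c) (ncmp \<eta> X)) f = Comp C (far R c) (Comp C (ncmp \<eta> X) f)"
        using c fA X by (intro L.source.Arr_assoc[symmetric]) auto
      also have "Comp C (ncmp \<eta> X) f = Comp C (far R (far L f)) (ncmp \<eta> (Dom C f))"
        using \<eta>.naturality_Arr[of f] fA by simp
      also have "Comp C (far R c) \<dots> = Comp C (Comp C (far R c) (far R (far L f))) (ncmp \<eta> (Dom C f))"
        using c fA by (intro L.source.Arr_assoc) auto
      finally show ?thesis using c fA by (simp add: R.far_Comp_Arr)
    qed
    \<comment> \<open>Injectivity of transposition: naturality of the counit and the triangle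
      identity at \<open>X\<close> rebuild \<open>c\<close> from its transpose.\<close>
    have recover: "c = Comp D (ncmp \<epsilon> Z) (far L (Comp C (far R c) (ncmp \<eta> X)))"
      if c: "c \<in> Arr D" "Dom D c = fob L X" "Cod D c = Z" for c
    proof -
      have "Comp D (ncmp \<epsilon> Z) (far L (Comp C (far R c) (ncmp \<eta> X)))
        = Comp D (ncmp \<epsilon> Z) (Comp D (far L (far R c)) (far L (ncmp \<eta> X)))"
        using c X by (simp add: L.far_Comp_Arr)
      also have "\<dots> = Comp D (Comp D (ncmp \<epsilon> Z) (far L (far R c))) (far L (ncmp \<eta> X))"
        using c X Z by (intro L.target.Arr_assoc) auto
      also have "Comp D (ncmp \<epsilon> Z) (far L (far R c)) = Comp D c (ncmp \<epsilon> (fob L X))"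
        using \<epsilon>.naturality_Arr[of c] c by simp
      also have "Comp D \<dots> (far L (ncmp \<eta> X)) = Comp D c (Comp D (ncmp \<epsilon> (fob L X)) (far L (ncmp \<eta> X)))"
        using c X by (intro L.target.Arr_assoc[symmetric]) auto
      finally show ?thesis using c tri by (simp add: L.target.Arr_Comp_Ident)
    qed
    have "Comp C (far R a) (ncmp \<eta> X) = Comp C (far R b) (ncmp \<eta> X)"
    proof -
      have "Comp C (Comp C (far R a) (ncmp \<eta> X)) f = Comp C (Comp C (far R b) (ncmp \<eta> X)) f" if f: "f \<in> \<Phi>" for f
        using transpose[OF aA(1,2) f] transpose[OF bA(1,2) f] eq f by simp
      moreover have "Comp C (far R a) (ncmp \<eta> X) \<in> Hom C X (fob R Z)" "Comp C (far R b) (ncmp \<eta> X) \<in> Hom C X (fob R Z)"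
        using aA bA X by (auto simp: Hom_def)
      ultimately show ?thesis using epi R.fob_in[OF Z] unfolding jointly_epi_def by blast
    qed
    then show "a = b" using recover[OF aA] recover[OF bA] by simp
  qed
qed

text \<open>This is literally the composite \<open>u\<^sup>* i\<^sub>A\<close> of the theorem. A
  functor record does not store its target, so the same record also serves as a functor into a
  subcategory of the target.\<close>

definition restrict_ftor :: "('o, 'a) cat \<Rightarrow> 'o set \<Rightarrow> ('o, 'a, 'p, 'b) ftor \<Rightarrow> ('o, 'a, 'p, 'b) ftor" where
  "restrict_ftor E S F = ftor_comp (full_subcat E S) F (inclusion (full_subcat E S))"

definition restrict_ntrans :: "('o, 'a) cat \<Rightarrow> 'o set \<Rightarrow> ('o, 'a, 'p, 'b) ntrans \<Rightarrow> ('o, 'a, 'p, 'b) ntrans" where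
  "restrict_ntrans E S \<alpha> = whisker_right (full_subcat E S) \<alpha> (inclusion (full_subcat E S))"

lemma restrict_ftor_simps [simp]:
  "X \<in> Obj E \<Longrightarrow> X \<in> S \<Longrightarrow> fob (restrict_ftor E S F) X = fob F X"
  "f \<in> Arr E \<Longrightarrow> Dom E f \<in> S \<Longrightarrow> Cod E f \<in> S \<Longrightarrow> far (restrict_ftor E S F) f = far F f"
  by (simp_all add: restrict_ftor_def)

lemma restrict_ntrans_simps [simp]:
  "nsrc (restrict_ntrans E S \<alpha>) = restrict_ftor E S (nsrc \<alpha>)"
  "ntgt (restrict_ntrans E S \<alpha>) = restrict_ftor E S (ntgt \<alpha>)"
  "X \<in> Obj E \<Longrightarrow> X \<in> S \<Longrightarrow> ncmp (restrict_ntrans E S \<alpha>) X = ncmp \<alpha> X"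
  by (simp_all add: restrict_ntrans_def restrict_ftor_def whisker_right_def)

lemma restrict_ftor_extensional [simp]:
  "fob (restrict_ftor E S F) \<in> extensional (Obj E \<inter> S)"
  "far (restrict_ftor E S F) \<in> extensional {f \<in> Arr E. Dom E f \<in> S \<and> Cod E f \<in> S}"
  "ncmp (restrict_ntrans E S \<alpha>) \<in> extensional (Obj E \<inter> S)"
  by (simp_all add: restrict_ftor_def restrict_ntrans_def ftor_comp_def whisker_right_def)

lemma ftor_eq_extI:
  assumes "fob F \<in> extensional A" "fob G \<in> extensional A" "far F \<in> extensional B" "far G \<in> extensional B"
    "\<And>X. X \<in> A \<Longrightarrow> fob F X = fob G X" "\<And>f. f \<in> B \<Longrightarrow> far F f = far G f"
  shows "F = (G :: ('o, 'a, 'p, 'b) ftor)"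
proof -
  have "fob F = fob G" "far F = far G" using assms by (metis extensionalityI)+
  then show ?thesis by simp
qed

lemma ftor_comp_extensional [simp]:
  "fob (ftor_comp C G F) \<in> extensional (Obj C)" "far (ftor_comp C G F) \<in> extensional (Arr C)"
  "fob (id_ftor C) \<in> extensional (Obj C)" "far (id_ftor C) \<in> extensional (Arr C)"
  by (auto simp: ftor_comp_def id_ftor_def)

lemma cat_functor_restrict:
  assumes F: "cat_functor E E' F" and S: "fob F ` (Obj E \<inter> S) \<subseteq> S'"
  shows "cat_functor (full_subcat E S) (full_subcat E' S') (restrict_ftor E S F)"
proof -
  interpret F: cat_functor E E' F by fact
  interpret s: category "full_subcat E S" by (rule category_full_subcat) unfold_locales
  interpret t: category "full_subcat E' S'" by (rule category_full_subcat) unfold_locales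
  have S': "fob F X \<in> S'" if "X \<in> Obj E" "X \<in> S" for X using S that by blast
  show ?thesis
  proof
    fix f X Y assume "f \<in> Hom (full_subcat E S) X Y"
    then show "far (restrict_ftor E S F) f \<in> Hom (full_subcat E' S') (fob (restrict_ftor E S F) X) (fob (restrict_ftor E S F) Y)"
      using F.far_in F.source.Hom_Obj S' by (auto simp: Hom_def F.source.Dom_in F.source.Cod_in F.far_Arr)
  qed (auto simp: F.fob_in S' F.source.Ident_Arr F.far_Ident Hom_def F.far_Comp_Arr F.source.Comp_Arr)
qed

lemma restrict_id: "restrict_ftor E S (id_ftor E) = id_ftor (full_subcat E S)"
  using ftor_comp_extensional(3,4)[of "full_subcat E S"]
  by (intro ftor_eq_extI[of _ "Obj (full_subcat E S)" _ "Arr (full_subcat E S)"]) auto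

lemma restrict_ftor_comp:
  assumes F: "cat_functor E E' F" and S: "fob F ` (Obj E \<inter> S) \<subseteq> S'"
  shows "restrict_ftor E S (ftor_comp E G F) = ftor_comp (full_subcat E S) (restrict_ftor E' S' G) (restrict_ftor E S F)"
proof -
  interpret F: cat_functor E E' F by fact
  have S': "fob F X \<in> S'" if "X \<in> Obj E" "X \<in> S" for X using S that by blast
  have inc: "fob (ftor_comp (full_subcat E S) H K) \<in> extensional (Obj E \<inter> S)"
    "far (ftor_comp (full_subcat E S) H K) \<in> extensional {f \<in> Arr E. Dom E f \<in> S \<and> Cod E f \<in> S}"
    for H :: "('q, 'r, 's, 't) ftor" and K
    using ftor_comp_extensional(1,2)[of "full_subcat E S" H K] by simp_all
  show ?thesis
    by (rule ftor_eq_extI[of _ "Obj (full_subcat E S)" _ "Arr (full_subcat E S)"])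
      (auto simp: inc F.fob_in F.far_Arr S' F.source.Dom_in F.source.Cod_in)
qed

lemma nat_trans_restrict:
  assumes \<alpha>: "nat_trans E E' \<alpha>" and S: "fob (nsrc \<alpha>) ` (Obj E \<inter> S) \<subseteq> S'" "fob (ntgt \<alpha>) ` (Obj E \<inter> S) \<subseteq> S'"
  shows "nat_trans (full_subcat E S) (full_subcat E' S') (restrict_ntrans E S \<alpha>)"
proof -
  interpret \<alpha>: nat_trans E E' \<alpha> by fact
  have S': "fob (nsrc \<alpha>) X \<in> S'" "fob (ntgt \<alpha>) X \<in> S'" if "X \<in> Obj E" "X \<in> S" for X using S that by blast+
  show ?thesis
    by (rule nat_transI)
      (auto simp: S' \<alpha>.naturality_Arr \<alpha>.nsrc.source.Dom_in \<alpha>.nsrc.source.Cod_in Hom_def \<alpha>.ncmp_Arr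
        intro!: cat_functor_restrict \<alpha>.nsrc.cat_functor_axioms \<alpha>.ntgt.cat_functor_axioms)
qed

text \<open>Any \<open>S'\<close> may appear on the right, since \<open>full_subcat\<close> keeps
  \<open>Ident\<close>; for \<open>restrict_vcomp\<close> it is \<open>Comp\<close> that is
  kept.\<close>

lemma restrict_id_ntrans:
  "restrict_ntrans E S (id_ntrans E E' F) = id_ntrans (full_subcat E S) (full_subcat E' S') (restrict_ftor E S F)"
  by (rule ntrans_eqI[of _ "Obj (full_subcat E S)"]) (auto, auto simp: id_ntrans_def)

lemma restrict_vcomp: "restrict_ntrans E S (vcomp E E' \<beta> \<alpha>)
    = vcomp (full_subcat E S) (full_subcat E' S') (restrict_ntrans E S \<beta>) (restrict_ntrans E S \<alpha>)"
  by (rule ntrans_eqI[of _ "Obj (full_subcat E S)"]) (auto, auto simp: vcomp_def)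

lemma restrict_hcomp:
  assumes \<alpha>: "nat_trans E E' \<alpha>" and S: "fob (nsrc \<alpha>) ` (Obj E \<inter> S) \<subseteq> S'" "fob (ntgt \<alpha>) ` (Obj E \<inter> S) \<subseteq> S'"
  shows "restrict_ntrans E S (hcomp E E'' \<beta> \<alpha>)
    = hcomp (full_subcat E S) (full_subcat E'' S'') (restrict_ntrans E' S' \<beta>) (restrict_ntrans E S \<alpha>)"
proof -
  interpret \<alpha>: nat_trans E E' \<alpha> by fact
  have S': "fob (nsrc \<alpha>) X \<in> S'" "fob (ntgt \<alpha>) X \<in> S'" if "X \<in> Obj E" "X \<in> S" for X using S that by blast+
  show ?thesis
  proof (rule ntrans_eqI[of _ "Obj (full_subcat E S)"])
    show "ncmp (hcomp (full_subcat E S) (full_subcat E'' S'') (restrict_ntrans E' S' \<beta>) (restrict_ntrans E S \<alpha>))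
        \<in> extensional (Obj (full_subcat E S))"
      by (simp add: hcomp_def)
  qed (auto simp: S' \<alpha>.ncmp_Arr \<alpha>.nsrc.fob_in \<alpha>.ntgt.fob_in
      restrict_ftor_comp[OF \<alpha>.nsrc.cat_functor_axioms S(1)] restrict_ftor_comp[OF \<alpha>.ntgt.cat_functor_axioms S(2)])
qed

text \<open>Exactness takes a detour through the ambient categories: a limit in the subcategory is a
  limit in \<open>E\<close>, its image is a limit in \<open>E'\<close>, and that image lies in
  \<open>S'\<close>.\<close>

lemma site_ftor_restrict:
  assumes adj: "left_adjoint E E' F R" and exact: "exact_ftor E E' F"
    and S: "S \<subseteq> Obj E" "S' \<subseteq> Obj E'" "fob F ` S \<subseteq> S'" and closed: "closed_under_finite_limits E S"
  shows "site_ftor (canonical_site_on E S) (canonical_site_on E' S') (restrict_ftor E S F)"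
proof -
  have F: "cat_functor E E' F" using adj by (simp add: left_adjoint_def)
  interpret F: cat_functor E E' F by fact
  have S': "fob F ` (Obj E \<inter> S) \<subseteq> S'" using S by blast
  have FS: "fob F X \<in> S'" if "X \<in> S" for X using S(3) that by blast
  let ?T = "canonical_site_on E S" and ?T' = "canonical_site_on E' S'" and ?F = "restrict_ftor E S F"
  have u [simp]: "ucat (canonical_site_on C S) = full_subcat C S" for C S by (simp add: canonical_site_on_def)
  have cf: "cat_functor (full_subcat E S) (full_subcat E' S') ?F" by (rule cat_functor_restrict[OF F S'])
  have "continuous_ftor ?T ?T' ?F"
    unfolding continuous_ftor_def
  proof (intro allI impI)
    fix X \<Phi> assume "covering_family ?T X \<Phi>"
    then have X: "X \<in> S" and \<Phi>: "\<Phi> \<subseteq> {f \<in> Arr E. Dom E f \<in> S \<and> Cod E f = X}" and epi: "jointly_epi E X \<Phi>"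
      by (auto simp: F.source.covering_family_canonical_site_on[OF S(1)])
    have XE: "X \<in> Obj E" using X S by auto
    have im: "far ?F ` \<Phi> = far F ` \<Phi>" using \<Phi> X by (intro image_cong) auto
    have "jointly_epi E' (fob F X) (far F ` \<Phi>)"
      using \<Phi> by (intro left_adjoint_jointly_epi[OF adj XE _ epi]) auto
    moreover have "far F ` \<Phi> \<subseteq> {f \<in> Arr E'. Dom E' f \<in> S' \<and> Cod E' f = fob F X}"
      using \<Phi> X by (auto simp: F.far_Arr subset_iff FS)
    ultimately show "covering_family ?T' (fob ?F X) (far ?F ` \<Phi>)"
      using X XE S unfolding im by (auto simp: F.target.covering_family_canonical_site_on[OF S(2)])
  qed
  moreover have "exact_ftor (full_subcat E S) (full_subcat E' S') ?F"
    unfolding exact_ftor_def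
  proof (intro allI impI)
    fix J :: "(nat, nat) cat" and K L p
    assume A: "finite_diagram J (full_subcat E S) K \<and> is_limit J (full_subcat E S) K L p"
    note KE = finite_diagram_full_subcat[OF conjunct1[OF A] F.source.category_axioms]
    interpret K: cat_functor J E K using KE by (simp add: finite_diagram_def)
    have "is_limit J E K L p" by (rule F.source.is_limit_if_full_subcat[OF closed conjunct1[OF A] conjunct2[OF A]])
    then have lim: "is_limit J E' (ftor_comp J F K) (fob F L) (\<lambda>i. far F (p i))"
      using exact KE unfolding exact_ftor_def by blast
    have L: "L \<in> S" "L \<in> Obj E" and p: "\<And>i. i \<in> Obj J \<Longrightarrow> p i \<in> Arr E \<and> Dom E (p i) = L \<and> Cod E (p i) = fob K i"
      using A by (auto simp: is_limit_def is_cone_def Hom_def)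
    have K_S: "fob K i \<in> S" if "i \<in> Obj J" for i using KE(2) that by blast
    \<comment> \<open>The diagram stays in \<open>S\<close>, where \<open>F\<close> and its
      restriction have the same values.\<close>
    have eq: "ftor_comp J ?F K = ftor_comp J F K"
    proof (rule ftor_eq_extI[of _ "Obj J" _ "Arr J"])
      fix h assume h: "h \<in> Arr J"
      then show "far (ftor_comp J ?F K) h = far (ftor_comp J F K) h"
        using K_S K.source.Dom_in K.source.Cod_in by (simp add: K.far_Arr)
    qed (use K_S in \<open>auto simp: ftor_comp_extensional K.fob_in\<close>)
    have "is_limit J (full_subcat E' S') (ftor_comp J F K) (fob F L) (\<lambda>i. far F (p i))"
      using K_S L S by (intro is_limit_full_subcatI[OF lim]) auto
    moreover have "far ?F (p i) = far F (p i)" if "i \<in> Obj J" for i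
      using p[OF that] L K_S[OF that] by simp
    moreover have "\<forall>h\<in>Arr J. Dom J h \<in> Obj J \<and> Cod J h \<in> Obj J" using K.source.Dom_in K.source.Cod_in by blast
    ultimately show "is_limit J (full_subcat E' S') (ftor_comp J ?F K) (fob ?F L) (\<lambda>i. far ?F (p i))"
      using L unfolding eq is_limit_def is_cone_def by simp
  qed
  ultimately show ?thesis using cf by (simp add: site_ftor_def)
qed

section \<open>Diagrams of topoi\<close>

lemma Top_simps:
  "Ob (Top U) = {E. topos U E}" "HomC (Top U) = Top_hom" "inv_im (Id1 (Top U) E) = id_ftor E"
  "f \<in> Obj (Top_hom E1 E2) \<Longrightarrow> g \<in> Obj (Top_hom E2 E3) \<Longrightarrow>
    inv_im (fob (HComp (Top U) E1 E2 E3) (g, f)) = ftor_comp E3 (inv_im f) (inv_im g)"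
  "\<sigma> \<in> Arr (Top_hom E1 E2) \<Longrightarrow> \<tau> \<in> Arr (Top_hom E2 E3) \<Longrightarrow>
    gtrans (far (HComp (Top U) E1 E2 E3) (\<tau>, \<sigma>)) = hcomp E3 E1 (gtrans \<sigma>) (gtrans \<tau>)"
  by (auto simp: Top_def geom_comp_def)

lemma Top_hom_simps:
  "f \<in> Obj (Top_hom E F) \<longleftrightarrow> left_adjoint F E (inv_im f) (dir_im f) \<and> exact_ftor F E (inv_im f)"
  "\<sigma> \<in> Hom (Top_hom E F) f g \<Longrightarrow> nat_trans F E (gtrans \<sigma>) \<and> nsrc (gtrans \<sigma>) = inv_im g \<and> ntgt (gtrans \<sigma>) = inv_im f"
  "gtrans (Ident (Top_hom E F) f) = id_ntrans F E (inv_im f)"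
  "gtrans (Comp (Top_hom E F) \<tau> \<sigma>) = vcomp F E (gtrans \<sigma>) (gtrans \<tau>)"
  by (auto simp: Top_hom_def geometric_morphism_def Hom_def)

locale topos_diagram =
  fixes U :: "'u set" and A :: "('x, 'y, 'z) two_cat"
    and E :: "('x, 'y, 'z, ('o, 'a) cat, ('o, 'a) geom, ('o, 'a) geom_cell) two_ftor"
  assumes universe_U: "universe U" and two_category_A: "two_category A"
    and small_A: "small_two_cat U A" and two_functor_E: "two_functor (two_op A) (Top U) E"
begin

interpretation A: two_category A by (rule two_category_A)
interpretation E: two_functor "two_op A" "Top U" E by (rule two_functor_E)

text \<open>For \<open>u : X \<rightarrow> Y\<close> in \<open>A\<close>, the diagram on
  \<open>two_op A\<close> gives a geometric morphism from \<open>F0 E Y\<close> to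
  \<open>F0 E X\<close>. This explains the index order \<open>Y X\<close>; the inverse image points
  back, in the direction of \<open>u\<close>.\<close>

definition pull :: "'x \<Rightarrow> 'x \<Rightarrow> 'y \<Rightarrow> ('o, 'a, 'o, 'a) ftor" where
  "pull X Y u = inv_im (fob (FH E Y X) u)"

definition pull_cell :: "'x \<Rightarrow> 'x \<Rightarrow> 'z \<Rightarrow> ('o, 'a, 'o, 'a) ntrans" where
  "pull_cell X Y \<gamma> = gtrans (far (FH E Y X) \<gamma>)"

lemma topos_category_E: "X \<in> Ob A \<Longrightarrow> topos_category U (F0 E X)"
  using topos_category_if_topos[OF universe_U] E.F0_in[of X] by (simp add: Top_simps)

lemma FH_E_functor: "X \<in> Ob A \<Longrightarrow> Y \<in> Ob A \<Longrightarrow>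
    cat_functor (op_cat (HomC A X Y)) (Top_hom (F0 E Y) (F0 E X)) (FH E Y X)"
  using E.FH_functor[of Y X] by (simp add: Top_simps)

lemma FH_E_Obj: "X \<in> Ob A \<Longrightarrow> Y \<in> Ob A \<Longrightarrow> u \<in> Obj (HomC A X Y) \<Longrightarrow>
    fob (FH E Y X) u \<in> Obj (Top_hom (F0 E Y) (F0 E X))"
  using cat_functor.fob_in[OF FH_E_functor] by simp

lemma FH_E_Hom: "X \<in> Ob A \<Longrightarrow> Y \<in> Ob A \<Longrightarrow> \<gamma> \<in> Hom (HomC A X Y) u v \<Longrightarrow>
    far (FH E Y X) \<gamma> \<in> Hom (Top_hom (F0 E Y) (F0 E X)) (fob (FH E Y X) v) (fob (FH E Y X) u)"
  by (rule cat_functor.far_in[OF FH_E_functor]) auto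

lemma pull_adjoint:
  assumes "X \<in> Ob A" "Y \<in> Ob A" "u \<in> Obj (HomC A X Y)"
  shows "left_adjoint (F0 E X) (F0 E Y) (pull X Y u) (dir_im (fob (FH E Y X) u))"
    "exact_ftor (F0 E X) (F0 E Y) (pull X Y u)" "cat_functor (F0 E X) (F0 E Y) (pull X Y u)"
  using FH_E_Obj[OF assms] by (auto simp: Top_hom_simps pull_def left_adjoint_def)

text \<open>Two reversals cancel: \<open>two_op\<close> reverses 2-cells, and a 2-cell from
  \<open>f\<close> to \<open>g\<close> in \<open>Top_hom\<close> is a transformation from the
  inverse image of \<open>g\<close> to that of \<open>f\<close>.\<close>

lemma pull_cell_trans:
  assumes "X \<in> Ob A" "Y \<in> Ob A" "\<gamma> \<in> Hom (HomC A X Y) u v"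
  shows "nat_trans (F0 E X) (F0 E Y) (pull_cell X Y \<gamma>)" "nsrc (pull_cell X Y \<gamma>) = pull X Y u"
    "ntgt (pull_cell X Y \<gamma>) = pull X Y v"
  using Top_hom_simps(2)[OF FH_E_Hom[OF assms]] by (auto simp: pull_def pull_cell_def)

lemma pull_cell_Ident: "X \<in> Ob A \<Longrightarrow> Y \<in> Ob A \<Longrightarrow> u \<in> Obj (HomC A X Y) \<Longrightarrow>
    pull_cell X Y (Ident (HomC A X Y) u) = id_ntrans (F0 E X) (F0 E Y) (pull X Y u)"
  using cat_functor.far_Ident[OF FH_E_functor, of X Y u] by (simp add: pull_cell_def pull_def Top_hom_simps)

lemma pull_cell_Comp: "X \<in> Ob A \<Longrightarrow> Y \<in> Ob A \<Longrightarrow> \<gamma> \<in> Hom (HomC A X Y) u v \<Longrightarrow> \<delta> \<in> Hom (HomC A X Y) v w \<Longrightarrow>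
    pull_cell X Y (Comp (HomC A X Y) \<delta> \<gamma>) = vcomp (F0 E X) (F0 E Y) (pull_cell X Y \<delta>) (pull_cell X Y \<gamma>)"
  using cat_functor.far_Comp[OF FH_E_functor, of X Y \<delta> w v \<gamma> u] by (simp add: pull_cell_def Top_hom_simps)

lemma pull_Id1: "X \<in> Ob A \<Longrightarrow> pull X X (Id1 A X) = id_ftor (F0 E X)"
  using E.FH_Id1[of X] by (simp add: pull_def Top_simps)

lemma pull_HComp:
  assumes "X \<in> Ob A" "Y \<in> Ob A" "Z \<in> Ob A" "u \<in> Obj (HomC A X Y)" "v \<in> Obj (HomC A Y Z)"
  shows "pull X Z (fob (HComp A X Y Z) (v, u)) = ftor_comp (F0 E X) (pull Y Z v) (pull X Y u)"
proof -
  have "fob (FH E Z X) (fob (HComp A X Y Z) (v, u))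
      = fob (HComp (Top U) (F0 E Z) (F0 E Y) (F0 E X)) (fob (FH E Y X) u, fob (FH E Z Y) v)"
    using E.FH_fob_HComp[of Z Y X v u] assms by simp
  then show ?thesis using Top_simps(4)[OF FH_E_Obj[of Y Z v] FH_E_Obj[of X Y u]] assms by (simp add: pull_def)
qed

lemma pull_cell_HComp:
  assumes "X \<in> Ob A" "Y \<in> Ob A" "Z \<in> Ob A" "\<gamma> \<in> Arr (HomC A X Y)" "\<delta> \<in> Arr (HomC A Y Z)"
  shows "pull_cell X Z (far (HComp A X Y Z) (\<delta>, \<gamma>)) = hcomp (F0 E X) (F0 E Z) (pull_cell Y Z \<delta>) (pull_cell X Y \<gamma>)"
proof -
  have "far (FH E Z X) (far (HComp A X Y Z) (\<delta>, \<gamma>))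
      = far (HComp (Top U) (F0 E Z) (F0 E Y) (F0 E X)) (far (FH E Y X) \<gamma>, far (FH E Z Y) \<delta>)"
    using E.FH_far_HComp[of Z Y X \<delta> \<gamma>] assms by simp
  moreover have "far (FH E Y X) \<gamma> \<in> Arr (Top_hom (F0 E Y) (F0 E X))"
    "far (FH E Z Y) \<delta> \<in> Arr (Top_hom (F0 E Z) (F0 E Y))"
    using cat_functor.far_Arr[OF FH_E_functor[OF assms(1,2)], of \<gamma>]
      cat_functor.far_Arr[OF FH_E_functor[OF assms(2,3)], of \<delta>] assms by auto
  ultimately show ?thesis using Top_simps(5) by (simp add: pull_cell_def)
qed

lemma closed_subcategories:
  "\<exists>S. \<forall>X\<in>Ob A. S X \<subseteq> Obj (F0 E X) \<and> small U (S X) \<and> generates (F0 E X) (S X) \<and>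
    closed_under_finite_limits (F0 E X) (S X) \<and> (\<forall>Y\<in>Ob A. \<forall>u\<in>Obj (HomC A X Y). fob (pull X Y u) ` S X \<subseteq> S Y)"
proof -
  have "\<exists>S. \<forall>X\<in>Ob A. S X \<subseteq> Obj (F0 E X) \<and> small U (S X) \<and> generates (F0 E X) (S X) \<and>
    closed_under_finite_limits (F0 E X) (S X) \<and> (\<forall>Y\<in>Ob A. \<forall>F\<in>pull X Y ` Obj (HomC A X Y). fob F ` S X \<subseteq> S Y)"
    using small_A topos_category_E pull_adjoint(3)
    by (intro closed_family_ex[OF universe_U]) (auto simp: small_two_cat_def intro: small_image)
  then show ?thesis by simp
qed

end

section \<open>The restricted diagram of sites\<close>

locale closed_topos_diagram = topos_diagram U A E
  for U :: "'u set" and A :: "('x, 'y, 'z) two_cat"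
    and E :: "('x, 'y, 'z, ('o, 'a) cat, ('o, 'a) geom, ('o, 'a) geom_cell) two_ftor" +
  fixes S :: "'x \<Rightarrow> 'o set"
  assumes S_Obj: "X \<in> Ob A \<Longrightarrow> S X \<subseteq> Obj (F0 E X)" and small_S: "X \<in> Ob A \<Longrightarrow> small U (S X)"
    and generates_S: "X \<in> Ob A \<Longrightarrow> generates (F0 E X) (S X)"
    and closed_S: "X \<in> Ob A \<Longrightarrow> closed_under_finite_limits (F0 E X) (S X)"
    and pull_S: "\<lbrakk>X \<in> Ob A; Y \<in> Ob A; u \<in> Obj (HomC A X Y)\<rbrakk> \<Longrightarrow> fob (pull X Y u) ` S X \<subseteq> S Y"
begin

interpretation A: two_category A by (rule two_category_A)

abbreviation sub :: "'x \<Rightarrow> ('o, 'a) cat" where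
  "sub X \<equiv> full_subcat (F0 E X) (S X)"

abbreviation res_pull :: "'x \<Rightarrow> 'x \<Rightarrow> 'y \<Rightarrow> ('o, 'a, 'o, 'a) ftor" where
  "res_pull X Y u \<equiv> restrict_ftor (F0 E X) (S X) (pull X Y u)"

abbreviation res_cell :: "'x \<Rightarrow> 'x \<Rightarrow> 'z \<Rightarrow> ('o, 'a, 'o, 'a) ntrans" where
  "res_cell X Y \<gamma> \<equiv> restrict_ntrans (F0 E X) (S X) (pull_cell X Y \<gamma>)"

definition site_diagram :: "('x, 'y, 'z, ('o, 'a) site, ('o, 'a, 'o, 'a) ftor, ('o, 'a, 'o, 'a) ntrans) two_ftor" where
  "site_diagram = \<lparr>F0 = (\<lambda>X. canonical_site_on (F0 E X) (S X)),
     FH = (\<lambda>Y X. \<lparr>fob = (\<lambda>u\<in>Obj (HomC A X Y). res_pull X Y u),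
                   far = (\<lambda>\<gamma>\<in>Arr (HomC A X Y). res_cell X Y \<gamma>)\<rparr>)\<rparr>"

lemma ucat_canonical_site_on [simp]: "ucat (canonical_site_on C K) = full_subcat C K"
  by (simp add: canonical_site_on_def)

lemma site_diagram_simps [simp]:
  "F0 site_diagram X = canonical_site_on (F0 E X) (S X)"
  "u \<in> Obj (HomC A X Y) \<Longrightarrow> fob (FH site_diagram Y X) u = res_pull X Y u"
  "\<gamma> \<in> Arr (HomC A X Y) \<Longrightarrow> far (FH site_diagram Y X) \<gamma> = res_cell X Y \<gamma>"
  by (simp_all add: site_diagram_def)

lemma pull_S': "X \<in> Ob A \<Longrightarrow> Y \<in> Ob A \<Longrightarrow> u \<in> Obj (HomC A X Y) \<Longrightarrow>
    fob (pull X Y u) ` (Obj (F0 E X) \<inter> S X) \<subseteq> S Y"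
  using pull_S by blast

lemma site_F0: "X \<in> Ob A \<Longrightarrow> site U (canonical_site_on (F0 E X) (S X))"
  by (rule topos_category.site_canonical_site_on[OF topos_category_E S_Obj small_S generates_S closed_S])

lemma site_ftor_pull: "X \<in> Ob A \<Longrightarrow> Y \<in> Ob A \<Longrightarrow> u \<in> Obj (HomC A X Y) \<Longrightarrow>
    site_ftor (canonical_site_on (F0 E X) (S X)) (canonical_site_on (F0 E Y) (S Y)) (res_pull X Y u)"
  by (rule site_ftor_restrict[OF pull_adjoint(1,2) S_Obj S_Obj pull_S closed_S])

lemma Hom_HomC_Obj: "X \<in> Ob A \<Longrightarrow> Y \<in> Ob A \<Longrightarrow> \<gamma> \<in> Hom (HomC A X Y) u v \<Longrightarrow>
    u \<in> Obj (HomC A X Y) \<and> v \<in> Obj (HomC A X Y)"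
  using category.Hom_Obj[OF A.HomC_category] by blast

lemma nat_trans_res_cell:
  assumes "X \<in> Ob A" "Y \<in> Ob A" "\<gamma> \<in> Hom (HomC A X Y) u v"
  shows "nat_trans (sub X) (sub Y) (res_cell X Y \<gamma>)"
  using pull_cell_trans[OF assms] Hom_HomC_Obj[OF assms] pull_S' assms by (intro nat_trans_restrict) auto

text \<open>Stated covariantly, with values in \<open>Sit_star_hom\<close>. The hom-categories of
  \<open>two_op A\<close> and of \<open>Sit U\<close> are the opposites of the two categories here,
  so one use of \<open>cat_functor_op_cat\<close> gives the required form.\<close>

lemma FH_site_diagram:
  assumes X: "X \<in> Ob A" and Y: "Y \<in> Ob A"
  shows "cat_functor (HomC A X Y) (Sit_star_hom (canonical_site_on (F0 E X) (S X)) (canonical_site_on (F0 E Y) (S Y)))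
    (FH site_diagram Y X)"
proof -
  interpret s: category "HomC A X Y" by (rule A.HomC_category[OF X Y])
  interpret t: category "Sit_star_hom (canonical_site_on (F0 E X) (S X)) (canonical_site_on (F0 E Y) (S Y))"
    by (rule category_Sit_star_hom)
  show ?thesis
  proof
    fix \<gamma> u v assume g: "\<gamma> \<in> Hom (HomC A X Y) u v"
    then have "\<gamma> \<in> Arr (HomC A X Y)" by (simp add: Hom_def)
    then show "far (FH site_diagram Y X) \<gamma> \<in> Hom (Sit_star_hom (canonical_site_on (F0 E X) (S X))
        (canonical_site_on (F0 E Y) (S Y))) (fob (FH site_diagram Y X) u) (fob (FH site_diagram Y X) v)"
      using Hom_HomC_Obj[OF X Y g] nat_trans_res_cell[OF X Y g] site_ftor_pull[OF X Y] pull_cell_trans[OF X Y g]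
      by (simp add: Hom_Sit_star_hom)
  next
    fix u assume u: "u \<in> Obj (HomC A X Y)"
    then show "far (FH site_diagram Y X) (Ident (HomC A X Y) u) = Ident (Sit_star_hom (canonical_site_on (F0 E X) (S X))
        (canonical_site_on (F0 E Y) (S Y))) (fob (FH site_diagram Y X) u)"
      using s.Ident_Arr[OF u] restrict_id_ntrans[of "F0 E X" "S X" "F0 E Y" "pull X Y u" "S Y"]
      by (simp add: pull_cell_Ident[OF X Y])
  next
    fix \<gamma> u v \<delta> w assume g: "\<gamma> \<in> Hom (HomC A X Y) u v" and d: "\<delta> \<in> Hom (HomC A X Y) v w"
    then have "Comp (HomC A X Y) \<delta> \<gamma> \<in> Arr (HomC A X Y)" "\<gamma> \<in> Arr (HomC A X Y)" "\<delta> \<in> Arr (HomC A X Y)"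
      using s.Comp_in[OF g d] by (auto simp: Hom_def)
    then show "far (FH site_diagram Y X) (Comp (HomC A X Y) \<delta> \<gamma>) = Comp (Sit_star_hom (canonical_site_on (F0 E X) (S X))
        (canonical_site_on (F0 E Y) (S Y))) (far (FH site_diagram Y X) \<delta>) (far (FH site_diagram Y X) \<gamma>)"
      using restrict_vcomp[of "F0 E X" "S X" "F0 E Y" _ _ "S Y"] by (simp add: pull_cell_Comp[OF X Y g d])
  qed (use site_ftor_pull[OF X Y] in \<open>auto simp: site_diagram_def\<close>)
qed

lemma Sit_simps [simp]:
  "Ob (Sit U) = {T. site U T}" "HomC (Sit U) T T' = op_cat (Sit_star_hom T' T)" "Id1 (Sit U) T = id_ftor (ucat T)"
  "fob (HComp (Sit U) T1 T2 T3) (G, F) = fob (HComp (Sit_star U) T3 T2 T1) (F, G)"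
  "far (HComp (Sit U) T1 T2 T3) (\<beta>, \<alpha>) = far (HComp (Sit_star U) T3 T2 T1) (\<alpha>, \<beta>)"
  by (simp_all add: Sit_def)

text \<open>Each equation is the restriction of the corresponding equation for inverse images, and
  these hold strictly because \<open>E\<close> is a strict 2-functor.\<close>

theorem two_functor_site_diagram: "two_functor (two_op A) (Sit U) site_diagram"
proof (intro two_functor.intro two_functor_axioms.intro)
  show "two_category (two_op A)" by (rule two_category_two_op[OF two_category_A])
  show "two_category (Sit U)" by (rule two_category_Sit)
next
  fix X assume "X \<in> Ob (two_op A)"
  then have X: "X \<in> Ob A" by simp
  show "F0 site_diagram X \<in> Ob (Sit U)" using site_F0[OF X] by simp
  show "fob (FH site_diagram X X) (Id1 (two_op A) X) = Id1 (Sit U) (F0 site_diagram X)"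
    using A.Id1_in[OF X] by (simp add: pull_Id1[OF X] restrict_id)
next
  fix X Y assume "X \<in> Ob (two_op A)" "Y \<in> Ob (two_op A)"
  then show "cat_functor (HomC (two_op A) X Y) (HomC (Sit U) (F0 site_diagram X) (F0 site_diagram Y)) (FH site_diagram X Y)"
    using cat_functor_op_cat[OF FH_site_diagram[of Y X]] by simp
next
  fix Z Y X v u assume "Z \<in> Ob (two_op A)" "Y \<in> Ob (two_op A)" "X \<in> Ob (two_op A)"
    "v \<in> Obj (HomC (two_op A) Z Y)" "u \<in> Obj (HomC (two_op A) Y X)"
  then have X: "X \<in> Ob A" "Y \<in> Ob A" "Z \<in> Ob A" and u: "u \<in> Obj (HomC A X Y)" and v: "v \<in> Obj (HomC A Y Z)" by auto
  have vu: "fob (HComp A X Y Z) (v, u) \<in> Obj (HomC A X Z)"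
    using cat_functor.fob_in[OF A.HComp_functor[OF X], of "(v, u)"] u v by simp
  show "fob (FH site_diagram Z X) (fob (HComp (two_op A) Z Y X) (u, v)) =
    fob (HComp (Sit U) (F0 site_diagram Z) (F0 site_diagram Y) (F0 site_diagram X)) (fob (FH site_diagram Y X) u, fob (FH site_diagram Z Y) v)"
    using u v vu site_ftor_pull[OF X(1,2) u] site_ftor_pull[OF X(2,3) v]
      restrict_ftor_comp[OF pull_adjoint(3)[OF X(1,2) u] pull_S'[OF X(1,2) u]]
    by (simp add: pull_HComp[OF X u v])
next
  fix Z Y X \<delta> \<gamma> assume "Z \<in> Ob (two_op A)" "Y \<in> Ob (two_op A)" "X \<in> Ob (two_op A)"
    "\<delta> \<in> Arr (HomC (two_op A) Z Y)" "\<gamma> \<in> Arr (HomC (two_op A) Y X)"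
  then have X: "X \<in> Ob A" "Y \<in> Ob A" "Z \<in> Ob A" and g: "\<gamma> \<in> Arr (HomC A X Y)" and d: "\<delta> \<in> Arr (HomC A Y Z)" by auto
  have dg: "far (HComp A X Y Z) (\<delta>, \<gamma>) \<in> Arr (HomC A X Z)"
    using cat_functor.far_Arr[OF A.HComp_functor[OF X], of "(\<delta>, \<gamma>)"] g d by simp
  obtain u v where g': "\<gamma> \<in> Hom (HomC A X Y) u v" using g by (auto simp: Hom_def)
  note t = pull_cell_trans[OF X(1,2) g'] and uv = Hom_HomC_Obj[OF X(1,2) g']
  have S: "fob (nsrc (pull_cell X Y \<gamma>)) ` (Obj (F0 E X) \<inter> S X) \<subseteq> S Y"
    "fob (ntgt (pull_cell X Y \<gamma>)) ` (Obj (F0 E X) \<inter> S X) \<subseteq> S Y"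
    using t uv pull_S'[OF X(1,2)] by auto
  have arr: "res_cell X Y \<gamma> \<in> Arr (Sit_star_hom (canonical_site_on (F0 E X) (S X)) (canonical_site_on (F0 E Y) (S Y)))"
    "res_cell Y Z \<delta> \<in> Arr (Sit_star_hom (canonical_site_on (F0 E Y) (S Y)) (canonical_site_on (F0 E Z) (S Z)))"
    using cat_functor.far_Arr[OF FH_site_diagram[OF X(1,2)], of \<gamma>] g cat_functor.far_Arr[OF FH_site_diagram[OF X(2,3)], of \<delta>] d
    by (simp_all del: Sit_star_hom_simps)
  show "far (FH site_diagram Z X) (far (HComp (two_op A) Z Y X) (\<gamma>, \<delta>)) =
    far (HComp (Sit U) (F0 site_diagram Z) (F0 site_diagram Y) (F0 site_diagram X)) (far (FH site_diagram Y X) \<gamma>, far (FH site_diagram Z Y) \<delta>)"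
    using g d dg arr restrict_hcomp[OF t(1) S] by (simp add: pull_cell_HComp[OF X g d] del: Sit_star_hom_simps)
qed

end

theorem proposition2p2:
  fixes U :: "'u set"
    and A :: "('x, 'y, 'z) two_cat"
    and E :: "('x, 'y, 'z, ('o, 'a) cat, ('o, 'a) geom, ('o, 'a) geom_cell) two_ftor"
  assumes "universe U"
    and "two_category A"
    and "small_two_cat U A"
    and "two_functor (two_op A) (Top U) E"
  shows "\<exists>C :: ('x, 'y, 'z, ('o, 'a) site, ('o, 'a, 'o, 'a) ftor, ('o, 'a, 'o, 'a) ntrans) two_ftor.
    two_functor (two_op A) (Sit U) C \<and>
    (\<forall>X \<in> Ob A. \<exists>S \<subseteq> Obj (F0 E X).
       small U S \<and> small U (Arr (full_subcat (F0 E X) S)) \<and>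
       generating (F0 E X) S \<and> closed_under_finite_limits (F0 E X) S \<and>
       F0 C X = canonical_site_on (F0 E X) S) \<and>
    (\<forall>X \<in> Ob A. \<forall>Y \<in> Ob A. \<forall>u v \<gamma>. \<gamma> \<in> Hom (HomC A X Y) u v \<longrightarrow>
       (let CX = ucat (F0 C X); iX = inclusion CX; iY = inclusion (ucat (F0 C Y))
        in ftor_comp CX (inv_im (fob (FH E Y X) u)) iX = ftor_comp CX iY (fob (FH C Y X) u) \<and>
           ftor_comp CX (inv_im (fob (FH E Y X) v)) iX = ftor_comp CX iY (fob (FH C Y X) v) \<and>
           whisker_right CX (gtrans (far (FH E Y X) \<gamma>)) iX
             = whisker_left CX iY (far (FH C Y X) \<gamma>)))"
proof -
  interpret topos_diagram U A E by (intro topos_diagram.intro assms)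
  interpret A: two_category A by fact
  obtain S where S: "\<forall>X\<in>Ob A. S X \<subseteq> Obj (F0 E X) \<and> small U (S X) \<and> generates (F0 E X) (S X) \<and>
    closed_under_finite_limits (F0 E X) (S X) \<and> (\<forall>Y\<in>Ob A. \<forall>u\<in>Obj (HomC A X Y). fob (pull X Y u) ` S X \<subseteq> S Y)"
    using closed_subcategories by blast
  interpret closed_topos_diagram U A E S
    by (intro closed_topos_diagram.intro closed_topos_diagram_axioms.intro topos_diagram_axioms)
      (use S in blast)+
  show ?thesis
  proof (intro exI[of _ site_diagram] conjI ballI allI impI)
    show "two_functor (two_op A) (Sit U) site_diagram" by (rule two_functor_site_diagram)
  next
    fix X assume X: "X \<in> Ob A"
    interpret EX: topos_category U "F0 E X" by (rule topos_category_E[OF X])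
    show "\<exists>S\<subseteq>Obj (F0 E X). small U S \<and> small U (Arr (full_subcat (F0 E X) S)) \<and> generating (F0 E X) S \<and>
        closed_under_finite_limits (F0 E X) S \<and> F0 site_diagram X = canonical_site_on (F0 E X) S"
      using S_Obj[OF X] small_S[OF X] EX.small_Arr_full_subcat[OF S_Obj[OF X] small_S[OF X]]
        EX.generating_if_generates[OF S_Obj[OF X] generates_S[OF X]] closed_S[OF X]
      by (intro exI[of _ "S X"]) (simp del: full_subcat_simps)
  next
    fix X Y u v \<gamma> assume X: "X \<in> Ob A" and Y: "Y \<in> Ob A" and g: "\<gamma> \<in> Hom (HomC A X Y) u v"
    have u: "u \<in> Obj (HomC A X Y)" and v: "v \<in> Obj (HomC A X Y)" and gA: "\<gamma> \<in> Arr (HomC A X Y)"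
      using Hom_HomC_Obj[OF X Y g] g by (auto simp: Hom_def)
    \<comment> \<open>A restricted functor already takes values in \<open>sub Y\<close>, so
      composing it with the inclusion leaves its record unchanged. The strict equations then reduce
      to the definitions of the restrictions.\<close>
    have ftor_eq: "ftor_comp (sub X) (inclusion (sub Y)) (res_pull X Y w) = res_pull X Y w"
      if "w \<in> Obj (HomC A X Y)" for w
      using site_ftor_pull[OF X Y that] by (intro ftor_comp_id) (simp add: site_ftor_def)
    have "ncmp (res_cell X Y \<gamma>) K \<in> Arr (sub Y)" if "K \<in> Obj (sub X)" for K
      using nat_trans.ncmp_Arr[OF nat_trans_res_cell[OF X Y g] that] by blast
    then have cell_eq: "whisker_left (sub X) (inclusion (sub Y)) (res_cell X Y \<gamma>) = res_cell X Y \<gamma>"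
      using ftor_eq[OF u] ftor_eq[OF v] pull_cell_trans(2,3)[OF X Y g]
      by (intro ntrans_eqI[of _ "Obj (sub X)"]) (simp_all add: whisker_left_def)
    show "let CX = ucat (F0 site_diagram X); iX = inclusion CX; iY = inclusion (ucat (F0 site_diagram Y))
        in ftor_comp CX (inv_im (fob (FH E Y X) u)) iX = ftor_comp CX iY (fob (FH site_diagram Y X) u) \<and>
           ftor_comp CX (inv_im (fob (FH E Y X) v)) iX = ftor_comp CX iY (fob (FH site_diagram Y X) v) \<and>
           whisker_right CX (gtrans (far (FH E Y X) \<gamma>)) iX = whisker_left CX iY (far (FH site_diagram Y X) \<gamma>)"
      using u v gA ftor_eq[OF u] ftor_eq[OF v] cell_eq
      by (simp add: Let_def pull_def[symmetric] pull_cell_def[symmetric] restrict_ftor_def[symmetric]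
          restrict_ntrans_def[symmetric])
  qed
qed

end
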